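(* Let $r$ be a positive integer, let $a>0$, $\mathbf{w}=(w_1,\dots,w_r)\in\mathbb{R}_{>0}^r$, and let $s=\sigma+it$ with $t\ge2$. Then we have the following uniform bounds as $t\to\infty$: \[ \zeta_r(\sigma+it,a,\mathbf{w})\ll\begin{cases}1 & \text{if } \sigma>r,\\ t^{(r-\sigma)/2}\log t & \text{if } r-1<\sigma\le r,\\ t^{\,r-\sigma-1/2}\log t & \text{if } \sigma\le r-1,\end{cases} \] where the implied constants depend on $a$, $r$ and $\mathbf{w}$.
   Context: The Barnes multiple zeta function is $\zeta_r(s,a,\mathbf{w})=\sum_{m_1,\dots,m_r\ge0}(a+m_1w_1+\cdots+m_rw_r)^{-s}$ for $\Re s>r$, meromorphically continued to all of $\mathbb{C}$ (simple poles at $s=1,\dots,r$). $f\ll g$ means $|f|\le Cg$ for some constant $C$.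
   Formalization: For σ>r and σ≤r−1 the implied constants may also depend on a compact range of σ (σ₁≤σ≤σ₂ with σ₁>r; σ₀≤σ≤r−1), since constants depending only on a, r, w fail as σ→r⁺ and as σ→−∞ (e.g. for the Riemann zeta function); the strip r−1<σ≤r is fully uniform. *)

theory Defs
  imports "HOL-Complex_Analysis.Complex_Analysis"
begin

definition barnes_series :: "nat \<Rightarrow> real \<Rightarrow> (nat \<Rightarrow> real) \<Rightarrow> complex \<Rightarrow> complex" where
  "barnes_series r a w s =
     (\<Sum>\<^sub>\<infinity>m \<in> {..<r} \<rightarrow>\<^sub>E (UNIV :: nat set).
        complex_of_real (a + (\<Sum>i<r. real (m i) * w i)) powr (-s))"

(* Being nicely meromorphic fixes the value of the continuation at its poles (to 0), so that
   the description below determines a single function. *)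
definition barnes_zeta :: "nat \<Rightarrow> real \<Rightarrow> (nat \<Rightarrow> real) \<Rightarrow> complex \<Rightarrow> complex" where
  "barnes_zeta r a w =
     (THE Z. Z nicely_meromorphic_on UNIV \<and>
             (\<forall>s. Re s > real r \<longrightarrow> Z s = barnes_series r a w s))"

end

(*
  With G(z) = exp (- a z) / prod (1 - exp (- w_i z)) and H(z) = z^r G(z), which is holomorphic near 0,
  the Gamma integral along the ray through any u with Re u > 0, followed by r + k integrations by
  parts, gives
    (s - 1) ... (s - r) zeta_r(s)
      = (-1)^(r+k) / Gamma(s + k) * u^(s+k) * int_0^oo x^(s+k-1) H^(r+k)(u x) dx,
  valid for Re s > -k; this is the continuation.  For the bound at height t take u of argument
  pi/2 - 1/t: the exponential factors of u^(s+k) and 1/Gamma cancel, and the ray passes the poles of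
  H on the imaginary axis at distance about x/t.  There H^(r+k) is controlled by powers of
  1/|1 - exp (- w_i u x)|, whose square is essentially a Poisson kernel with an explicit primitive
  along the ray.  Only the lines Re s = r - 1 - j need this, since there |Gamma(s + k)| is known
  exactly from the reflection formula.  The three lines theorem interpolates between these lines,
  and between Re s = r - 1 and Re s = r + 1/log t, where the series itself is O(log t).
*)

theory Submission
  imports Defs "HOL-Real_Asymp.Real_Asymp"
begin

section \<open>Mellin integrals\<close>

text \<open>The obstacle is one power of t. Write q for exp (- w_i u x). Near the poles the
  derivative of order r + k is of size 1/|1 - q|^(2 r + k), and |1 - q| can be as small as a
  multiple of x/t; bounding every factor by its maximum loses a full t. But |1 - q| is that small
  only on a short part of each turn of q, and (1 - |q|^2)/|1 - q|^2 has mean 1 over a circle |q| =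
  const < 1. So two of the factors are kept as a Poisson kernel and integrated, which costs only
  t^(2 r + k - 1) log t. With k = j + 1 on the line Re s = r - 1 - j one has s + k = r + i t, a line
  through an integer whatever j is. The exponents coming from 1/Gamma, from the integral and from
  the division by (s - 1) ... (s - r) add up to (1/2 - r) + (2 r + j) - r = j + 1/2, as claimed
  there. The logarithm stems from the integral of exp (- x/t)/x away from 0; the code trades the
  exponential for x^(- delta) with delta about 1/log t.\<close>

lemma powr_exp_integrable:
  fixes c b :: real
  assumes "c > 0" "b > 0"
  shows "(\<lambda>x. x powr (c - 1) * exp (- (b * x))) integrable_on {0<..}"
proof -
  have "(\<lambda>x. complex_of_real x powr (of_real c - 1) / of_real (exp (b * x))) absolutely_integrable_on {0<..}"
    using absolutely_integrable_Gamma_integral[of "of_real c" b] assms by simp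
  hence "(\<lambda>x. norm (complex_of_real x powr (of_real c - 1) / of_real (exp (b * x)))) integrable_on {0<..}"
    by (simp add: absolutely_integrable_on_def)
  thus ?thesis
    by (rule integrable_eq) (auto simp: norm_divide norm_powr_real_powr exp_minus field_simps)
qed

lemma mellin_absolutely_integrable:
  fixes g :: "real \<Rightarrow> complex"
  assumes "continuous_on {0<..} g" and g: "\<And>x. x > 0 \<Longrightarrow> norm (g x) \<le> M * exp (- (b * x))"
    and "b > 0" "Re p > 0"
  shows "(\<lambda>x. of_real x powr (p - 1) * g x) absolutely_integrable_on {0<..}"
proof (rule measurable_bounded_by_integrable_imp_absolutely_integrable)
  show "(\<lambda>x. of_real x powr (p - 1) * g x) \<in> borel_measurable (lebesgue_on {0<..})"
    by (rule continuous_imp_measurable_on_sets_lebesgue)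
       (use assms(1) in \<open>auto intro!: continuous_intros simp: complex_nonpos_Reals_iff\<close>)
  show "(\<lambda>x. M * (x powr (Re p - 1) * exp (- (b * x)))) integrable_on {0<..}"
    using powr_exp_integrable[of "Re p" b] assms by (intro integrable_on_mult_right) auto
  show "norm (complex_of_real x powr (p - 1) * g x) \<le> M * (x powr (Re p - 1) * exp (- (b * x)))"
    if "x \<in> {0<..}" for x
    using mult_left_mono[OF g[of x], of "x powr (Re p - 1)"] that
    by (simp add: norm_mult norm_powr_real_powr mult_ac)
qed auto

text \<open>The Lipschitz bound says exactly that the difference quotients are dominated by the
  integrable \<open>g\<close>. The limit is tested along sequences because dominated convergence is
  a statement about sequences.\<close>

lemma has_field_derivative_integral_dominated:
  fixes f :: "complex \<Rightarrow> real \<Rightarrow> complex"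
  assumes "\<eta> > 0" and int: "\<And>y. y \<in> ball z \<eta> \<Longrightarrow> f y integrable_on S"
    and der: "\<And>x. x \<in> S \<Longrightarrow> ((\<lambda>y. f y x) has_field_derivative f' x) (at z)"
    and lip: "\<And>y x. y \<in> ball z \<eta> \<Longrightarrow> x \<in> S \<Longrightarrow> norm (f y x - f z x) \<le> norm (y - z) * g x"
    and g: "g integrable_on S"
  shows "((\<lambda>y. integral S (f y)) has_field_derivative integral S f') (at z)"
  unfolding has_field_derivative_iff tendsto_at_iff_sequentially
proof (intro allI impI)
  fix X :: "nat \<Rightarrow> complex"
  assume X: "\<forall>i. X i \<in> UNIV - {z}" "X \<longlonglongrightarrow> z"
  from X(2) \<open>\<eta> > 0\<close> have "eventually (\<lambda>n. X n \<in> ball z \<eta>) sequentially"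
    by (auto simp: tendsto_iff dist_commute)
  then obtain N where N: "\<And>n. n \<ge> N \<Longrightarrow> X n \<in> ball z \<eta>"
    by (auto simp: eventually_sequentially)
  \<comment> \<open>Domination is needed for every index, so the terms outside the ball are dropped;
    \<open>LIMSEQ_offset\<close> restores them at the end.\<close>
  define Y where "Y = (\<lambda>n. X (n + N))"
  have Y: "Y n \<in> ball z \<eta>" "Y n \<noteq> z" for n using N X by (auto simp: Y_def)
  have Ylim: "Y \<longlonglongrightarrow> z" unfolding Y_def using X(2) by (rule LIMSEQ_ignore_initial_segment)
  have I: "(\<lambda>x. (f (Y n) x - f z x) / (Y n - z)) integrable_on S" for n
    using int[OF Y(1), of n] int[of z] \<open>\<eta> > 0\<close>
    by (intro integrable_on_divide integrable_diff) auto
  have "(\<lambda>n. integral S (\<lambda>x. (f (Y n) x - f z x) / (Y n - z))) \<longlonglongrightarrow> integral S f'"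
  proof (rule dominated_convergence(2)[OF I g])
    show "norm ((f (Y n) x - f z x) / (Y n - z)) \<le> g x" if "x \<in> S" for n x
      using lip[OF Y(1)[of n] that] Y(2)[of n] by (simp add: norm_divide field_simps)
    show "(\<lambda>n. (f (Y n) x - f z x) / (Y n - z)) \<longlonglongrightarrow> f' x" if "x \<in> S" for x
    proof -
      have "((\<lambda>y. (f y x - f z x) / (y - z)) \<longlongrightarrow> f' x) (at z)"
        using der[OF that] by (simp add: has_field_derivative_iff)
      thus ?thesis using Y(2) Ylim by (simp add: tendsto_at_iff_sequentially o_def)
    qed
  qed
  also have "(\<lambda>n. integral S (\<lambda>x. (f (Y n) x - f z x) / (Y n - z))) =
      (\<lambda>n. (integral S (f (Y n)) - integral S (f z)) / (Y n - z))"
    using int[OF Y(1)] int[of z] \<open>\<eta> > 0\<close> by (simp add: integral_diff fun_eq_iff)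
  finally have "(\<lambda>n. (integral S (f (X (n + N))) - integral S (f z)) / (X (n + N) - z))
      \<longlonglongrightarrow> integral S f'" by (simp add: Y_def)
  hence "(\<lambda>n. (integral S (f (X n)) - integral S (f z)) / (X n - z)) \<longlonglongrightarrow> integral S f'"
    by (rule LIMSEQ_offset)
  thus "((\<lambda>y. (integral S (f y) - integral S (f z)) / (y - z)) \<circ> X) \<longlonglongrightarrow> integral S f'"
    by (simp add: o_def)
qed

lemma norm_exp_minus_1_le: "norm (exp z - 1) \<le> norm z * exp (norm z)" for z :: complex
proof -
  have "norm (exp z - exp 0) \<le> exp (norm z) * norm (z - 0)"
  proof (rule field_differentiable_bound[of "cball 0 (norm z)" exp exp])
    show "norm (exp y) \<le> exp (norm z)" if "y \<in> cball 0 (norm z)" for y :: complex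
      using that norm_exp[of y] by (smt (verit) exp_le_cancel_iff mem_cball_0)
  qed (auto intro!: derivative_eq_intros)
  thus ?thesis by (simp add: mult.commute)
qed

text \<open>Differentiating x^(p - 1) in p produces a factor ln x, unbounded at both ends of the
  half line. It is absorbed by a small power of x at infinity and a small negative power at
  0.\<close>

lemma abs_ln_mult_exp_le:
  fixes x \<eta> :: real
  assumes "x > 0" "\<eta> > 0"
  shows "\<bar>ln x\<bar> * exp (\<eta> * \<bar>ln x\<bar>) \<le> (x powr (2 * \<eta>) + x powr (- (2 * \<eta>))) / \<eta>"
proof -
  have "\<eta> * \<bar>ln x\<bar> \<le> exp (\<eta> * \<bar>ln x\<bar>)" using exp_ge_add_one_self[of "\<eta> * \<bar>ln x\<bar>"] by linarith
  hence "\<eta> * \<bar>ln x\<bar> * exp (\<eta> * \<bar>ln x\<bar>) \<le> exp (\<eta> * \<bar>ln x\<bar>) * exp (\<eta> * \<bar>ln x\<bar>)"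
    by (intro mult_right_mono) auto
  also have "\<dots> = exp (2 * \<eta> * \<bar>ln x\<bar>)" by (simp flip: exp_add)
  also have "\<dots> \<le> x powr (2 * \<eta>) + x powr (- (2 * \<eta>))"
    using assms by (cases "ln x \<ge> 0") (auto simp: powr_def)
  finally show ?thesis using assms by (simp add: field_simps)
qed

lemma mellin_holomorphic:
  fixes g :: "real \<Rightarrow> complex"
  assumes cont: "continuous_on {0<..} g" and g: "\<And>x. x > 0 \<Longrightarrow> norm (g x) \<le> M * exp (- (b * x))"
    and "b > 0"
  shows "(\<lambda>p. integral {0<..} (\<lambda>x. of_real x powr (p - 1) * g x)) holomorphic_on {p. Re p > 0}"
proof -
  have "(\<lambda>p. integral {0<..} (\<lambda>x. of_real x powr (p - 1) * g x)) field_differentiable (at p)"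
    if p: "Re p > 0" for p
  proof -
    \<comment> \<open>With a quarter of Re p, the exponents Re p - 2 \<eta> and Re p + 2 \<eta> of
      the dominating function are still positive.\<close>
    define \<eta> where "\<eta> = Re p / 4"
    have \<eta>: "\<eta> > 0" using p by (simp add: \<eta>_def)
    have M: "M \<ge> 0" using g[of 1] norm_ge_zero[of "g 1"]
      by (smt (verit) exp_gt_zero mult_nonneg_nonneg zero_le_mult_iff zero_less_one)
    let ?G = "\<lambda>x. M / \<eta> * (x powr (Re p + 2 * \<eta> - 1) * exp (- (b * x)))
                + M / \<eta> * (x powr (Re p - 2 * \<eta> - 1) * exp (- (b * x)))"
    have "((\<lambda>p. integral {0<..} (\<lambda>x. of_real x powr (p - 1) * g x)) has_field_derivative
            integral {0<..} (\<lambda>x. of_real (ln x) * of_real x powr (p - 1) * g x)) (at p)"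
    proof (rule has_field_derivative_integral_dominated[OF \<eta>])
      show "(\<lambda>x. of_real x powr (y - 1) * g x) integrable_on {0<..}" if "y \<in> ball p \<eta>" for y
      proof -
        have "\<bar>Re (p - y)\<bar> < \<eta>" using that abs_Re_le_cmod[of "p - y"] by (simp add: dist_norm)
        hence "Re p - Re y < \<eta>" by (smt (verit) minus_complex.sel(1))
        hence "Re y > 0" using \<eta> unfolding \<eta>_def by linarith
        thus ?thesis using mellin_absolutely_integrable[OF cont g \<open>b > 0\<close>, of y]
          by (simp add: absolutely_integrable_on_def)
      qed
      show "((\<lambda>p. of_real x powr (p - 1) * g x) has_field_derivative
              of_real (ln x) * of_real x powr (p - 1) * g x) (at p)" if "x \<in> {0<..}" for x
        using that by (auto simp: powr_def Ln_of_real intro!: derivative_eq_intros)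
      show "?G integrable_on {0<..}"
        using powr_exp_integrable[of "Re p + 2 * \<eta>" b] powr_exp_integrable[of "Re p - 2 * \<eta>" b] \<eta> \<open>b > 0\<close>
        by (intro integrable_add integrable_on_mult_right) (auto simp: \<eta>_def)
      show "norm (of_real x powr (y - 1) * g x - of_real x powr (p - 1) * g x) \<le> norm (y - p) * ?G x"
        if y: "y \<in> ball p \<eta>" and x: "x \<in> {0<..}" for y x
      proof -
        have x0: "x > 0" using x by simp
        have "of_real x powr (y - 1) = of_real x powr (p - 1) * exp ((y - p) * of_real (ln x))"
          using x0 by (simp add: powr_def Ln_of_real algebra_simps flip: exp_add)
        hence "of_real x powr (y - 1) * g x - of_real x powr (p - 1) * g x =
            of_real x powr (p - 1) * g x * (exp ((y - p) * of_real (ln x)) - 1)"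
          by (simp add: algebra_simps)
        also have "norm \<dots> = x powr (Re p - 1) * norm (g x) * norm (exp ((y - p) * of_real (ln x)) - 1)"
          using x0 by (simp add: norm_mult norm_powr_real_powr)
        also have "\<dots> \<le> x powr (Re p - 1) * (M * exp (- (b * x))) *
            (norm (y - p) * ((x powr (2 * \<eta>) + x powr (- (2 * \<eta>))) / \<eta>))"
        proof (intro mult_mono g[OF x0])
          have "norm (exp ((y - p) * of_real (ln x)) - 1) \<le> norm (y - p) * \<bar>ln x\<bar> * exp (norm (y - p) * \<bar>ln x\<bar>)"
            using norm_exp_minus_1_le[of "(y - p) * of_real (ln x)"] by (simp add: norm_mult)
          also have "\<dots> \<le> norm (y - p) * \<bar>ln x\<bar> * exp (\<eta> * \<bar>ln x\<bar>)"
            using y by (intro mult_left_mono) (auto simp: dist_norm norm_minus_commute mult_right_mono)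
          also have "\<dots> \<le> norm (y - p) * ((x powr (2 * \<eta>) + x powr (- (2 * \<eta>))) / \<eta>)"
            unfolding mult.assoc using abs_ln_mult_exp_le[OF x0 \<eta>] by (intro mult_left_mono) auto
          finally show "norm (exp ((y - p) * of_real (ln x)) - 1) \<le> \<dots>" .
        qed (use M \<eta> in auto)
        also have "\<dots> = norm (y - p) * ?G x"
          using x0 \<eta> by (simp add: field_simps powr_add powr_diff powr_minus)
        finally show ?thesis .
      qed
    qed
    thus ?thesis by (auto simp: field_differentiable_def)
  qed
  thus ?thesis by (auto simp: holomorphic_on_def field_differentiable_at_within)
qed

text \<open>Reduces an integral over the half line to compact intervals, where the fundamental
  theorem of calculus and splitting at a point apply; |f| itself is the dominating function.\<close>

lemma integral_exhaust_tendsto: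
  fixes f :: "real \<Rightarrow> complex"
  assumes f: "f absolutely_integrable_on {0<..}"
  shows "(\<lambda>n. integral {1 / real (Suc n)..real (Suc n)} f) \<longlonglongrightarrow> integral {0<..} f"
proof -
  let ?I = "\<lambda>n. {1 / real (Suc n)..real (Suc n)}"
  have "(\<lambda>n. integral {0<..} (\<lambda>x. if x \<in> ?I n then f x else 0)) \<longlonglongrightarrow> integral {0<..} f"
  proof (rule dominated_convergence(2)[where h = "\<lambda>x. norm (f x)"])
    show "(\<lambda>x. norm (f x)) integrable_on {0<..}" using f by (simp add: absolutely_integrable_on_def)
    show "(\<lambda>x. if x \<in> ?I n then f x else 0) integrable_on {0<..}" for n
    proof -
      have "f absolutely_integrable_on ?I n"
        by (rule set_integrable_subset[OF f]) (auto intro: less_le_trans[of 0 "1 / (1 + real n)"])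
      hence "f integrable_on ({0<..} \<inter> ?I n)"
        by (subst Int_absorb1) (auto simp: absolutely_integrable_on_def intro: less_le_trans[of 0 "1 / (1 + real n)"])
      thus ?thesis by (subst integrable_restrict_Int) (simp add: Int_commute)
    qed
    show "(\<lambda>n. if x \<in> ?I n then f x else 0) \<longlonglongrightarrow> f x" if "x \<in> {0<..}" for x
    proof (rule tendsto_eventually)
      show "\<forall>\<^sub>F n in sequentially. (if x \<in> ?I n then f x else 0) = f x"
        using eventually_gt_at_top[of "nat \<lceil>x\<rceil>"] eventually_gt_at_top[of "nat \<lceil>1/x\<rceil>"]
      proof eventually_elim
        case (elim n)
        hence "x \<le> real (Suc n)" "1 / x \<le> real (Suc n)" by linarith+
        hence "x \<in> ?I n" using that by (simp add: field_simps)
        thus ?case by simp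
      qed
    qed
  qed auto
  moreover have "integral {0<..} (\<lambda>x. if x \<in> ?I n then f x else 0) = integral (?I n) f" for n
    by (subst integral_restrict_Int, rule arg_cong[where f = "\<lambda>S. integral S f"])
      (auto intro: less_le_trans[of 0 "1 / (1 + real n)"])
  ultimately show ?thesis by simp
qed

text \<open>The boundary term x^p g(x) vanishes at 0 because Re p > 0 and at infinity by the
  exponential decay.\<close>

lemma mellin_by_parts:
  fixes g g' :: "real \<Rightarrow> complex"
  assumes der: "\<And>x. x > 0 \<Longrightarrow> (g has_vector_derivative g' x) (at x)"
    and cont: "continuous_on {0<..} g'"
    and g: "\<And>x. x > 0 \<Longrightarrow> norm (g x) \<le> M * exp (- (b * x))"
    and g': "\<And>x. x > 0 \<Longrightarrow> norm (g' x) \<le> M' * exp (- (b' * x))"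
    and b: "b > 0" "b' > 0" and p: "Re p > 0"
  shows "integral {0<..} (\<lambda>x. of_real x powr p * g' x) = - p * integral {0<..} (\<lambda>x. of_real x powr (p - 1) * g x)"
proof -
  have contg: "continuous_on {0<..} g"
    by (rule continuous_on_vector_derivative[OF has_vector_derivative_at_within[OF der]]) auto
  define f1 where "f1 = (\<lambda>x. complex_of_real x powr (p - 1) * g x)"
  define f2 where "f2 = (\<lambda>x. complex_of_real x powr p * g' x)"
  define F where "F = (\<lambda>x. complex_of_real x powr p * g x)"
  have i1: "f1 absolutely_integrable_on {0<..}" unfolding f1_def
    by (rule mellin_absolutely_integrable[OF contg g b(1) p])
  have i2: "f2 absolutely_integrable_on {0<..}" unfolding f2_def
    using mellin_absolutely_integrable[OF cont g' b(2), of "p + 1"] p by simp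
  have i3: "(\<lambda>x. p * f1 x + f2 x) absolutely_integrable_on {0<..}"
    using i1 i2 by (intro set_integral_add absolutely_integrable_scaleR_left) (auto simp: set_integrable_mult_right)
  have F: "(F has_vector_derivative (p * f1 x + f2 x)) (at x)" if "x > 0" for x
  proof -
    have "((\<lambda>x. complex_of_real x powr p) has_vector_derivative (p * of_real x powr (p - 1))) (at x)"
      by (rule has_vector_derivative_real_field) (use that in \<open>auto intro!: derivative_eq_intros simp: complex_nonpos_Reals_iff\<close>)
    from has_vector_derivative_mult[OF this der[OF that]] show ?thesis
      by (simp add: F_def f1_def f2_def algebra_simps)
  qed
  have "integral {1 / real (Suc n)..real (Suc n)} (\<lambda>x. p * f1 x + f2 x) = F (real (Suc n)) - F (1 / real (Suc n))" for n
  proof (intro integral_unique fundamental_theorem_of_calculus)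
    show "1 / real (Suc n) \<le> real (Suc n)" by (simp add: field_simps)
    show "(F has_vector_derivative p * f1 x + f2 x) (at x within {1 / real (Suc n)..real (Suc n)})"
      if "x \<in> {1 / real (Suc n)..real (Suc n)}" for x
    proof (rule has_vector_derivative_at_within[OF F])
      show "x > 0" using that by (auto intro: less_le_trans[of 0 "1 / (1 + real n)"])
    qed
  qed
  with integral_exhaust_tendsto[OF i3]
  have L: "(\<lambda>n. F (real (Suc n)) - F (1 / real (Suc n))) \<longlonglongrightarrow> integral {0<..} (\<lambda>x. p * f1 x + f2 x)"
    by simp
  have nF: "norm (F x) \<le> M * (x powr Re p * exp (- (b * x)))" if "x > 0" for x
    using mult_left_mono[OF g[OF that], of "x powr Re p"] that
    by (simp add: F_def norm_mult norm_powr_real_powr mult_ac)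
  have "(\<lambda>n. F (real (Suc n))) \<longlonglongrightarrow> 0"
  proof (rule Lim_null_comparison)
    show "\<forall>\<^sub>F n in sequentially. norm (F (real (Suc n))) \<le> M * (real (Suc n) powr Re p * exp (- (b * real (Suc n))))"
      using nF by (intro always_eventually) auto
    show "(\<lambda>n. M * (real (Suc n) powr Re p * exp (- (b * real (Suc n))))) \<longlonglongrightarrow> 0"
      using b p by real_asymp
  qed
  moreover have "(\<lambda>n. F (1 / real (Suc n))) \<longlonglongrightarrow> 0"
  proof (rule Lim_null_comparison)
    show "\<forall>\<^sub>F n in sequentially. norm (F (1 / real (Suc n))) \<le> M * ((1 / real (Suc n)) powr Re p * exp (- (b * (1 / real (Suc n)))))"
      by (intro always_eventually allI nF) simp
    show "(\<lambda>n. M * ((1 / real (Suc n)) powr Re p * exp (- (b * (1 / real (Suc n)))))) \<longlonglongrightarrow> 0"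
      using b p by real_asymp
  qed
  ultimately have "(\<lambda>n. F (real (Suc n)) - F (1 / real (Suc n))) \<longlonglongrightarrow> 0 - 0" by (intro tendsto_diff)
  with L have "integral {0<..} (\<lambda>x. p * f1 x + f2 x) = 0"
    using LIMSEQ_unique by fastforce
  also have "integral {0<..} (\<lambda>x. p * f1 x + f2 x) = p * integral {0<..} f1 + integral {0<..} f2"
    using i1 i2 by (subst integral_add) (auto simp: absolutely_integrable_on_def intro: integrable_on_mult_right)
  finally show ?thesis by (simp add: f1_def f2_def eq_neg_iff_add_eq_0 add.commute)
qed

text \<open>For complex l this avoids rotating a contour: as a function of l the integral F
  satisfies F' = - (s/l) F, by differentiation under the integral and one integration by parts.
  Hence l^s F(l) is constant on the half plane, and l = 1 is Euler's integral.\<close>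

lemma laplace_powr_integral:
  fixes s l :: complex
  assumes s: "Re s > 0" and l: "Re l > 0"
  shows "integral {0<..} (\<lambda>x. of_real x powr (s - 1) * exp (- (l * of_real x))) = Gamma s * l powr (- s)"
proof -
  define F where "F = (\<lambda>l. integral {0<..} (\<lambda>x. of_real x powr (s - 1) * exp (- (l * of_real x))))"
  have contexp: "continuous_on {0<..} (\<lambda>x. exp (- (l * complex_of_real x)))" for l
    by (intro continuous_intros)
  have normexp: "norm (exp (- (l * complex_of_real x))) \<le> 1 * exp (- (Re l * x))" for l and x :: real
    by simp
  have dF: "(F has_field_derivative - (s / l) * F l) (at l)" if l: "Re l > 0" for l
  proof -
    \<comment> \<open>On this ball Re y stays positive, and exp (- Re l x) exp (\<eta> x) = exp (-
      \<eta> x) still decays.\<close>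
    define \<eta> where "\<eta> = Re l / 2"
    have \<eta>: "\<eta> > 0" using l by (simp add: \<eta>_def)
    have "((\<lambda>l. integral {0<..} (\<lambda>x. of_real x powr (s - 1) * exp (- (l * of_real x)))) has_field_derivative
            integral {0<..} (\<lambda>x. of_real x powr (s - 1) * (- of_real x * exp (- (l * of_real x))))) (at l)"
    proof (rule has_field_derivative_integral_dominated[OF \<eta>])
      show "(\<lambda>x. of_real x powr (s - 1) * exp (- (y * of_real x))) integrable_on {0<..}" if "y \<in> ball l \<eta>" for y
      proof -
        have "\<bar>Re (l - y)\<bar> < \<eta>" using that abs_Re_le_cmod[of "l - y"] by (simp add: dist_norm)
        hence "Re l - Re y < \<eta>" by (smt (verit) minus_complex.sel(1))
        hence "Re y > 0" using \<eta> unfolding \<eta>_def by linarith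
        thus ?thesis using mellin_absolutely_integrable[OF contexp normexp _ s, of y]
          by (simp add: absolutely_integrable_on_def)
      qed
      show "((\<lambda>l. of_real x powr (s - 1) * exp (- (l * of_real x))) has_field_derivative
              of_real x powr (s - 1) * (- of_real x * exp (- (l * of_real x)))) (at l)" for x
        by (auto intro!: derivative_eq_intros)
      show "(\<lambda>x. x powr (Re s + 1 - 1) * exp (- (\<eta> * x))) integrable_on {0<..}"
        using powr_exp_integrable[of "Re s + 1" \<eta>] s \<eta> by simp
      show "norm (of_real x powr (s - 1) * exp (- (y * of_real x)) - of_real x powr (s - 1) * exp (- (l * of_real x)))
          \<le> norm (y - l) * (x powr (Re s + 1 - 1) * exp (- (\<eta> * x)))"
        if y: "y \<in> ball l \<eta>" and x: "x \<in> {0<..}" for y x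
      proof -
        have x0: "x > 0" using x by simp
        have "exp (- (y * of_real x)) = exp (- (l * of_real x)) * exp ((l - y) * of_real x)"
          by (simp add: algebra_simps flip: exp_add)
        hence "of_real x powr (s - 1) * exp (- (y * of_real x)) - of_real x powr (s - 1) * exp (- (l * of_real x))
           = of_real x powr (s - 1) * exp (- (l * of_real x)) * (exp ((l - y) * of_real x) - 1)"
          by (simp add: algebra_simps)
        also have "norm \<dots> = x powr (Re s - 1) * exp (- (Re l * x)) * norm (exp ((l - y) * of_real x) - 1)"
          using x0 by (simp add: norm_mult norm_powr_real_powr)
        also have "\<dots> \<le> x powr (Re s - 1) * exp (- (Re l * x)) * (norm (y - l) * x * exp (\<eta> * x))"
        proof (intro mult_left_mono)
          have "norm (exp ((l - y) * of_real x) - 1) \<le> norm (y - l) * x * exp (norm (y - l) * x)"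
            using norm_exp_minus_1_le[of "(l - y) * of_real x"] x0 by (simp add: norm_mult norm_minus_commute)
          also have "\<dots> \<le> norm (y - l) * x * exp (\<eta> * x)"
            using y x0 by (intro mult_left_mono) (auto simp: dist_norm norm_minus_commute mult_right_mono)
          finally show "norm (exp ((l - y) * of_real x) - 1) \<le> \<dots>" .
        qed auto
        also have "\<dots> = norm (y - l) * (x powr (Re s + 1 - 1) * exp (- (\<eta> * x)))"
        proof -
          have 1: "exp (- (\<eta> * x)) = exp (- (Re l * x)) * exp (\<eta> * x)"
            by (simp add: \<eta>_def flip: exp_add)
          have 2: "x powr (Re s + 1 - 1) = x powr (Re s - 1) * x" using x0 by (simp add: powr_diff)
          show ?thesis unfolding 1 2 by (simp only: mult_ac)
        qed
        finally show ?thesis .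
      qed
    qed
    moreover have "integral {0<..} (\<lambda>x. of_real x powr (s - 1) * (- of_real x * exp (- (l * of_real x)))) = - (s / l) * F l"
    proof -
      have "integral {0<..} (\<lambda>x. of_real x powr s * (- l * exp (- (l * of_real x)))) = - s * F l"
        unfolding F_def
      proof (rule mellin_by_parts[where b = "Re l" and M = 1 and b' = "Re l" and M' = "norm l"])
        show "((\<lambda>x. exp (- (l * complex_of_real x))) has_vector_derivative - l * exp (- (l * complex_of_real x))) (at x)" for x
          by (rule has_vector_derivative_real_field) (auto intro!: derivative_eq_intros)
        show "norm (- l * exp (- (l * complex_of_real x))) \<le> norm l * exp (- (Re l * x))" for x
          by (simp add: norm_mult)
      qed (use l s in \<open>auto intro!: continuous_intros\<close>)
      moreover have "integral {0<..} (\<lambda>x. of_real x powr s * (- l * exp (- (l * of_real x)))) =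
         integral {0<..} (\<lambda>x. l * (of_real x powr (s - 1) * (- of_real x * exp (- (l * of_real x)))))"
        by (rule integral_cong) (simp add: powr_diff)
      ultimately show ?thesis using l by (auto simp: field_simps)
    qed
    ultimately show ?thesis unfolding F_def by simp
  qed
  have "((\<lambda>l. l powr s * F l) has_field_derivative 0) (at l within {l. Re l > 0})" if "l \<in> {l. Re l > 0}" for l
  proof -
    from that have "Re l > 0" "l \<noteq> 0" "l \<notin> \<real>\<^sub>\<le>\<^sub>0" by (auto simp: complex_nonpos_Reals_iff)
    hence "((\<lambda>l. l powr s * F l) has_field_derivative 0) (at l)"
      by (auto intro!: derivative_eq_intros dF simp: powr_diff field_simps)
    thus ?thesis by (rule has_field_derivative_at_within)
  qed
  from has_field_derivative_zero_constant[OF convex_halfspace_Re_gt this]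
  obtain c where c: "l powr s * F l = c" if "Re l > 0" for l by auto
  have "F 1 = Gamma s"
  proof -
    have "F 1 = integral {0<..} (\<lambda>x. of_real x powr (s - 1) / of_real (exp x))"
      unfolding F_def by (rule integral_cong) (simp add: exp_minus field_simps flip: exp_of_real)
    thus ?thesis using Gamma_integral_complex'[OF s] by (simp add: integral_unique)
  qed
  with c[of 1] c[OF l] have "l powr s * F l = Gamma s" by simp
  moreover have "l \<noteq> 0" using l by auto
  ultimately show ?thesis unfolding F_def by (simp add: powr_minus field_simps)
qed

lemma powr_exp_integral:
  fixes c b :: real
  assumes "c > 0" "b > 0"
  shows "integral {0<..} (\<lambda>x. x powr (c - 1) * exp (- (b * x))) = Gamma c * b powr (- c)"
proof -
  have "complex_of_real (integral {0<..} (\<lambda>x. x powr (c - 1) * exp (- (b * x)))) =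
     integral {0<..} (\<lambda>x. complex_of_real (x powr (c - 1) * exp (- (b * x))))"
    using integral_linear[OF powr_exp_integrable[OF assms] bounded_linear_of_real, symmetric] by (simp add: o_def)
  also have "\<dots> = integral {0<..} (\<lambda>x. of_real x powr (of_real c - 1) * exp (- (of_real b * of_real x)))"
    by (rule integral_cong) (auto simp: powr_of_real[symmetric] exp_of_real[symmetric])
  also have "\<dots> = Gamma (of_real c) * of_real b powr (- of_real c)"
    by (rule laplace_powr_integral) (use assms in auto)
  also have "\<dots> = of_real (Gamma c * b powr (- c))"
    using assms by (simp add: Gamma_complex_of_real powr_of_real[symmetric])
  finally show ?thesis by (simp only: of_real_eq_iff)
qed

lemma mellin_norm_le:
  fixes g :: "real \<Rightarrow> complex"
  assumes cont: "continuous_on {0<..} g" and g: "\<And>x. x > 0 \<Longrightarrow> norm (g x) \<le> M * exp (- (b * x))"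
    and b: "b > 0" and p: "Re p > 0"
  shows "norm (integral {0<..} (\<lambda>x. of_real x powr (p - 1) * g x)) \<le> M * (Gamma (Re p) * b powr (- Re p))"
proof -
  have "norm (integral {0<..} (\<lambda>x. of_real x powr (p - 1) * g x)) \<le>
      integral {0<..} (\<lambda>x. M * (x powr (Re p - 1) * exp (- (b * x))))"
  proof (rule integral_norm_bound_integral)
    show "(\<lambda>x. of_real x powr (p - 1) * g x) integrable_on {0<..}"
      using mellin_absolutely_integrable[OF cont g b p] by (simp add: absolutely_integrable_on_def)
    show "(\<lambda>x. M * (x powr (Re p - 1) * exp (- (b * x)))) integrable_on {0<..}"
      using powr_exp_integrable[of "Re p" b] b p by (intro integrable_on_mult_right) auto
    show "norm (of_real x powr (p - 1) * g x) \<le> M * (x powr (Re p - 1) * exp (- (b * x)))" if "x \<in> {0<..}" for x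
      using mult_left_mono[OF g[of x], of "x powr (Re p - 1)"] that
      by (simp add: norm_mult norm_powr_real_powr mult_ac)
  qed
  also have "\<dots> = M * (Gamma (Re p) * b powr (- Re p))"
    using powr_exp_integral[OF p b] by simp
  finally show ?thesis .
qed

section \<open>Convexity in a rectangle and the growth of 1/Gamma\<close>

text \<open>A local form of the three lines theorem, since the bounds A and B available later depend
  on the height T. The function f is divided by the exponential interpolating A and B and multiplied
  by exp ((s - s0)^2), of modulus exp ((x - \<sigma>)^2 - (y - T)^2). The latter supplies a factor
  exp (- R^2) on the horizontal sides, so a crude bound suffices there. The maximum modulus
  principle does the rest.\<close>

lemma three_lines_rectangle:
  fixes f :: "complex \<Rightarrow> complex"
  assumes "\<alpha> < \<beta>" "R > 0" "A > 0" "B > 0"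
    and hol: "f holomorphic_on S" "cbox (Complex \<alpha> (T - R)) (Complex \<beta> (T + R)) \<subseteq> S"
    and left: "\<And>y. \<bar>y - T\<bar> \<le> R \<Longrightarrow> norm (f (Complex \<alpha> y)) \<le> A"
    and right: "\<And>y. \<bar>y - T\<bar> \<le> R \<Longrightarrow> norm (f (Complex \<beta> y)) \<le> B"
    and horiz: "\<And>x y. \<alpha> \<le> x \<Longrightarrow> x \<le> \<beta> \<Longrightarrow> \<bar>y - T\<bar> = R \<Longrightarrow> norm (f (Complex x y)) \<le> exp (R\<^sup>2) * min A B"
    and \<sigma>: "\<alpha> \<le> \<sigma>" "\<sigma> \<le> \<beta>"
  shows "norm (f (Complex \<sigma> T)) \<le> exp ((\<beta> - \<alpha>)\<^sup>2) *
           (A powr ((\<beta> - \<sigma>) / (\<beta> - \<alpha>)) * B powr ((\<sigma> - \<alpha>) / (\<beta> - \<alpha>)))"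
proof -
  define s0 where "s0 = Complex \<sigma> T"
  define h where "h = (\<lambda>x. (\<beta> - x) / (\<beta> - \<alpha>) * ln A + (x - \<alpha>) / (\<beta> - \<alpha>) * ln B)"
  define F where "F = (\<lambda>s. f s * exp ((s - s0)\<^sup>2) *
     exp (- ((of_real \<beta> - s) / of_real (\<beta> - \<alpha>) * of_real (ln A) + (s - of_real \<alpha>) / of_real (\<beta> - \<alpha>) * of_real (ln B))))"
  have nF: "norm (F (Complex x y)) = norm (f (Complex x y)) * exp ((x - \<sigma>)\<^sup>2 - (y - T)\<^sup>2) * exp (- h x)" for x y
    by (simp add: F_def norm_mult s0_def h_def power2_eq_square)
  let ?Q = "cbox (Complex \<alpha> (T - R)) (Complex \<beta> (T + R))"
  have sq: "(x - \<sigma>)\<^sup>2 \<le> (\<beta> - \<alpha>)\<^sup>2" if "\<alpha> \<le> x" "x \<le> \<beta>" for x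
    using that \<sigma> by (intro power2_le_iff_abs_le[THEN iffD2]) auto
  have "norm (F s0) \<le> exp ((\<beta> - \<alpha>)\<^sup>2)"
  proof (rule maximum_modulus_frontier[of F ?Q])
    have "F holomorphic_on S" unfolding F_def using hol(1) by (intro holomorphic_intros) (use \<open>\<alpha> < \<beta>\<close> in auto)
    hence *: "F holomorphic_on ?Q" using hol(2) by (rule holomorphic_on_subset)
    show "F holomorphic_on interior ?Q" by (rule holomorphic_on_subset[OF *]) (rule interior_subset)
    show "continuous_on (closure ?Q) F" using holomorphic_on_imp_continuous_on[OF *] by simp
    show "s0 \<in> ?Q" using \<sigma> \<open>R > 0\<close> by (auto simp: s0_def in_cbox_complex_iff)
    show "norm (F z) \<le> exp ((\<beta> - \<alpha>)\<^sup>2)" if "z \<in> frontier ?Q" for z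
    proof -
      obtain x y where z: "z = Complex x y" by (cases z)
      from that have xy: "\<alpha> \<le> x" "x \<le> \<beta>" "\<bar>y - T\<bar> \<le> R" and c: "x = \<alpha> \<or> x = \<beta> \<or> \<bar>y - T\<bar> = R"
        by (auto simp: frontier_cbox in_cbox_complex_iff in_box_complex_iff z)
      have sq': "(x - \<sigma>)\<^sup>2 - (y - T)\<^sup>2 \<le> (\<beta> - \<alpha>)\<^sup>2"
        using sq[OF xy(1,2)] zero_le_power2[of "y - T"] by linarith
      from c consider "x = \<alpha>" | "x = \<beta>" | "\<bar>y - T\<bar> = R" by auto
      thus ?thesis
      proof cases
        case 1
        have "norm (F z) \<le> A * exp ((\<beta> - \<alpha>)\<^sup>2) * exp (- h x)"
          unfolding z nF using left[OF xy(3)] sq' 1 \<open>A > 0\<close>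
          by (intro mult_mono mult_nonneg_nonneg) auto
        also have "h x = ln A" using \<open>\<alpha> < \<beta>\<close> 1 by (simp add: h_def)
        finally show ?thesis using \<open>A > 0\<close> by (simp add: exp_minus field_simps)
      next
        case 2
        have "norm (F z) \<le> B * exp ((\<beta> - \<alpha>)\<^sup>2) * exp (- h x)"
          unfolding z nF using right[OF xy(3)] sq' 2 \<open>B > 0\<close>
          by (intro mult_mono mult_nonneg_nonneg) auto
        also have "h x = ln B" using \<open>\<alpha> < \<beta>\<close> 2 by (simp add: h_def)
        finally show ?thesis using \<open>B > 0\<close> by (simp add: exp_minus field_simps)
      next
        case 3
        hence y2: "(y - T)\<^sup>2 = R\<^sup>2" by (metis power2_abs)
        define m where "m = ln (min A B)"
        have m: "m \<le> ln A" "m \<le> ln B" using \<open>A > 0\<close> \<open>B > 0\<close> by (auto simp: m_def)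
        have "h x \<ge> (\<beta> - x) / (\<beta> - \<alpha>) * m + (x - \<alpha>) / (\<beta> - \<alpha>) * m"
          unfolding h_def using xy \<open>\<alpha> < \<beta>\<close> m by (intro add_mono mult_left_mono) auto
        also have "(\<beta> - x) / (\<beta> - \<alpha>) * m + (x - \<alpha>) / (\<beta> - \<alpha>) * m = m"
          unfolding distrib_right[symmetric] add_divide_distrib[symmetric] using \<open>\<alpha> < \<beta>\<close> by simp
        finally have hm: "h x \<ge> m" .
        have "norm (F z) \<le> (exp (R\<^sup>2) * min A B) * exp ((\<beta> - \<alpha>)\<^sup>2 - R\<^sup>2) * exp (- m)"
          unfolding z nF using horiz[OF xy(1,2) 3] sq[OF xy(1,2)] y2 hm \<open>A > 0\<close> \<open>B > 0\<close>
          by (intro mult_mono mult_nonneg_nonneg) auto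
        also have "\<dots> = exp ((\<beta> - \<alpha>)\<^sup>2)" using \<open>A > 0\<close> \<open>B > 0\<close>
          by (simp add: m_def exp_minus exp_diff)
        finally show ?thesis .
      qed
    qed
  qed auto
  also have "norm (F s0) = norm (f (Complex \<sigma> T)) * exp (- h \<sigma>)" unfolding s0_def nF by simp
  finally have "norm (f (Complex \<sigma> T)) \<le> exp ((\<beta> - \<alpha>)\<^sup>2) * exp (h \<sigma>)"
    by (simp add: exp_minus field_simps)
  also have "exp (h \<sigma>) = A powr ((\<beta> - \<sigma>) / (\<beta> - \<alpha>)) * B powr ((\<sigma> - \<alpha>) / (\<beta> - \<alpha>))"
    using \<open>A > 0\<close> \<open>B > 0\<close> by (simp add: h_def powr_def exp_add)
  finally show ?thesis .
qed

text \<open>On the imaginary axis - z is the conjugate of z, so the reflection formula for 1/(Gamma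
  z Gamma (- z)) computes |1/Gamma z|^2 itself. The recurrence then moves to real part n, each
  factor z + i having modulus at least t.\<close>

lemma norm_rGamma_integer_line_le:
  assumes t: "t > 0"
  shows "norm (rGamma (Complex (real n) t)) \<le> t powr (1/2 - real n) * exp (pi * t / 2)"
proof -
  let ?z = "Complex 0 t"
  have "rGamma (- ?z) = cnj (rGamma ?z)"
  proof -
    have "- ?z = cnj ?z" by (simp add: complex_eq_iff)
    thus ?thesis by (metis rGamma_complex_altdef complex_cnj_cnj cnj_rGamma)
  qed
  hence "(norm (rGamma ?z))\<^sup>2 = norm (rGamma ?z * rGamma (- ?z))"
    by (simp add: norm_mult power2_eq_square)
  also have "\<dots> = t * norm (sin (of_real pi * ?z)) / pi"
    using t by (simp add: rGamma_reflection_complex' norm_mult norm_divide complex_norm)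
  also have "\<dots> \<le> t * exp (pi * t) / 1"
  proof (intro divide_left_mono frac_le mult_left_mono)
    show "norm (sin (of_real pi * ?z)) \<le> exp (pi * t)"
      using cmod_sin_le_exp[of 1 "of_real pi * ?z"] t by simp
  qed (use t pi_gt3 in auto)
  also have "\<dots> = (t powr (1/2) * exp (pi * t / 2))\<^sup>2"
    using t by (simp add: power_mult_distrib powr_half_sqrt exp_double[symmetric])
  finally have 1: "norm (rGamma ?z) \<le> t powr (1/2) * exp (pi * t / 2)"
    by (rule power2_le_imp_le) simp
  have zn: "?z + of_nat n = Complex (real n) t" by (simp add: complex_eq_iff)
  have "rGamma ?z = pochhammer ?z n * rGamma (Complex (real n) t)"
    using pochhammer_rGamma[of ?z n] by (simp add: zn)
  moreover have "t ^ n \<le> norm (pochhammer ?z n)"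
  proof -
    have "(\<Prod>i<n. t) \<le> (\<Prod>i<n. norm (?z + of_nat i))"
      by (rule prod_mono) (use t abs_Im_le_cmod[of "?z + of_nat i" for i] in auto)
    thus ?thesis by (simp add: pochhammer_prod prod_norm atLeast0LessThan)
  qed
  ultimately have "t ^ n * norm (rGamma (Complex (real n) t)) \<le> t powr (1/2) * exp (pi * t / 2)"
    using 1 by (smt (verit) mult_right_mono norm_ge_zero norm_mult)
  hence "norm (rGamma (Complex (real n) t)) \<le> t powr (1/2) * exp (pi * t / 2) / t ^ n"
    using t by (simp add: field_simps)
  also have "\<dots> = t powr (1/2 - real n) * exp (pi * t / 2)"
    using t by (simp add: powr_diff powr_realpow)
  finally show ?thesis .
qed

text \<open>Only needed on the horizontal sides of the rectangles, hence exp (pi t) instead of the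
  true order exp (pi t / 2) times a power. After a shift to the left by N, 1 - z has real part at
  least 1, where |Gamma| is at most Gamma of the real part; reflection then gives the claim.\<close>

lemma norm_rGamma_vertical_strip_le:
  "\<exists>C. \<forall>x \<in> {x0..x1}. \<forall>t \<ge> 1. norm (rGamma (Complex x t)) \<le> C * exp (pi * t)"
proof -
  define N where "N = nat \<lceil>x1\<rceil>"
  have N: "x1 \<le> real N" unfolding N_def by linarith
  have "continuous_on {x0..x1} (\<lambda>x. Gamma (1 - x + real N))"
    using N by (intro continuous_on_compose2[OF continuous_on_Gamma[of "{0<..}"]] continuous_intros)
      (auto elim!: nonpos_Ints_cases)
  from continuous_on_compact_bound[OF compact_Icc this]
  obtain C where C: "C \<ge> 0" "\<And>x. x \<in> {x0..x1} \<Longrightarrow> \<bar>Gamma (1 - x + real N)\<bar> \<le> C" by auto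
  show ?thesis
  proof (intro exI[of _ C] ballI allI impI)
    fix x t :: real assume x: "x \<in> {x0..x1}" and t: "t \<ge> 1"
    let ?z = "Complex x t - of_nat N"
    have "rGamma ?z = pochhammer ?z N * rGamma (Complex x t)"
      using pochhammer_rGamma[of ?z N] by simp
    moreover have "1 \<le> norm (pochhammer ?z N)"
    proof -
      have "(\<Prod>i<N. 1) \<le> (\<Prod>i<N. norm (?z + of_nat i))"
      proof (rule prod_mono)
        fix i show "0 \<le> (1::real) \<and> 1 \<le> norm (?z + of_nat i)"
          using t abs_Im_le_cmod[of "?z + of_nat i"] by simp
      qed
      thus ?thesis by (simp add: pochhammer_prod prod_norm atLeast0LessThan)
    qed
    ultimately have "norm (rGamma (Complex x t)) \<le> norm (rGamma ?z)"
      by (simp add: norm_mult mult_le_cancel_right1)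
    also have "\<dots> \<le> C * exp (pi * t)"
    proof -
      have re: "Re (1 - ?z) > 0" using x N by simp
      hence "1 - ?z \<notin> \<real>\<^sub>\<le>\<^sub>0" by (simp add: complex_nonpos_Reals_iff)
      hence "1 - ?z \<notin> \<int>\<^sub>\<le>\<^sub>0" using nonpos_Ints_subset_nonpos_Reals by blast
      hence "Gamma (1 - ?z) * rGamma (1 - ?z) = 1"
        by (simp only: rGamma_inverse_Gamma right_inverse Gamma_eq_zero_iff not_False_eq_True)
      hence "rGamma ?z = Gamma (1 - ?z) * (rGamma ?z * rGamma (1 - ?z))"
        by (metis mult.left_commute mult.right_neutral)
      hence "rGamma ?z = Gamma (1 - ?z) * sin (of_real pi * ?z) / of_real pi"
        unfolding rGamma_reflection_complex by simp
      hence "norm (rGamma ?z) = norm (Gamma (1 - ?z)) * (norm (sin (of_real pi * ?z)) / pi)"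
        by (simp add: norm_mult norm_divide)
      also have "\<dots> \<le> C * (exp (pi * t) / 1)"
      proof (intro mult_mono frac_le)
        show "norm (sin (of_real pi * ?z)) \<le> exp (pi * t)"
          using cmod_sin_le_exp[of 1 "of_real pi * ?z"] t by simp
        have "norm (Gamma (1 - ?z)) \<le> Gamma (Re (1 - ?z))"
        proof -
          have g: "Gamma (1 - ?z) = integral {0<..} (\<lambda>x. of_real x powr ((1 - ?z) - 1) * exp (- (1 * of_real x)))"
            using laplace_powr_integral[OF re, of 1] by simp
          show ?thesis unfolding g
            using mellin_norm_le[of "\<lambda>x. exp (- (1 * of_real x))" 1 1 "1 - ?z"] re
            by (simp add: continuous_intros)
        qed
        also have "\<dots> \<le> C" using C(2)[OF x] by (simp add: algebra_simps)
        finally show "norm (Gamma (1 - ?z)) \<le> C" .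
      qed (use C(1) pi_gt3 in auto)
      finally show ?thesis by simp
    qed
    finally show "norm (rGamma (Complex x t)) \<le> C * exp (pi * t)" .
  qed
qed

section \<open>Uniqueness of the meromorphic continuation\<close>

text \<open>Justifies the definite description in \<open>barnes_zeta\<close>. The identity theorem
  gives equality on punctured neighbourhoods; the value at the centre is then forced, being 0 at a
  pole and the limit elsewhere.\<close>

lemma nicely_meromorphic_unique:
  assumes f: "f nicely_meromorphic_on UNIV" and g: "g nicely_meromorphic_on UNIV"
    and A: "open A" "A \<noteq> {}" and eq: "\<And>z. z \<in> A \<Longrightarrow> f z = g z"
  shows "f = g"
proof
  fix z
  define h where "h = (\<lambda>z. f z - g z)"
  have h: "h meromorphic_on UNIV" unfolding h_def
    using f g by (intro meromorphic_intros) (auto simp: nicely_meromorphic_on_def)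
  \<comment> \<open>The difference of two nicely meromorphic functions need not be one: where two
    poles cancel, h has value 0, which may differ from its limit.\<close>
  hence h': "remove_sings h nicely_meromorphic_on UNIV" by (rule remove_sings_nicely_meromorphic)
  obtain z0 where z0: "z0 \<in> A" using A by auto
  have "eventually (\<lambda>z. remove_sings h z = h z) (at z0)"
    using eventually_remove_sings_eq[OF h] by (simp add: eventually_cosparse_open_eq)
  moreover have "eventually (\<lambda>z. z \<in> A) (at z0)" using A z0 eventually_at_in_open' by blast
  ultimately have "eventually (\<lambda>z. remove_sings h z = 0) (at z0)"
    by eventually_elim (use eq in \<open>auto simp: h_def\<close>)
  hence "frequently (\<lambda>z. remove_sings h z = 0) (at z0)" by (rule eventually_frequently[rotated]) auto
  hence z: "remove_sings h w = 0" for w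
    by (rule frequently_eq_meromorphic_imp_constant[OF _ h' open_UNIV connected_UNIV UNIV_I UNIV_I])
  have "eventually (\<lambda>w. remove_sings h w = h w) (at z)"
    using eventually_remove_sings_eq[OF h] by (simp add: eventually_cosparse_open_eq)
  hence ev: "eventually (\<lambda>w. f w = g w) (at z)" by eventually_elim (use z in \<open>auto simp: h_def\<close>)
  have pole: "is_pole f z \<longleftrightarrow> is_pole g z" by (rule is_pole_cong[OF ev refl])
  have lim: "(f \<longlongrightarrow> c) (at z) \<longleftrightarrow> (g \<longlongrightarrow> c) (at z)" for c by (rule tendsto_cong[OF ev])
  have nolim: "\<not> (f \<longlongrightarrow> c) (at z)" if "is_pole f z" for c
    using that not_tendsto_and_filterlim_at_infinity[of "at z" f c] by (auto simp: is_pole_def)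
  from f g have "is_pole f z \<and> f z = 0 \<or> f \<midarrow>z\<rightarrow> f z" "is_pole g z \<and> g z = 0 \<or> g \<midarrow>z\<rightarrow> g z"
    by (auto simp: nicely_meromorphic_on_def)
  with pole lim nolim show "f z = g z" by (metis LIM_unique)
qed

section \<open>The generating function and its derivatives\<close>

text \<open>Its reciprocal z/(1 - exp (- z)) is the Bernoulli generating function (with B_1 = 1/2).
  One such factor per weight distributes z^r over the product in \<open>H\<close>, so that
  \<open>H\<close> is defined and holomorphic at 0 as it stands.\<close>

definition expq :: "complex \<Rightarrow> complex" where
  "expq z = (if z = 0 then 1 else (1 - exp (- z)) / z)"

text \<open>Off 0 this is the difference quotient of - exp (- z) at 0, whose holomorphic extension
  takes the derivative, 1, as its value there.\<close>

lemma holomorphic_expq: "expq holomorphic_on UNIV"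
proof -
  have "(\<lambda>z. if z = 0 then deriv (\<lambda>z. - exp (- z)) 0 else (- exp (- z) - (- exp (- 0))) / (z - 0)) holomorphic_on (UNIV :: complex set)"
    by (rule pole_lemma_open) (auto intro!: holomorphic_intros)
  moreover have "deriv (\<lambda>z::complex. - exp (- z)) 0 = 1"
    by (rule DERIV_imp_deriv) (auto intro!: derivative_eq_intros)
  ultimately show ?thesis by (simp add: expq_def[abs_def] if_distrib cong: if_cong)
qed

text \<open>The zeros of 1 - exp (- z) are the multiples of 2 pi i; among these only 0 is compatible
  with the hypothesis, and there the value is 1.\<close>

lemma expq_nonzero:
  assumes "Re z > 0 \<or> norm z < 2 * pi"
  shows "expq z \<noteq> 0"
proof (cases "z = 0")
  case False
  have "exp (- z) \<noteq> 1"
  proof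
    assume "exp (- z) = 1"
    then obtain n :: int where n: "Re z = 0" "Im (- z) = of_int (2 * n) * pi"
      by (auto simp: exp_eq_1)
    have "\<bar>Im z\<bar> < 2 * pi" using assms n(1) abs_Im_le_cmod[of z] by linarith
    moreover have "\<bar>Im z\<bar> = 2 * pi * \<bar>of_int n\<bar>" 
    proof -
      have "- Im z = 2 * of_int n * pi" using n(2) by simp
      hence "Im z = - (2 * of_int n * pi)" by linarith
      thus ?thesis by (simp add: abs_mult)
    qed
    ultimately have "\<bar>of_int n :: real\<bar> < 1" by simp
    hence "n = 0" by linarith
    with n False show False by (simp add: complex_eq_iff)
  qed
  thus ?thesis using False by (simp add: expq_def)
qed (simp add: expq_def)

lemma power_mult_exp_bounded:
  fixes b c :: real
  assumes "b > 0" "c \<ge> 0"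
  shows "\<exists>C\<ge>0. \<forall>x\<ge>0. (x + c) ^ n * exp (- (b * x)) \<le> C"
proof (cases "n = 0")
  case False
  \<comment> \<open>The constant comes from (1 + Y/n)^n \<le> exp Y applied with Y = b (x +
    c).\<close>
  show ?thesis
  proof (intro exI[of _ "(real n / b) ^ n * exp (b * c)"] conjI allI impI)
    fix x :: real assume x: "x \<ge> 0"
    let ?y = "b * (x + c)"
    have "(?y / real n) ^ n \<le> (1 + ?y / real n) ^ n"
      using assms x by (intro power_mono) auto
    also have "\<dots> \<le> exp ?y"
      using assms x False by (intro exp_ge_one_plus_x_over_n_power_n) (auto intro: order_trans[of _ 0])
    also have "\<dots> = exp (b * x) * exp (b * c)" by (simp add: algebra_simps flip: exp_add)
    also have "(?y / real n) ^ n = (x + c) ^ n * (b / real n) ^ n" by (simp add: mult.commute flip: power_mult_distrib)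
    finally have "(x + c) ^ n * (b / real n) ^ n \<le> exp (b * x) * exp (b * c)" .
    thus "(x + c) ^ n * exp (- (b * x)) \<le> (real n / b) ^ n * exp (b * c)"
      using assms False by (simp add: exp_minus field_simps power_divide)
  qed (use assms in auto)
qed (use assms in \<open>auto intro!: exI[of _ 1]\<close>)

text \<open>Turns a power of a sum over the weights into a sum of powers, so that each weight can
  later be treated by its own Poisson kernel. The proof compares all terms with the largest
  one.\<close>

lemma sum_power_le_power_mult_sum:
  fixes y :: "nat \<Rightarrow> real"
  assumes "r > 0" "\<And>i. i < r \<Longrightarrow> y i \<ge> 0"
  shows "(\<Sum>i<r. y i) ^ N \<le> real r ^ N * (\<Sum>i<r. y i ^ N)"
proof -
  obtain j where j: "j < r" "\<And>i. i < r \<Longrightarrow> y i \<le> y j"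
  proof -
    have "Max (y ` {..<r}) \<in> y ` {..<r}" using assms(1) by (intro Max_in) auto
    then obtain j where "j < r" "y j = Max (y ` {..<r})" by auto
    thus ?thesis using that by simp
  qed
  have "(\<Sum>i<r. y i) ^ N \<le> (real r * y j) ^ N"
    using sum_bounded_above[of "{..<r}" y "y j"] j assms by (intro power_mono sum_nonneg) auto
  also have "\<dots> = real r ^ N * y j ^ N" by (simp add: power_mult_distrib)
  also have "y j ^ N \<le> (\<Sum>i<r. y i ^ N)"
    using j assms by (intro member_le_sum) auto
  finally show ?thesis by (simp add: mult_left_mono)
qed

text \<open>|1 - exp (- c z)| changes at most by a factor 2 on a disc whose radius is a quarter of
  its own size over c. As this size is at most 2, c |\<zeta> - z| \<le> 1/2, and the exponential in
  \<open>norm_exp_minus_1_le\<close> costs at most 2.\<close>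

lemma norm_one_minus_exp_perturb:
  fixes z \<zeta> :: complex and c :: real
  assumes "c > 0" "Re z > 0" and "c * norm (\<zeta> - z) \<le> norm (1 - exp (- (c * z))) / 4"
  shows "norm (1 - exp (- (c * \<zeta>))) \<ge> norm (1 - exp (- (c * z))) / 2"
proof -
  let ?y = "norm (1 - exp (- (of_real c * z)))"
  have q: "norm (exp (- (of_real c * z))) \<le> 1" using assms by simp
  have "?y \<le> 2" using norm_triangle_ineq4[of 1 "exp (- (of_real c * z))"] q unfolding norm_one by linarith
  hence h: "c * norm (\<zeta> - z) \<le> 1 / 2" using assms by linarith
  have n: "norm (of_real c * (z - \<zeta>)) = c * norm (\<zeta> - z)"
    using assms by (simp add: norm_mult norm_minus_commute)
  have "exp (- (of_real c * \<zeta>)) = exp (- (of_real c * z)) * exp (of_real c * (z - \<zeta>))"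
    by (simp add: algebra_simps flip: exp_add)
  hence eq: "1 - exp (- (of_real c * \<zeta>)) = (1 - exp (- (of_real c * z))) - exp (- (of_real c * z)) * (exp (of_real c * (z - \<zeta>)) - 1)"
    by (simp add: algebra_simps)
  have "norm (exp (- (of_real c * z)) * (exp (of_real c * (z - \<zeta>)) - 1)) \<le> 1 * (c * norm (\<zeta> - z) * exp (c * norm (\<zeta> - z)))"
    unfolding norm_mult using q norm_exp_minus_1_le[of "of_real c * (z - \<zeta>)"] unfolding n
    by (intro mult_mono) auto
  also have "\<dots> \<le> 1 * (c * norm (\<zeta> - z) * 2)"
  proof (intro mult_left_mono)
    have "exp (c * norm (\<zeta> - z)) \<le> exp (1 / 2)" using h by simp
    also have "exp (1 / 2 :: real) \<le> 2"
    proof (rule power2_le_imp_le)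
      have "(exp (1 / 2 :: real))\<^sup>2 = exp 1" by (simp add: exp_double[symmetric])
      also have "\<dots> \<le> 2\<^sup>2" using exp_le by simp
      finally show "(exp (1 / 2 :: real))\<^sup>2 \<le> 2\<^sup>2" .
    qed simp
    finally show "exp (c * norm (\<zeta> - z)) \<le> 2" .
  qed (use assms in auto)
  also have "\<dots> \<le> ?y / 2" using assms by linarith
  finally show ?thesis unfolding eq
    using norm_triangle_ineq2[of "1 - exp (- (of_real c * z))" "exp (- (of_real c * z)) * (exp (of_real c * (z - \<zeta>)) - 1)"]
    by linarith
qed

lemma inverse_one_minus_exp_le:
  fixes v :: real assumes "v > 0" shows "1 / (1 - exp (- v)) \<le> 1 + 1 / v"
proof -
  have "1 + v \<le> exp v" by (rule exp_ge_add_one_self)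
  hence "exp (- v) * (1 + v) \<le> 1" by (simp add: exp_minus field_simps)
  hence "v \<le> (1 - exp (- v)) * (1 + v)" by (simp add: algebra_simps)
  thus ?thesis using assms by (simp add: field_simps)
qed

section \<open>The regularised kernel and Cauchy estimates for its derivatives\<close>

locale barnes =
  fixes r :: nat and a :: real and w :: "nat \<Rightarrow> real"
  assumes r_pos: "r > 0" and a_pos: "a > 0" and w_pos: "\<And>i. i < r \<Longrightarrow> w i > 0"
begin

definition H :: "complex \<Rightarrow> complex" where
  "H z = exp (- (of_real a * z)) / (\<Prod>i<r. of_real (w i) * expq (of_real (w i) * z))"

definition \<Omega> :: "complex set" where
  "\<Omega> = {z. \<forall>i<r. expq (of_real (w i) * z) \<noteq> 0}"

definition D :: "nat \<Rightarrow> complex \<Rightarrow> complex" where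
  "D n = (deriv ^^ n) H"

text \<open>A radius with w_i \<rho> \<le> 1 for all i: the closed disc stays clear of the poles 2
  pi i n / w_i of \<open>H\<close>, and it separates the range where all derivatives are bounded
  from the range where the poles matter.\<close>

definition \<rho> :: real where
  "\<rho> = 1 / (1 + (\<Sum>i<r. w i))"

text \<open>Measures the closeness of z to the nearest pole 2 pi i n / w_i of the i-th factor: near
  such a pole it is comparable to the reciprocal distance.\<close>

definition y :: "nat \<Rightarrow> complex \<Rightarrow> real" where
  "y i z = 1 / norm (1 - exp (- (of_real (w i) * z)))"

lemma rho_pos: "\<rho> > 0"
  unfolding \<rho>_def using sum_nonneg[of "{..<r}" w] w_pos by (force intro: add_pos_nonneg less_imp_le)

lemma w_rho_le: "i < r \<Longrightarrow> w i * \<rho> \<le> 1"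
proof -
  assume i: "i < r"
  have "w i \<le> (\<Sum>i<r. w i)" using i w_pos by (intro member_le_sum) (auto intro: less_imp_le)
  moreover have "0 \<le> (\<Sum>i<r. w i)" using w_pos by (intro sum_nonneg) (auto intro: less_imp_le)
  ultimately show ?thesis unfolding \<rho>_def by (simp add: field_simps)
qed

lemma open_Omega: "open \<Omega>"
proof -
  have "open {z. expq (of_real (w i) * z) \<noteq> 0}" for i
  proof (rule open_Collect_neq)
    show "continuous_on UNIV (\<lambda>z. expq (of_real (w i) * z))"
      by (rule continuous_on_compose2[OF holomorphic_on_imp_continuous_on[OF holomorphic_expq]])
         (auto intro!: continuous_intros)
  qed auto
  moreover have "\<Omega> = (\<Inter>i\<in>{..<r}. {z. expq (of_real (w i) * z) \<noteq> 0})" by (auto simp: \<Omega>_def)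
  ultimately show ?thesis by auto
qed

lemma Re_pos_in_Omega: "Re z > 0 \<Longrightarrow> z \<in> \<Omega>"
  unfolding \<Omega>_def using w_pos expq_nonzero by (auto simp: zero_less_mult_iff)

lemma cball_subset_Omega: "cball 0 \<rho> \<subseteq> \<Omega>"
proof
  fix z :: complex assume "z \<in> cball 0 \<rho>"
  hence "norm (of_real (w i) * z) < 2 * pi" if "i < r" for i
  proof -
    have "w i * norm z \<le> w i * \<rho>" using \<open>z \<in> cball 0 \<rho>\<close> w_pos[OF that] by (intro mult_left_mono) auto
    moreover have "norm (of_real (w i) * z) = w i * norm z" using w_pos[OF that] by (simp add: norm_mult)
    ultimately show ?thesis using w_rho_le[OF that] pi_gt3 by linarith
  qed
  thus "z \<in> \<Omega>" using expq_nonzero by (auto simp: \<Omega>_def)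
qed

lemma holomorphic_D: "D n holomorphic_on \<Omega>"
proof -
  have "H holomorphic_on \<Omega>" unfolding H_def
  proof (intro holomorphic_intros)
    show "(\<lambda>z. expq (of_real (w i) * z)) holomorphic_on \<Omega>" for i
      using holomorphic_on_compose_gen[OF _ holomorphic_expq, of "\<lambda>z. of_real (w i) * z" \<Omega>]
      by (auto simp: o_def intro!: holomorphic_intros)
    show "(\<Prod>i<r. of_real (w i) * expq (of_real (w i) * z)) \<noteq> 0" if "z \<in> \<Omega>" for z
      using that w_pos by (fastforce simp: \<Omega>_def)
  qed
  thus ?thesis unfolding D_def by (rule holomorphic_higher_deriv) (rule open_Omega)
qed

lemma D_has_derivative: "z \<in> \<Omega> \<Longrightarrow> (D n has_field_derivative D (Suc n) z) (at z)"
  using holomorphic_derivI[OF holomorphic_D open_Omega, of z n] by (simp add: D_def)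

lemma ray_in_Omega: "Re u > 0 \<Longrightarrow> x > 0 \<Longrightarrow> u * of_real x \<in> \<Omega>"
  by (rule Re_pos_in_Omega) simp

lemma continuous_on_D_ray: "Re u > 0 \<Longrightarrow> continuous_on {0<..} (\<lambda>x. D n (u * of_real x))"
  by (rule continuous_on_compose2[OF holomorphic_on_imp_continuous_on[OF holomorphic_D]])
     (auto intro!: continuous_intros ray_in_Omega)

lemma D_ray_has_vector_derivative:
  assumes "Re u > 0" "x > 0"
  shows "((\<lambda>x. D n (u * of_real x)) has_vector_derivative u * D (Suc n) (u * of_real x)) (at x)"
proof (rule has_vector_derivative_real_field)
  show "((\<lambda>x. D n (u * x)) has_field_derivative u * D (Suc n) (u * of_real x)) (at (of_real x))"
    unfolding mult.commute[of u "D (Suc n) (u * of_real x)"]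
    by (rule DERIV_chain2[where f = "D n" and g = "\<lambda>x. u * x"])
       (use assms in \<open>auto intro!: D_has_derivative ray_in_Omega derivative_eq_intros\<close>)
qed

lemma H_eq:
  assumes "z \<noteq> 0"
  shows "H z = z ^ r * exp (- (of_real a * z)) / (\<Prod>i<r. 1 - exp (- (of_real (w i) * z)))"
proof -
  have "(\<Prod>i<r. of_real (w i) * expq (of_real (w i) * z)) = (\<Prod>i<r. (1 - exp (- (of_real (w i) * z))) / z)"
    using assms w_pos by (intro prod.cong) (force simp: expq_def)+
  thus ?thesis using assms by (simp add: H_def prod_dividef)
qed

lemma y_ge_half: "Re z > 0 \<Longrightarrow> i < r \<Longrightarrow> y i z \<ge> 1 / 2"
proof -
  assume "Re z > 0" "i < r"
  hence q: "norm (exp (- (of_real (w i) * z))) < 1" using w_pos by simp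
  hence "norm (1 - exp (- (of_real (w i) * z))) \<le> 2"
    using norm_triangle_ineq4[of 1 "exp (- (of_real (w i) * z))"] unfolding norm_one by linarith
  moreover have "norm (1 - exp (- (of_real (w i) * z))) > 0"
    using q by (metis norm_one less_irrefl right_minus_eq zero_less_norm_iff)
  ultimately show ?thesis by (simp add: y_def field_simps)
qed

lemma y_le:
  assumes "Re z > 0" "i < r"
  shows "y i z \<le> 1 / (1 - exp (- (w i * Re z)))"
proof -
  have "w i * Re z > 0" using assms w_pos by simp
  have "1 - exp (- (w i * Re z)) \<le> norm (1 - exp (- (of_real (w i) * z)))"
    using norm_triangle_ineq2[of 1 "exp (- (of_real (w i) * z))"] by simp
  thus ?thesis unfolding y_def using \<open>w i * Re z > 0\<close> by (intro divide_left_mono mult_pos_pos) auto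
qed

lemma D_bounded_near_0: "\<exists>C\<ge>0. \<forall>z. norm z \<le> \<rho> \<longrightarrow> norm (D n z) \<le> C"
proof -
  have "continuous_on (cball 0 \<rho>) (D n)"
    using holomorphic_on_imp_continuous_on[OF holomorphic_D] cball_subset_Omega continuous_on_subset by blast
  from continuous_on_compact_bound[OF compact_cball this] show ?thesis by (metis mem_cball_0)
qed

text \<open>
  The estimate follows from Cauchy's inequality on a disc whose radius is comparable to the distance
  from the nearest pole.
\<close>
lemma D_bound:
  "\<exists>C\<ge>0. \<forall>z. Re z > 0 \<longrightarrow> norm z \<ge> \<rho> \<longrightarrow>
     norm (D n z) \<le> C * (norm z ^ r * exp (- (a * Re z)) * (\<Sum>i<r. y i z ^ (r + n)))"
proof -
  \<comment> \<open>The quarter is the one of \<open>norm_one_minus_exp_perturb\<close>: with R =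
    \<eta>/Y and w_i \<rho> \<le> 1, w_i R is at most 1/(4 y_i) for all i at once.\<close>
  define \<eta> where "\<eta> = \<rho> / 4"
  define C where "C = fact n * (4 ^ r * exp (a * \<rho>) * real r ^ (r + n) / \<eta> ^ n)"
  have \<eta>: "\<eta> > 0" using rho_pos by (simp add: \<eta>_def)
  show ?thesis
  proof (intro exI[of _ C] conjI allI impI)
    show "C \<ge> 0" using \<eta> by (simp add: C_def)
    fix z assume z: "Re z > 0" "norm z \<ge> \<rho>"
    define Y where "Y = (\<Sum>i<r. y i z)"
    have ypos: "y i z > 0" if "i < r" for i using y_ge_half[OF z(1) that] by linarith
    have yY: "y i z \<le> Y" if "i < r" for i
      unfolding Y_def using that ypos by (intro member_le_sum) (auto intro: less_imp_le)
    have Y: "Y \<ge> 1 / 2" using y_ge_half[OF z(1) r_pos] yY[OF r_pos] by linarith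
    define R where "R = \<eta> / Y"
    have R: "R > 0" using \<eta> Y by (simp add: R_def)
    have R2: "R \<le> \<rho>" using Y rho_pos by (simp add: R_def \<eta>_def field_simps)
    have pert: "norm (1 - exp (- (of_real (w i) * \<zeta>))) \<ge> 1 / (2 * y i z)" if i: "i < r" and \<zeta>: "norm (\<zeta> - z) \<le> R" for i \<zeta>
    proof -
      have "w i * norm (\<zeta> - z) \<le> w i * R" using \<zeta> w_pos[OF i] by (intro mult_left_mono) auto
      also have "\<dots> = (w i * \<rho>) / (4 * Y)" by (simp add: R_def \<eta>_def)
      also have "\<dots> \<le> 1 / (4 * y i z)" using w_rho_le[OF i] yY[OF i] ypos[OF i]
        by (intro frac_le) auto
      also have "\<dots> = norm (1 - exp (- (of_real (w i) * z))) / 4" by (simp add: y_def)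
      finally have "norm (1 - exp (- (of_real (w i) * \<zeta>))) \<ge> norm (1 - exp (- (of_real (w i) * z))) / 2"
        by (rule norm_one_minus_exp_perturb[OF w_pos[OF i] z(1)])
      thus ?thesis by (simp add: y_def)
    qed
    have nz: "exp (- (of_real (w i) * \<zeta>)) \<noteq> 1" if "i < r" "norm (\<zeta> - z) \<le> R" for i \<zeta>
      using pert[OF that] ypos[OF that(1)] by (smt (verit) divide_pos_pos norm_zero right_minus_eq)
    have \<zeta>0: "\<zeta> \<noteq> 0" if "norm (\<zeta> - z) \<le> R" for \<zeta> using nz[OF r_pos that] by auto
    have sub: "cball z R \<subseteq> \<Omega>"
    proof
      fix \<zeta> assume "\<zeta> \<in> cball z R"
      hence *: "norm (\<zeta> - z) \<le> R" by (simp add: dist_norm norm_minus_commute)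
      show "\<zeta> \<in> \<Omega>" unfolding \<Omega>_def expq_def using nz[OF _ *] \<zeta>0[OF *] w_pos by force
    qed
    have hol: "H holomorphic_on \<Omega>" using holomorphic_D[of 0] by (simp add: D_def)
    \<comment> \<open>Bounds |H| on the circle: |\<zeta>| \<le> 2 |z| since R \<le> \<rho> \<le>
      |z|, and each factor of the product is at most 2 Y. Cauchy's R^(- n) = (Y/\<eta>)^n raises Y^r
      to Y^(r + n).\<close>
    define B where "B = (2 * norm z) ^ r * exp (a * \<rho> - a * Re z) * (2 ^ r * Y ^ r)"
    have "norm (D n z) \<le> fact n * B / R ^ n" unfolding D_def
    proof (rule Cauchy_inequality[OF _ _ R])
      show "H holomorphic_on ball z R" using hol sub ball_subset_cball holomorphic_on_subset by blast
      show "continuous_on (cball z R) H" using hol sub holomorphic_on_imp_continuous_on holomorphic_on_subset by blast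
      fix \<zeta> assume "norm (z - \<zeta>) = R"
      hence *: "norm (\<zeta> - z) \<le> R" by (simp add: norm_minus_commute)
      have "norm (H \<zeta>) = norm \<zeta> ^ r * exp (- (a * Re \<zeta>)) * (\<Prod>i<r. 1 / norm (1 - exp (- (of_real (w i) * \<zeta>))))"
        by (simp add: H_eq[OF \<zeta>0[OF *]] norm_mult norm_divide norm_power prod_norm prod_dividef)
      also have "\<dots> \<le> B" unfolding B_def
      proof (intro mult_mono power_mono prod_nonneg)
        show "norm \<zeta> \<le> 2 * norm z" using * R2 z(2) norm_triangle_ineq[of "\<zeta> - z" z] by simp
        have "Re z - Re \<zeta> \<le> \<rho>" using * R2 abs_Re_le_cmod[of "\<zeta> - z"] by simp
        hence "a * (Re z - Re \<zeta>) \<le> a * \<rho>" using a_pos by (intro mult_left_mono) auto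
        thus "exp (- (a * Re \<zeta>)) \<le> exp (a * \<rho> - a * Re z)" by (simp add: algebra_simps)
        have "(\<Prod>i<r. 1 / norm (1 - exp (- (of_real (w i) * \<zeta>)))) \<le> (\<Prod>i<r. 2 * Y)"
        proof (rule prod_mono)
          fix i assume "i \<in> {..<r}"
          hence i: "i < r" by simp
          have "1 / norm (1 - exp (- (of_real (w i) * \<zeta>))) \<le> 1 / (1 / (2 * y i z))"
            using pert[OF i *] ypos[OF i] by (intro divide_left_mono mult_pos_pos) (auto intro: less_le_trans[rotated])
          thus "0 \<le> 1 / norm (1 - exp (- (of_real (w i) * \<zeta>))) \<and> 1 / norm (1 - exp (- (of_real (w i) * \<zeta>))) \<le> 2 * Y"
            using yY[OF i] by simp
        qed
        thus "(\<Prod>i<r. 1 / norm (1 - exp (- (of_real (w i) * \<zeta>)))) \<le> 2 ^ r * Y ^ r"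
          by (simp add: power_mult_distrib)
      qed (use z in auto)
      finally show "norm (H \<zeta>) \<le> B" .
    qed
    also have "\<dots> = fact n * (4 ^ r * exp (a * \<rho>) / \<eta> ^ n) * (norm z ^ r * exp (- (a * Re z)) * Y ^ (r + n))"
    proof -
      have "(4::real) ^ r = 2 ^ r * 2 ^ r" by (simp flip: power_mult_distrib)
      thus ?thesis using Y \<eta>
        by (simp add: B_def R_def power_divide power_add power_mult_distrib exp_diff exp_minus field_simps)
    qed
    also have "\<dots> \<le> fact n * (4 ^ r * exp (a * \<rho>) / \<eta> ^ n) *
        (norm z ^ r * exp (- (a * Re z)) * (real r ^ (r + n) * (\<Sum>i<r. y i z ^ (r + n))))"
      unfolding Y_def using sum_power_le_power_mult_sum[OF r_pos, of "\<lambda>i. y i z" "r + n"] ypos \<eta>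
      by (intro mult_left_mono) (auto intro: less_imp_le)
    also have "\<dots> = C * (norm z ^ r * exp (- (a * Re z)) * (\<Sum>i<r. y i z ^ (r + n)))"
      by (simp add: C_def)
    finally show "norm (D n z) \<le> C * (norm z ^ r * exp (- (a * Re z)) * (\<Sum>i<r. y i z ^ (r + n)))" .
  qed
qed

text \<open>Qualitative only: M depends on u without control as Re u tends to 0, which suffices for
  convergence and for the integrations by parts. Half of the exponential decay pays for the factor
  |z|^r.\<close>

lemma D_ray_decay:
  assumes u: "Re u > 0"
  shows "\<exists>M. \<forall>x>0. norm (D n (u * of_real x)) \<le> M * exp (- (a * Re u / 2 * x))"
proof -
  define b where "b = a * Re u / 2"
  have b: "b > 0" using a_pos u by (simp add: b_def)
  have u0: "norm u > 0" using u by auto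
  obtain C0 where C0: "C0 \<ge> 0" "\<And>z. norm z \<le> \<rho> \<Longrightarrow> norm (D n z) \<le> C0" using D_bounded_near_0 by blast
  obtain C1 where C1: "C1 \<ge> 0" "\<And>z. Re z > 0 \<Longrightarrow> norm z \<ge> \<rho> \<Longrightarrow>
     norm (D n z) \<le> C1 * (norm z ^ r * exp (- (a * Re z)) * (\<Sum>i<r. y i z ^ (r + n)))" using D_bound by blast
  obtain C2 where C2: "C2 \<ge> 0" "\<And>x. x \<ge> 0 \<Longrightarrow> (x + 0) ^ r * exp (- (b * x)) \<le> C2"
    using power_mult_exp_bounded[OF b, of 0 r] by auto
  define Q where "Q = (\<Sum>i<r. (1 + norm u / (w i * Re u * \<rho>)) ^ (r + n))"
  have Q: "Q \<ge> 0" unfolding Q_def using w_pos u rho_pos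
    by (intro sum_nonneg zero_le_power add_nonneg_nonneg divide_nonneg_nonneg mult_nonneg_nonneg) (auto intro: less_imp_le)
  define M where "M = C0 * exp (b * (\<rho> / norm u)) + C1 * (norm u ^ r * C2 * Q)"
  have "norm (D n (u * of_real x)) \<le> M * exp (- (b * x))" if x: "x > 0" for x
  proof (cases "norm u * x \<le> \<rho>")
    case True
    hence "x \<le> \<rho> / norm u" using u0 by (simp add: field_simps)
    hence "b * x \<le> b * (\<rho> / norm u)" using b by (intro mult_left_mono) auto
    hence "1 \<le> exp (b * (\<rho> / norm u)) * exp (- (b * x))" by (simp flip: exp_add)
    hence "C0 * 1 \<le> C0 * (exp (b * (\<rho> / norm u)) * exp (- (b * x)))" by (intro mult_left_mono C0(1))
    moreover have "0 \<le> C1 * (norm u ^ r * C2 * Q) * exp (- (b * x))" using C1 C2 Q by simp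
    moreover have "norm (D n (u * of_real x)) \<le> C0" using True x by (intro C0(2)) (simp add: norm_mult)
    ultimately show ?thesis by (simp add: M_def algebra_simps)
  next
    case False
    have "y i (u * of_real x) ^ (r + n) \<le> (1 + norm u / (w i * Re u * \<rho>)) ^ (r + n)" if i: "i < r" for i
    proof (rule power_mono)
      show "0 \<le> y i (u * of_real x)" by (simp add: y_def)
      have "y i (u * of_real x) \<le> 1 / (1 - exp (- (w i * (Re u * x))))"
        using y_le[of "u * of_real x" i] i u x by simp
      also have "\<dots> \<le> 1 + 1 / (w i * (Re u * x))"
        using w_pos[OF i] u x by (intro inverse_one_minus_exp_le) auto
      also have "1 / (w i * (Re u * x)) = norm u / (w i * Re u * (norm u * x))"
        using u0 by simp
      also have "\<dots> \<le> norm u / (w i * Re u * \<rho>)"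
        using False w_pos[OF i] u x u0 rho_pos by (intro divide_left_mono mult_left_mono mult_pos_pos) auto
      finally show "y i (u * of_real x) \<le> 1 + norm u / (w i * Re u * \<rho>)" by simp
    qed
    hence sumQ: "(\<Sum>i<r. y i (u * of_real x) ^ (r + n)) \<le> Q" unfolding Q_def by (intro sum_mono) auto
    have "norm (D n (u * of_real x)) \<le> C1 * (norm (u * of_real x) ^ r * exp (- (a * Re (u * of_real x))) * (\<Sum>i<r. y i (u * of_real x) ^ (r + n)))"
      using False u x by (intro C1(2)) (auto simp: norm_mult)
    also have "\<dots> \<le> C1 * (norm (u * of_real x) ^ r * exp (- (a * Re (u * of_real x))) * Q)"
      using sumQ C1(1) by (intro mult_left_mono) auto
    also have "\<dots> = C1 * (norm u ^ r * ((x + 0) ^ r * exp (- (b * x))) * Q) * exp (- (b * x))"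
    proof -
      have "exp (- (a * Re (u * of_real x))) = exp (- (b * x)) * exp (- (b * x))"
        by (simp add: b_def flip: exp_add)
      thus ?thesis using x by (simp add: norm_mult power_mult_distrib)
    qed
    also have "\<dots> \<le> C1 * (norm u ^ r * C2 * Q) * exp (- (b * x))"
      using C1(1) Q C2(2)[of x] x by (intro mult_right_mono mult_left_mono) auto
    also have "\<dots> \<le> M * exp (- (b * x))" using C0(1) by (intro mult_right_mono) (auto simp: M_def)
    finally show ?thesis .
  qed
  thus ?thesis unfolding b_def by blast
qed

end

section \<open>The analytic continuation\<close>

context barnes
begin

text \<open>The integral of z^(p - 1) H^(n)(z) along the ray through u, parametrised by z = u x; the
  power u^p is written with \<open>Ln u\<close>.\<close>

definition J :: "complex \<Rightarrow> complex \<Rightarrow> nat \<Rightarrow> complex" where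
  "J u p n = exp (p * Ln u) * integral {0<..} (\<lambda>x. of_real x powr (p - 1) * D n (u * of_real x))"

definition node :: "(nat \<Rightarrow> nat) \<Rightarrow> real" where
  "node m = a + (\<Sum>i<r. real (m i) * w i)"

text \<open>Cubes are chosen because the exponential sum over a cube factors into r finite geometric
  sums.\<close>

definition grid :: "nat \<Rightarrow> (nat \<Rightarrow> nat) set" where
  "grid n = {..<r} \<rightarrow>\<^sub>E {..<n}"

text \<open>Using the entire function \<open>rGamma\<close> instead of division by Gamma makes
  holomorphy on the whole half plane Re s > - k immediate.\<close>

definition E :: "nat \<Rightarrow> complex \<Rightarrow> complex \<Rightarrow> complex" where
  "E k u s = (- 1) ^ (r + k) * rGamma (s + of_nat k) * J u (s + of_nat k) (r + k)"

definition P :: "complex \<Rightarrow> complex" where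
  "P s = pochhammer (s - of_nat r) r"

text \<open>One integration by parts; the factor u of the chain rule is what raises u^p to u^(p +
  1).\<close>

lemma J_Suc:
  assumes u: "Re u > 0" and p: "Re p > 0"
  shows "J u (p + 1) (Suc n) = - p * J u p n"
proof -
  obtain M where M: "\<And>x. x > 0 \<Longrightarrow> norm (D n (u * of_real x)) \<le> M * exp (- (a * Re u / 2 * x))"
    using D_ray_decay[OF u] by blast
  obtain M' where M': "\<And>x. x > 0 \<Longrightarrow> norm (D (Suc n) (u * of_real x)) \<le> M' * exp (- (a * Re u / 2 * x))"
    using D_ray_decay[OF u] by blast
  have "integral {0<..} (\<lambda>x. of_real x powr p * (u * D (Suc n) (u * of_real x))) =
      - p * integral {0<..} (\<lambda>x. of_real x powr (p - 1) * D n (u * of_real x))"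
  proof (rule mellin_by_parts[where M = M and M' = "norm u * M'" and b = "a * Re u / 2" and b' = "a * Re u / 2"])
    show "norm (u * D (Suc n) (u * of_real x)) \<le> norm u * M' * exp (- (a * Re u / 2 * x))" if "x > 0" for x
      using mult_left_mono[OF M'[OF that], of "norm u"] by (simp add: norm_mult mult.assoc)
  qed (use u p a_pos M D_ray_has_vector_derivative in \<open>auto intro!: continuous_intros continuous_on_D_ray\<close>)
  moreover have "(\<lambda>x. of_real x powr p * (u * D (Suc n) (u * of_real x))) =
      (\<lambda>x. u * (of_real x powr p * D (Suc n) (u * of_real x)))"
    by (simp add: fun_eq_iff)
  moreover have "u \<noteq> 0" using u by auto
  ultimately show ?thesis by (simp add: J_def distrib_right exp_add mult.assoc mult.left_commute[of p])
qed

lemma J_add_nat: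
  assumes u: "Re u > 0" and p: "Re p > 0"
  shows "J u (p + of_nat m) m = (- 1) ^ m * pochhammer p m * J u p 0"
proof (induction m)
  case (Suc m)
  have "J u (p + of_nat (Suc m)) (Suc m) = J u ((p + of_nat m) + 1) (Suc m)" by (simp add: add_ac)
  also have "\<dots> = - (p + of_nat m) * J u (p + of_nat m) m" by (rule J_Suc) (use u p in auto)
  finally show ?case by (simp add: Suc.IH pochhammer_Suc algebra_simps)
qed simp

lemma holomorphic_J:
  assumes u: "Re u > 0"
  shows "(\<lambda>p. J u p n) holomorphic_on {p. Re p > 0}"
proof -
  obtain M where "\<And>x. x > 0 \<Longrightarrow> norm (D n (u * of_real x)) \<le> M * exp (- (a * Re u / 2 * x))"
    using D_ray_decay[OF u] by blast
  from mellin_holomorphic[OF continuous_on_D_ray[OF u] this] show ?thesis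
    unfolding J_def using a_pos u by (intro holomorphic_intros) auto
qed

text \<open>On the real ray M does not depend on p. This yields all bounds that are merely needed to
  be finite: right of Re s = r, and on the horizontal sides of the rectangles.\<close>

lemma norm_J_one_le:
  "\<exists>M\<ge>0. \<forall>p. Re p > 0 \<longrightarrow> norm (J 1 p n) \<le> M * (Gamma (Re p) * (a / 2) powr (- Re p))"
proof -
  obtain M where M: "\<And>x. x > 0 \<Longrightarrow> norm (D n (1 * of_real x)) \<le> M * exp (- (a * Re 1 / 2 * x))"
    using D_ray_decay[of 1 n] by auto
  have "0 \<le> M * exp (- (a * Re 1 / 2 * 1))" using norm_ge_zero M[of 1] by (rule order_trans) simp
  hence "M \<ge> 0" by (simp add: zero_le_mult_iff)
  moreover have "norm (J 1 p n) \<le> M * (Gamma (Re p) * (a / 2) powr (- Re p))" if "Re p > 0" for p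
    using mellin_norm_le[OF continuous_on_D_ray[of 1] M _ that] a_pos by (simp add: J_def norm_mult)
  ultimately show ?thesis by blast
qed

lemma holomorphic_E:
  assumes "Re u > 0"
  shows "E k u holomorphic_on {s. Re s > - real k}"
proof -
  have "((\<lambda>p. J u p (r + k)) \<circ> (\<lambda>s. s + of_nat k)) holomorphic_on {s. Re s > - real k}"
    by (rule holomorphic_on_compose_gen[OF _ holomorphic_J[OF assms]]) (auto intro!: holomorphic_intros)
  hence "(\<lambda>s. J u (s + of_nat k) (r + k)) holomorphic_on {s. Re s > - real k}" by (simp add: o_def)
  thus ?thesis unfolding E_def[abs_def] by (intro holomorphic_intros)
qed

section \<open>From Laplace integrals of finite sums to the series\<close>

lemma node_pos: "node m > 0"
  unfolding node_def using a_pos w_pos by (intro add_pos_nonneg sum_nonneg mult_nonneg_nonneg) (auto intro: less_imp_le)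

lemma finite_grid [simp]: "finite (grid n)"
  unfolding grid_def by (intro finite_PiE) auto

lemma sum_exp_grid:
  fixes z :: complex
  shows "(\<Sum>m\<in>grid n. exp (- (of_real (node m) * z))) =
     exp (- (of_real a * z)) * (\<Prod>i<r. \<Sum>j<n. exp (- (of_real (w i) * z)) ^ j)"
proof -
  have "exp (- (of_real (node m) * z)) = exp (- (of_real a * z)) * (\<Prod>i<r. exp (- (of_real (w i) * z)) ^ m i)" for m
  proof -
    have "- (of_real (node m) * z) = - (of_real a * z) + (\<Sum>i<r. of_nat (m i) * (- (of_real (w i) * z)))"
      by (simp add: node_def distrib_right sum_distrib_right sum_negf mult.assoc)
    thus ?thesis by (simp only: exp_add exp_sum[OF finite_lessThan] exp_of_nat_mult)
  qed
  thus ?thesis by (simp add: grid_def prod_sum_PiE sum_distrib_left)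
qed

text \<open>Each finite geometric sum is (1 - q^n)/(1 - q) with |1 - q^n| \<le> 2. Being uniform in
  n, the bound serves as dominating function when the cubes exhaust the lattice.\<close>

lemma norm_sum_exp_grid_le:
  assumes z: "Re z > 0"
  shows "norm (\<Sum>m\<in>grid n. exp (- (of_real (node m) * z))) \<le> 2 ^ r * (norm (H z) / norm z ^ r)"
proof -
  have z0: "z \<noteq> 0" using z by auto
  have "norm (\<Sum>j<n. exp (- (of_real (w i) * z)) ^ j) \<le> 2 / norm (1 - exp (- (of_real (w i) * z)))" if "i < r" for i
  proof -
    let ?q = "exp (- (of_real (w i) * z))"
    have q: "norm ?q < 1" using z w_pos[OF that] by simp
    hence q1: "?q \<noteq> 1" by (metis norm_one less_irrefl)
    have "norm (1 - ?q ^ n) \<le> 2"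
      using norm_triangle_ineq4[of 1 "?q ^ n"] power_le_one[OF norm_ge_zero less_imp_le[OF q], of n]
      unfolding norm_one norm_power by linarith
    hence "norm (1 - ?q ^ n) / norm (1 - ?q) \<le> 2 / norm (1 - ?q)" by (intro divide_right_mono) auto
    moreover have "(\<Sum>j<n. ?q ^ j) = (1 - ?q ^ n) / (1 - ?q)" using sum_gp_strict[of ?q n] q1 by simp
    ultimately show ?thesis by (simp add: norm_divide)
  qed
  hence "(\<Prod>i<r. norm (\<Sum>j<n. exp (- (of_real (w i) * z)) ^ j)) \<le>
     (\<Prod>i<r. 2 / norm (1 - exp (- (of_real (w i) * z))))"
    by (intro prod_mono) auto
  hence "exp (- (a * Re z)) * (\<Prod>i<r. norm (\<Sum>j<n. exp (- (of_real (w i) * z)) ^ j)) \<le>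
     exp (- (a * Re z)) * (\<Prod>i<r. 2 / norm (1 - exp (- (of_real (w i) * z))))"
    by (intro mult_left_mono) auto
  also have "\<dots> = 2 ^ r * (norm (H z) / norm z ^ r)"
    using z0 by (simp add: H_eq norm_mult norm_divide norm_power prod_norm prod_dividef)
  finally show ?thesis by (simp add: sum_exp_grid norm_mult prod_norm)
qed

lemma sum_exp_grid_tendsto:
  assumes z: "Re z > 0"
  shows "(\<lambda>n. \<Sum>m\<in>grid n. exp (- (of_real (node m) * z))) \<longlonglongrightarrow> H z / z ^ r"
proof -
  have z0: "z \<noteq> 0" using z by auto
  have "(\<lambda>n. \<Sum>j<n. exp (- (of_real (w i) * z)) ^ j) \<longlonglongrightarrow> 1 / (1 - exp (- (of_real (w i) * z)))" if "i < r" for i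
    using geometric_sums[of "exp (- (of_real (w i) * z))"] z w_pos[OF that] by (simp add: sums_def)
  hence "(\<lambda>n. exp (- (of_real a * z)) * (\<Prod>i<r. \<Sum>j<n. exp (- (of_real (w i) * z)) ^ j)) \<longlonglongrightarrow>
     exp (- (of_real a * z)) * (\<Prod>i<r. 1 / (1 - exp (- (of_real (w i) * z))))"
    by (intro tendsto_intros) auto
  also have "exp (- (of_real a * z)) * (\<Prod>i<r. 1 / (1 - exp (- (of_real (w i) * z)))) = H z / z ^ r"
    using z0 by (simp add: H_eq prod_dividef)
  finally show ?thesis by (simp add: sum_exp_grid)
qed

lemma Gamma_mult_sum_grid:
  assumes s: "Re s > 0" and u: "Re u > 0"
  shows "Gamma s * (\<Sum>m\<in>grid n. of_real (node m) powr (- s)) =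
     exp (s * Ln u) * integral {0<..} (\<lambda>t. of_real t powr (s - 1) * (\<Sum>m\<in>grid n. exp (- (of_real (node m) * (u * of_real t)))))"
proof -
  have u0: "u \<noteq> 0" using u by auto
  have l: "Re (of_real (node m) * u) > 0" for m using node_pos u by simp
  have int: "(\<lambda>t. of_real t powr (s - 1) * exp (- (of_real (node m) * (u * of_real t)))) integrable_on {0<..}" for m
    using mellin_absolutely_integrable[of "\<lambda>t. exp (- (of_real (node m) * (u * of_real t)))" 1 "Re (of_real (node m) * u)" s] l[of m] s
    by (simp add: absolutely_integrable_on_def continuous_intros mult_ac)
  have "Gamma s * of_real (node m) powr (- s) =
      exp (s * Ln u) * integral {0<..} (\<lambda>t. of_real t powr (s - 1) * exp (- (of_real (node m) * (u * of_real t))))" for m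
  proof -
    have "(of_real (node m) * u) powr (- s) = of_real (node m) powr (- s) * exp (- (s * Ln u))"
    proof -
      have L: "Ln (of_real (node m) * u) = of_real (ln (node m)) + Ln u"
        using node_pos[of m] u0 by (simp add: Ln_times_of_real Ln_of_real)
      have "(of_real (node m) * u) powr (- s) = exp (- s * (of_real (ln (node m)) + Ln u))"
        using node_pos[of m] u0 by (simp add: powr_def L)
      also have "\<dots> = exp (- s * of_real (ln (node m))) * exp (- (s * Ln u))"
        by (simp add: algebra_simps flip: exp_add)
      also have "exp (- s * of_real (ln (node m))) = of_real (node m) powr (- s)"
        using node_pos[of m] by (simp add: powr_def Ln_of_real)
      finally show ?thesis .
    qed
    thus ?thesis using laplace_powr_integral[OF s l[of m]] by (simp add: exp_minus mult.assoc)
  qed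
  thus ?thesis by (simp add: sum_distrib_left integral_sum int del: exp_of_real)
qed

text \<open>Dominated convergence under the integral. The factor z^(- r) shifts the exponent from s
  to s - r, and integrability at 0 is where Re s > r enters.\<close>

lemma Gamma_mult_sum_grid_tendsto:
  assumes s: "Re s > real r" and u: "Re u > 0"
  shows "(\<lambda>n. Gamma s * (\<Sum>m\<in>grid n. of_real (node m) powr (- s))) \<longlonglongrightarrow> J u (s - of_nat r) 0"
proof -
  have s0: "Re s > 0" using s by simp
  have u0: "u \<noteq> 0" using u by auto
  define b where "b = a * Re u / 2"
  have b: "b > 0" using a_pos u by (simp add: b_def)
  obtain M where M: "\<And>x. x > 0 \<Longrightarrow> norm (D 0 (u * of_real x)) \<le> M * exp (- (b * x))"
    using D_ray_decay[OF u] unfolding b_def by blast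
  define f where "f = (\<lambda>n t. of_real t powr (s - 1) * (\<Sum>m\<in>grid n. exp (- (of_real (node m) * (u * complex_of_real t)))))"
  have "(\<lambda>n. integral {0<..} (f n)) \<longlonglongrightarrow>
     integral {0<..} (\<lambda>t. of_real t powr (s - 1) * (H (u * of_real t) / (u * of_real t) ^ r))"
  proof (rule dominated_convergence(2))
    show "f n integrable_on {0<..}" for n
    proof -
      have "(\<lambda>t. of_real t powr (s - 1) * exp (- (of_real (node m) * (u * of_real t)))) integrable_on {0<..}" for m
        using mellin_absolutely_integrable[of "\<lambda>t. exp (- (of_real (node m) * (u * of_real t)))" 1 "Re (of_real (node m) * u)" s] node_pos[of m] u s0
        by (simp add: absolutely_integrable_on_def continuous_intros mult_ac)
      thus ?thesis unfolding f_def sum_distrib_left by (intro integrable_sum) auto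
    qed
    show "(\<lambda>t. 2 ^ r * M / norm u ^ r * (t powr (Re s - real r - 1) * exp (- (b * t)))) integrable_on {0<..}"
      using powr_exp_integrable[of "Re s - real r" b] s b by (intro integrable_on_mult_right) auto
    fix t :: real assume "t \<in> {0<..}"
    hence t: "t > 0" by simp
    have ut: "Re (u * of_real t) > 0" using u t by simp
    show "(\<lambda>n. f n t) \<longlonglongrightarrow> of_real t powr (s - 1) * (H (u * of_real t) / (u * of_real t) ^ r)"
      unfolding f_def by (intro tendsto_intros sum_exp_grid_tendsto ut)
    fix n
    have "norm (f n t) \<le> t powr (Re s - 1) * (2 ^ r * (norm (H (u * of_real t)) / norm (u * of_real t) ^ r))"
      unfolding f_def norm_mult[of "of_real t powr (s - 1)"] using t norm_sum_exp_grid_le[OF ut, of n]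
      by (intro mult_mono) (auto simp: norm_powr_real_powr)
    also have "\<dots> \<le> t powr (Re s - 1) * (2 ^ r * (M * exp (- (b * t)) / norm (u * of_real t) ^ r))"
      using M[OF t] by (intro mult_left_mono divide_right_mono) (auto simp: D_def)
    also have "\<dots> = 2 ^ r * M / norm u ^ r * (t powr (Re s - real r - 1) * exp (- (b * t)))"
    proof -
      have "t powr (Re s - 1) = t powr ((Re s - real r - 1) + real r)" by simp
      also have "\<dots> = t powr (Re s - real r - 1) * t ^ r" using t unfolding powr_add by (simp add: powr_realpow)
      finally show ?thesis using t u0 by (simp add: norm_mult power_mult_distrib)
    qed
    finally show "norm (f n t) \<le> 2 ^ r * M / norm u ^ r * (t powr (Re s - real r - 1) * exp (- (b * t)))" .
  qed
  hence "(\<lambda>n. exp (s * Ln u) * integral {0<..} (f n)) \<longlonglongrightarrow>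
     exp (s * Ln u) * integral {0<..} (\<lambda>t. of_real t powr (s - 1) * (H (u * of_real t) / (u * of_real t) ^ r))"
    by (intro tendsto_intros)
  also have "integral {0<..} (\<lambda>t. of_real t powr (s - 1) * (H (u * of_real t) / (u * of_real t) ^ r)) =
      integral {0<..} (\<lambda>t. (1 / u ^ r) * (of_real t powr (s - of_nat r - 1) * D 0 (u * of_real t)))"
  proof (rule integral_cong)
    fix t :: real assume "t \<in> {0<..}"
    hence t: "t > 0" by simp
    have "of_real t powr (s - 1) = of_real t powr ((s - of_nat r - 1) + of_nat r)" by simp
    also have "\<dots> = of_real t powr (s - of_nat r - 1) * of_real t powr of_nat r" by (rule powr_add)
    also have "of_real t powr of_nat r = (of_real t :: complex) ^ r" using t by (subst powr_nat') auto
    finally show "of_real t powr (s - 1) * (H (u * of_real t) / (u * of_real t) ^ r) =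
       (1 / u ^ r) * (of_real t powr (s - of_nat r - 1) * D 0 (u * of_real t))"
      using t u0 by (simp add: D_def power_mult_distrib)
  qed
  also have "exp (s * Ln u) * \<dots> = J u (s - of_nat r) 0"
    using u0 by (simp add: J_def left_diff_distrib exp_diff exp_of_nat_mult)
  finally show ?thesis unfolding Gamma_mult_sum_grid[OF s0 u] f_def .
qed

lemma filterlim_grid: "filterlim grid (finite_subsets_at_top ({..<r} \<rightarrow>\<^sub>E UNIV)) sequentially"
  unfolding filterlim_finite_subsets_at_top
proof (intro allI impI)
  fix X :: "(nat \<Rightarrow> nat) set" assume X: "finite X \<and> X \<subseteq> {..<r} \<rightarrow>\<^sub>E UNIV"
  \<comment> \<open>The total of all coordinates of all points of X bounds each coordinate;
    \<open>Suc\<close> makes the inequality strict.\<close>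
  define N where "N = Suc (\<Sum>m\<in>X. \<Sum>i<r. m i)"
  have "X \<subseteq> grid n" if "n \<ge> N" for n
  proof
    fix m assume m: "m \<in> X"
    have "m i < n" if "i < r" for i
    proof -
      have "m i \<le> (\<Sum>i<r. m i)" using that by (intro member_le_sum) auto
      also have "\<dots> \<le> (\<Sum>m\<in>X. \<Sum>i<r. m i)"
        using m X by (intro member_le_sum[where f = "\<lambda>m. \<Sum>i<r. m i"]) auto
      finally show ?thesis using \<open>n \<ge> N\<close> by (simp add: N_def)
    qed
    thus "m \<in> grid n" using m X by (auto simp: grid_def PiE_iff)
  qed
  moreover have "grid n \<subseteq> {..<r} \<rightarrow>\<^sub>E UNIV" for n by (auto simp: grid_def PiE_iff)
  ultimately show "eventually (\<lambda>n. finite (grid n) \<and> X \<subseteq> grid n \<and> grid n \<subseteq> {..<r} \<rightarrow>\<^sub>E UNIV) sequentially"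
    unfolding eventually_sequentially by (intro exI[of _ N]) simp
qed

text \<open>At the real point Re s the sums over cubes increase to J/Gamma, so this limit bounds
  every finite sum. That gives absolute summability together with the first claim, uniformly in Im
  s. The unordered sum may then be computed along the cubes, which gives the second.\<close>

lemma
  assumes s: "Re s > real r"
  shows norm_barnes_series_le: "norm (barnes_series r a w s) \<le> norm (J 1 (of_real (Re s) - of_nat r) 0) / Gamma (Re s)"
    and Gamma_mult_barnes_series: "Re u > 0 \<Longrightarrow> Gamma s * barnes_series r a w s = J u (s - of_nat r) 0"
proof -
  let ?A = "{..<r} \<rightarrow>\<^sub>E (UNIV :: nat set)"
  let ?c = "Re s"
  let ?L = "norm (J 1 (of_real ?c - of_nat r) 0) / Gamma ?c"
  have c: "?c > 0" using s by simp
  hence G: "Gamma ?c > 0" by (rule Gamma_real_pos)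
  define T where "T = (\<lambda>n. \<Sum>m\<in>grid n. node m powr (- ?c))"
  have "(\<lambda>n. norm (Gamma (of_real ?c) * (\<Sum>m\<in>grid n. of_real (node m) powr (- of_real ?c)) :: complex)) \<longlonglongrightarrow> norm (J 1 (of_real ?c - of_nat r) 0)"
    using Gamma_mult_sum_grid_tendsto[of "of_real ?c" 1] s by (intro tendsto_norm) auto
  also have "(\<lambda>n. norm (Gamma (of_real ?c) * (\<Sum>m\<in>grid n. of_real (node m) powr (- of_real ?c)) :: complex)) = (\<lambda>n. Gamma ?c * T n)"
  proof
    fix n
    have "(\<Sum>m\<in>grid n. of_real (node m) powr (- of_real ?c)) = complex_of_real (T n)"
      unfolding T_def of_real_sum using node_pos
      by (intro sum.cong refl) (simp add: powr_of_real[symmetric] less_imp_le)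
    moreover have "T n \<ge> 0" by (auto simp: T_def intro: sum_nonneg)
    ultimately show "norm (Gamma (of_real ?c) * (\<Sum>m\<in>grid n. of_real (node m) powr (- of_real ?c)) :: complex) = Gamma ?c * T n"
      using G by (simp add: Gamma_complex_of_real norm_mult)
  qed
  finally have "(\<lambda>n. Gamma ?c * T n / Gamma ?c) \<longlonglongrightarrow> ?L" using G by (intro tendsto_divide) auto
  hence lim: "T \<longlonglongrightarrow> ?L" using G by simp
  have "incseq T" unfolding T_def
  proof (intro incseq_SucI sum_mono2)
    show "grid n \<subseteq> grid (Suc n)" for n unfolding grid_def by (intro PiE_mono) auto
  qed auto
  hence TL: "T n \<le> ?L" for n using lim by (rule incseq_le)
  have fin: "sum (\<lambda>m. node m powr (- ?c)) F \<le> ?L" if F: "finite F" "F \<subseteq> ?A" for F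
  proof -
    have "eventually (\<lambda>n. finite (grid n) \<and> F \<subseteq> grid n \<and> grid n \<subseteq> ?A) sequentially"
      using filterlim_grid F unfolding filterlim_finite_subsets_at_top by blast
    then obtain n where "F \<subseteq> grid n" by (auto simp: eventually_sequentially)
    hence "sum (\<lambda>m. node m powr (- ?c)) F \<le> T n" unfolding T_def by (intro sum_mono2) auto
    thus ?thesis using TL[of n] by linarith
  qed
  have nrm: "norm (of_real (node m) powr (- s) :: complex) = node m powr (- ?c)" for m
    using node_pos[of m] by (simp add: norm_powr_real_powr less_imp_le)
  have sum': "(\<lambda>m. node m powr (- ?c)) summable_on ?A"
    by (rule nonneg_bdd_above_summable_on) (auto intro!: bdd_aboveI2[where M = ?L] fin)
  hence sum: "(\<lambda>m. norm (of_real (node m) powr (- s) :: complex)) summable_on ?A" by (simp add: nrm)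
  have bs: "barnes_series r a w s = infsum (\<lambda>m. of_real (node m) powr (- s)) ?A"
    by (simp add: barnes_series_def node_def)
  have "norm (barnes_series r a w s) \<le> infsum (\<lambda>m. node m powr (- ?c)) ?A"
    unfolding bs using norm_infsum_bound[OF sum] by (simp add: nrm)
  also have "\<dots> \<le> ?L" by (rule infsum_le_finite_sums[OF sum']) (use fin in auto)
  finally show "norm (barnes_series r a w s) \<le> ?L" .
  show "Gamma s * barnes_series r a w s = J u (s - of_nat r) 0" if u: "Re u > 0"
  proof (rule LIMSEQ_unique)
    have "(sum (\<lambda>m. of_real (node m) powr (- s)) \<longlongrightarrow> barnes_series r a w s) (finite_subsets_at_top ?A)"
      unfolding bs using has_sum_infsum[OF abs_summable_summable[OF sum]] by (simp add: has_sum_def)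
    from filterlim_compose[OF this filterlim_grid]
    show "(\<lambda>n. Gamma s * (\<Sum>m\<in>grid n. of_real (node m) powr (- s))) \<longlonglongrightarrow> Gamma s * barnes_series r a w s"
      by (intro tendsto_intros)
  qed (rule Gamma_mult_sum_grid_tendsto[OF s u])
qed

text \<open>The r + k integrations by parts produce (s - r)(s - r + 1) ... (s + k - 1). Its first r
  factors are \<open>P s\<close>; the other k turn 1/Gamma(s + k) into 1/Gamma(s).\<close>

lemma E_eq_barnes_series:
  assumes s: "Re s > real r" and u: "Re u > 0"
  shows "E k u s = P s * barnes_series r a w s"
proof -
  have "J u (s + of_nat k) (r + k) = J u ((s - of_nat r) + of_nat (r + k)) (r + k)" by simp
  also have "\<dots> = (- 1) ^ (r + k) * pochhammer (s - of_nat r) (r + k) * J u (s - of_nat r) 0"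
    by (rule J_add_nat[OF u]) (use s in simp)
  also have "pochhammer (s - of_nat r) (r + k) = P s * pochhammer s k"
    by (simp add: P_def pochhammer_product')
  finally have "E k u s = ((- 1) ^ (r + k) * (- 1) ^ (r + k)) * P s * (pochhammer s k * rGamma (s + of_nat k)) * (Gamma s * barnes_series r a w s)"
    unfolding E_def Gamma_mult_barnes_series[OF s u] by simp
  also have "((- 1) ^ (r + k) * (- 1) ^ (r + k) :: complex) = 1" by (simp flip: power_mult_distrib)
  also have "pochhammer s k * rGamma (s + of_nat k) = rGamma s" by (rule pochhammer_rGamma[symmetric])
  also have "1 * P s * rGamma s * (Gamma s * barnes_series r a w s) = (rGamma s * Gamma s) * (P s * barnes_series r a w s)" by simp
  also have "rGamma s * Gamma s = 1"
  proof -
    have "s \<notin> \<real>\<^sub>\<le>\<^sub>0" using s by (simp add: complex_nonpos_Reals_iff)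
    hence "s \<notin> \<int>\<^sub>\<le>\<^sub>0" using nonpos_Ints_subset_nonpos_Reals by blast
    thus ?thesis by (simp add: rGamma_inverse_Gamma Gamma_eq_zero_iff)
  qed
  finally show ?thesis by simp
qed

text \<open>Independence of the ray, and of the number of derivatives, follows from the identity
  theorem: all versions agree with the series where it converges. No contour has to be
  rotated.\<close>

lemma E_indep:
  assumes "Re u > 0" "Re v > 0" and s: "Re s > - real k" "Re s > - real l"
  shows "E k u s = E l v s"
proof -
  let ?S = "{s. Re s > max (- real k) (- real l)}"
  have "open {s. Re s > real r}" "open ?S" by (rule open_halfspace_Re_gt)+
  moreover have "connected ?S" by (intro convex_connected convex_halfspace_Re_gt)
  moreover have "of_nat (Suc r) \<in> {s. Re s > real r}" by simp
  hence "{s. Re s > real r} \<noteq> {}" by blast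
  moreover have "{s. Re s > real r} \<subseteq> ?S" by auto
  moreover have "E k u holomorphic_on ?S" "E l v holomorphic_on ?S"
    using holomorphic_E assms(1,2) by (auto intro: holomorphic_on_subset)
  ultimately show ?thesis
    using analytic_continuation_open[of "{s. Re s > real r}" ?S "E k u" "E l v" s] s assms(1,2)
    by (auto simp: E_eq_barnes_series)
qed

text \<open>The index floor(- Re s) + 1 exceeds - Re s, so s lies in the half plane where this
  version of \<open>E\<close> is holomorphic.\<close>

definition EE :: "complex \<Rightarrow> complex" where
  "EE s = E (Suc (nat \<lfloor>- Re s\<rfloor>)) 1 s"

lemma EE_eq:
  assumes "Re u > 0" "Re s > - real k"
  shows "EE s = E k u s"
  unfolding EE_def by (rule E_indep) (use assms in \<open>auto, linarith\<close>)

lemma holomorphic_EE: "EE holomorphic_on UNIV"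
proof -
  have "EE field_differentiable (at s)" for s
  proof -
    obtain k :: nat where k: "- Re s < real k" using reals_Archimedean2 by blast
    have op: "open {s. Re s > - real k}" by (rule open_halfspace_Re_gt)
    have "EE holomorphic_on {s. Re s > - real k}"
      by (rule holomorphic_transform[OF holomorphic_E[of 1 k]]) (use EE_eq[of 1] in auto)
    with k op show ?thesis by (intro holomorphic_on_imp_differentiable_at) auto
  qed
  thus ?thesis by (simp add: holomorphic_on_def)
qed

lemma holomorphic_P: "P holomorphic_on A"
  unfolding P_def pochhammer_prod by (intro holomorphic_intros)

lemma P_nonzero:
  assumes "Im s \<noteq> 0 \<or> Re s > real r"
  shows "P s \<noteq> 0"
proof
  assume "P s = 0"
  then obtain k where k: "k < r" "s - of_nat r = - of_nat k"
    unfolding P_def pochhammer_eq_0_iff by auto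
  hence "Im (s - of_nat r) = Im (- of_nat k)" "Re (s - of_nat r) = Re (- of_nat k)" by simp_all
  thus False using assms by auto
qed

text \<open>Every one of the r factors has imaginary part t.\<close>

lemma norm_P_ge:
  assumes "t \<ge> 0"
  shows "norm (P (Complex c t)) \<ge> t ^ r"
proof -
  have "(\<Prod>i<r. t) \<le> (\<Prod>i<r. norm (Complex c t - of_nat r + of_nat i))"
  proof (rule prod_mono)
    fix i show "0 \<le> t \<and> t \<le> norm (Complex c t - of_nat r + of_nat i)"
      using assms abs_Im_le_cmod[of "Complex c t - of_nat r + of_nat i"] by simp
  qed
  thus ?thesis by (simp add: P_def pochhammer_prod prod_norm atLeast0LessThan)
qed

text \<open>The continuation is \<open>EE s / P s\<close> with its singularities normalised by
  \<open>remove_sings\<close>, which makes it nicely meromorphic; the identification with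
  \<open>barnes_zeta\<close> is then the uniqueness lemma.\<close>

lemma
  shows barnes_zeta_eq_EE: "P s \<noteq> 0 \<Longrightarrow> barnes_zeta r a w s = EE s / P s"
    and barnes_zeta_eq_series: "Re s > real r \<Longrightarrow> barnes_zeta r a w s = barnes_series r a w s"
proof -
  define Z where "Z = remove_sings (\<lambda>s. EE s / P s)"
  have Z_eq: "Z s = EE s / P s" if "P s \<noteq> 0" for s
  proof -
    have "EE analytic_on {s}" "P analytic_on {s}"
      using holomorphic_EE holomorphic_P[of UNIV] by (auto simp: analytic_at intro!: exI[of _ UNIV])
    thus ?thesis unfolding Z_def using that by (intro remove_sings_at_analytic analytic_intros) auto
  qed
  have Z: "Z nicely_meromorphic_on UNIV"
    unfolding Z_def
    using holomorphic_EE holomorphic_P[of UNIV]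
    by (intro remove_sings_nicely_meromorphic meromorphic_intros)
       (auto intro!: analytic_on_imp_meromorphic_on simp: analytic_on_open)
  have Zs: "Z s = barnes_series r a w s" if "Re s > real r" for s
    using that Z_eq[of s] P_nonzero[of s] EE_eq[where u = 1 and s = s and k = 0] E_eq_barnes_series[where s = s and u = 1 and k = 0] by simp
  have "barnes_zeta r a w = Z"
    unfolding barnes_zeta_def
  proof (rule the_equality)
    fix Y assume Y: "Y nicely_meromorphic_on UNIV \<and> (\<forall>s. Re s > real r \<longrightarrow> Y s = barnes_series r a w s)"
    have "of_nat (Suc r) \<in> {s. Re s > real r}" by simp
    hence ne: "{s. Re s > real r} \<noteq> {}" by blast
    show "Y = Z"
      by (rule nicely_meromorphic_unique[OF _ Z open_halfspace_Re_gt ne]) (use Y Zs in auto)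
  qed (use Z Zs in auto)
  thus "P s \<noteq> 0 \<Longrightarrow> barnes_zeta r a w s = EE s / P s"
    and "Re s > real r \<Longrightarrow> barnes_zeta r a w s = barnes_series r a w s"
    using Z_eq Zs by auto
qed

section \<open>Bounds for the continuation off the critical lines\<close>

text \<open>The pole of Gamma(c - r) at c = r is split off as 1/(c - r); what remains is continuous
  on [r, B]. Keeping this factor explicit allows c to depend on t.\<close>

lemma norm_barnes_zeta_right_le:
  "\<exists>C. \<forall>c t. real r < c \<longrightarrow> c \<le> B \<longrightarrow> norm (barnes_zeta r a w (Complex c t)) \<le> C / (c - real r)"
proof -
  obtain M where M: "M \<ge> 0" "\<And>p. Re p > 0 \<Longrightarrow> norm (J 1 p 0) \<le> M * (Gamma (Re p) * (a / 2) powr (- Re p))"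
    using norm_J_one_le by blast
  have "continuous_on {real r..B} (\<lambda>c. M * (Gamma (c - real r + 1) * (a / 2) powr (- (c - real r))) / Gamma c)"
  proof (intro continuous_intros continuous_on_compose2[OF continuous_on_Gamma[of "{0<..}"]])
    have "Gamma c > 0" if "c \<in> {real r..B}" for c
      using that r_pos by (intro Gamma_real_pos) auto
    thus "\<forall>c\<in>{real r..B}. Gamma c \<noteq> 0" by force
  qed (use r_pos a_pos in \<open>auto elim!: nonpos_Ints_cases\<close>)
  from continuous_on_compact_bound[OF compact_Icc this]
  obtain C where C: "\<And>c. c \<in> {real r..B} \<Longrightarrow> \<bar>M * (Gamma (c - real r + 1) * (a / 2) powr (- (c - real r))) / Gamma c\<bar> \<le> C"
    by auto
  show ?thesis
  proof (intro exI[of _ C] allI impI)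
    fix c t assume c: "real r < c" "c \<le> B"
    have G: "Gamma c > 0" using c by (intro Gamma_real_pos) auto
    have "norm (barnes_zeta r a w (Complex c t)) \<le> norm (J 1 (of_real c - of_nat r) 0) / Gamma c"
      using norm_barnes_series_le[of "Complex c t"] c by (simp add: barnes_zeta_eq_series)
    also have "\<dots> \<le> M * (Gamma (c - real r) * (a / 2) powr (- (c - real r))) / Gamma c"
      using M(2)[of "of_real c - of_nat r"] c G by (intro divide_right_mono) auto
    also have "Gamma (c - real r) = Gamma (c - real r + 1) / (c - real r)"
    proof -
      have "c - real r \<notin> \<int>\<^sub>\<le>\<^sub>0" using c by (auto elim!: nonpos_Ints_cases)
      thus ?thesis using Gamma_plus1[of "c - real r"] c by simp
    qed
    also have "M * (Gamma (c - real r + 1) / (c - real r) * (a / 2) powr (- (c - real r))) / Gamma c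
        = M * (Gamma (c - real r + 1) * (a / 2) powr (- (c - real r))) / Gamma c / (c - real r)" by simp
    also have "\<dots> \<le> C / (c - real r)"
      using order_trans[OF abs_ge_self C[of c]] c by (intro divide_right_mono) auto
    finally show "norm (barnes_zeta r a w (Complex c t)) \<le> C / (c - real r)" .
  qed
qed

text \<open>With u = 1 the exponential growth of 1/Gamma is not compensated. That is harmless: the
  Gaussian factor in the rectangle beats it.\<close>

lemma norm_barnes_zeta_crude_le:
  "\<exists>C. \<forall>c \<in> {\<alpha>..\<beta>}. \<forall>t \<ge> 1. norm (barnes_zeta r a w (Complex c t)) \<le> C * exp (pi * t)"
proof -
  define k where "k = Suc (nat \<lfloor>- \<alpha>\<rfloor>)"
  have k: "c + real k > 0" if "c \<ge> \<alpha>" for c using that unfolding k_def by linarith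
  have k': "c > 0" if "c \<ge> \<alpha> + real k" for c using k[of "c - real k"] that by simp
  obtain M where M: "M \<ge> 0" "\<And>p. Re p > 0 \<Longrightarrow> norm (J 1 p (r + k)) \<le> M * (Gamma (Re p) * (a / 2) powr (- Re p))"
    using norm_J_one_le by blast
  obtain C1 where C1: "\<And>c t. c \<in> {\<alpha> + real k..\<beta> + real k} \<Longrightarrow> t \<ge> 1 \<Longrightarrow> norm (rGamma (Complex c t)) \<le> C1 * exp (pi * t)"
    using norm_rGamma_vertical_strip_le by blast
  have "continuous_on {\<alpha>..\<beta>} (\<lambda>c. M * (Gamma (c + real k) * (a / 2) powr (- (c + real k))))"
    by (intro continuous_intros continuous_on_compose2[OF continuous_on_Gamma[of "{0<..}"]])
       (use a_pos k k' in \<open>auto elim!: nonpos_Ints_cases\<close>)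
  from continuous_on_compact_bound[OF compact_Icc this]
  obtain C2 where C2: "\<And>c. c \<in> {\<alpha>..\<beta>} \<Longrightarrow> \<bar>M * (Gamma (c + real k) * (a / 2) powr (- (c + real k)))\<bar> \<le> C2"
    by auto
  show ?thesis
  proof (intro exI[of _ "C1 * C2"] ballI allI impI)
    fix c t :: real assume c: "c \<in> {\<alpha>..\<beta>}" and t: "t \<ge> 1"
    let ?s = "Complex c t"
    have sk: "?s + of_nat k = Complex (c + real k) t" by (simp add: complex_eq_iff)
    have P1: "norm (P ?s) \<ge> 1"
      using norm_P_ge[of t c] t one_le_power[of t r] by linarith
    have "norm (barnes_zeta r a w ?s) = norm (EE ?s) / norm (P ?s)"
      using P_nonzero[of ?s] t by (simp add: barnes_zeta_eq_EE norm_divide)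
    also have "\<dots> \<le> norm (EE ?s) / 1"
      using P1 by (intro divide_left_mono) auto
    also have "norm (EE ?s) / 1 = norm (rGamma (Complex (c + real k) t)) * norm (J 1 (Complex (c + real k) t) (r + k))"
      using EE_eq[where u = 1 and s = ?s and k = k] k[of c] c by (simp add: E_def norm_mult norm_power sk)
    also have "\<dots> \<le> (C1 * exp (pi * t)) * C2"
    proof (intro mult_mono C1)
      show "norm (J 1 (Complex (c + real k) t) (r + k)) \<le> C2"
        using M(2)[of "Complex (c + real k) t"] C2[OF c] k[of c] c by auto
      show "0 \<le> C1 * exp (pi * t)" using C1[of "c + real k" t] c t by (intro order_trans[OF norm_ge_zero]) auto
    qed (use c t in auto)
    finally show "norm (barnes_zeta r a w ?s) \<le> C1 * C2 * exp (pi * t)" by (simp add: mult_ac)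
  qed
qed

end

section \<open>Integrals over Poisson kernels\<close>

text \<open>Gives Re u = sin (1/t) \<ge> 1/(2 t) for the ray of argument pi/2 - 1/t.\<close>

lemma half_le_sin:
  fixes x :: real assumes "0 \<le> x" "x \<le> 1" shows "x / 2 \<le> sin x"
proof -
  have "(\<lambda>x. sin x - x / 2) 0 \<le> (\<lambda>x. sin x - x / 2) x"
  proof (rule DERIV_nonneg_imp_nondecreasing[OF assms(1)])
    fix y assume y: "0 \<le> y" "y \<le> x"
    have "cos (pi / 3) \<le> cos y" using y assms pi_gt3 by (intro cos_monotone_0_pi_le) auto
    hence "0 \<le> cos y - 1 / 2" by (simp add: cos_60)
    thus "\<exists>d. ((\<lambda>x. sin x - x / 2) has_real_derivative d) (at y) \<and> 0 \<le> d"
      by (intro exI[of _ "cos y - 1 / 2"]) (auto intro!: derivative_eq_intros)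
  qed
  thus ?thesis by simp
qed

lemma powr_minus_le_one_plus_inverse:
  fixes y \<delta> :: real
  assumes "y > 0" "0 \<le> \<delta>" "\<delta> \<le> 1"
  shows "y powr (- \<delta>) \<le> 1 + 1 / y"
proof (cases "y \<ge> 1")
  case True
  hence "y powr (- \<delta>) \<le> y powr 0" using assms by (intro powr_mono) auto
  moreover have "y powr 0 = 1" "1 / y > 0" using assms by simp_all
  ultimately show ?thesis by linarith
next
  case False
  hence "y powr (- \<delta>) \<le> y powr (- 1)" using assms by (intro powr_mono') auto
  thus ?thesis using assms by (simp add: powr_minus inverse_eq_divide)
qed

text \<open>The Poisson kernel of the unit disc at the boundary point 1, that is Re ((1 + q)/(1 -
  q)).\<close>

definition poisson :: "complex \<Rightarrow> real" where
  "poisson q = (1 - (norm q)\<^sup>2) / (norm (1 - q))\<^sup>2"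

text \<open>Splits off the mean value 1. For q = exp (- c u x) the rest is the real part of the
  x-derivative of (2/(c u)) Ln (1 - q).\<close>

lemma poisson_eq:
  assumes "q \<noteq> 1"
  shows "poisson q = 1 + Re (2 * q / (1 - q))"
proof -
  have "1 + 2 * q / (1 - q) = (1 + q) / (1 - q)" using assms by (simp add: field_simps)
  hence "1 + Re (2 * q / (1 - q)) = Re ((1 + q) / (1 - q))"
    by (metis one_complex.sel(1) plus_complex.sel(1))
  also have "\<dots> = Re ((1 + q) * cnj (1 - q)) / (norm (1 - q))\<^sup>2"
    by (subst complex_div_cnj) simp
  also have "Re ((1 + q) * cnj (1 - q)) = 1 - (norm q)\<^sup>2"
    by (simp add: cmod_power2) (simp add: algebra_simps power2_eq_square)
  finally show ?thesis by (simp add: poisson_def)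
qed

text \<open>
  On the ray through \<open>u\<close> the Poisson kernel has the explicit primitive
  \<open>x + Re (2 / (c u) Ln (1 - exp (- c u x)))\<close>, which stays within bounded distance of \<open>x\<close>
  uniformly in \<open>u\<close>.
\<close>
lemma poisson_ray_integral_le:
  fixes c x0 :: real
  assumes c: "c > 0" and x0: "x0 > 0"
  shows "\<exists>C\<ge>0. \<forall>u \<delta> R. norm u = 1 \<longrightarrow> Re u > 0 \<longrightarrow> 0 < \<delta> \<longrightarrow> \<delta> \<le> 1 \<longrightarrow> x0 \<le> R \<longrightarrow>
    (\<lambda>x. x powr (- 1 - \<delta>) * poisson (exp (- (of_real c * (u * of_real x))))) integrable_on {x0..R} \<and>
    integral {x0..R} (\<lambda>x. x powr (- 1 - \<delta>) * poisson (exp (- (of_real c * (u * of_real x))))) \<le> C / \<delta>"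
proof -
  define M where "M = 2 / c * (1 + 1 / (c * x0) + pi)"
  define C where "C = (1 + 1 / x0) * (1 + 2 * M / x0)"
  have M: "M > 0" unfolding M_def using c x0 pi_gt_zero by (intro mult_pos_pos add_pos_pos) auto
  have C: "C \<ge> 0" unfolding C_def using M x0 by (intro mult_nonneg_nonneg add_nonneg_nonneg) auto
  have "(\<lambda>x. x powr (- 1 - \<delta>) * poisson (exp (- (of_real c * (u * of_real x))))) integrable_on {x0..R} \<and>
    integral {x0..R} (\<lambda>x. x powr (- 1 - \<delta>) * poisson (exp (- (of_real c * (u * of_real x))))) \<le> C / \<delta>"
    if u: "norm u = 1" "Re u > 0" and \<delta>: "0 < \<delta>" "\<delta> \<le> 1" and R: "x0 \<le> R" for u \<delta> R
  proof -
    have u0: "u \<noteq> 0" using u by auto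
    have u1: "Re u \<le> 1" "\<bar>Im u\<bar> \<le> 1" using u abs_Re_le_cmod[of u] abs_Im_le_cmod[of u] by auto
    define q where "q = (\<lambda>x::real. exp (- (of_real c * (u * of_real x))))"
    define L where "L = (\<lambda>x. Ln (1 - q x))"
    define \<Psi> where "\<Psi> = (\<lambda>x. Re (2 / (of_real c * u) * L x))"
    \<comment> \<open>A primitive of a majorant. Differentiating the first two terms gives x^(- 1 -
      \<delta>) times the kernel, minus (1 + \<delta>) x^(- 2 - \<delta>) \<Psi>; the last term adds
      (1 + \<delta>) x^(- 2 - \<delta>) M, and M - \<Psi> \<ge> 0.\<close>
    define \<Theta> where "\<Theta> = (\<lambda>x. x powr (- 1 - \<delta>) * \<Psi> x - x powr (- \<delta>) / \<delta> - M * x powr (- 1 - \<delta>))"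
    have q: "norm (q x) = exp (- (c * Re u * x))" for x by (simp add: q_def)
    have q1: "norm (q x) < 1" if "x > 0" for x using that c u unfolding q by simp
    have Req: "Re (1 - q x) > 0" if "x > 0" for x
      using q1[OF that] complex_Re_le_cmod[of "q x"] by simp
    have qn1: "q x \<noteq> 1" if "x > 0" for x using q1[OF that] by auto
    have \<Psi>_le: "\<bar>\<Psi> x\<bar> \<le> M" if x: "x \<ge> x0" for x
    proof -
      have xp: "x > 0" using x x0 by simp
      have Im: "\<bar>Im (L x)\<bar> \<le> pi" unfolding L_def using qn1[OF xp] mpi_less_Im_Ln[of "1 - q x"] Im_Ln_le_pi[of "1 - q x"] by auto
      have "norm (1 - q x) \<le> 2" using norm_triangle_ineq4[of 1 "q x"] q1[OF xp] unfolding norm_one by linarith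
      hence "ln (norm (1 - q x)) \<le> norm (1 - q x) - 1" "norm (1 - q x) - 1 \<le> 1"
        using qn1[OF xp] by (auto intro: ln_le_minus_one)
      hence up: "ln (norm (1 - q x)) \<le> 1" by linarith
      have v: "c * Re u * x > 0" using c u xp by simp
      have ge: "1 - exp (- (c * Re u * x)) \<le> norm (1 - q x)"
        using norm_triangle_ineq2[of 1 "q x"] by (simp add: q)
      have "- ln (norm (1 - q x)) = ln (1 / norm (1 - q x))" using qn1[OF xp] by (simp add: ln_div)
      also have "\<dots> \<le> 1 / norm (1 - q x)" using qn1[OF xp] ln_le_minus_one[of "1 / norm (1 - q x)"] by simp
      also have "\<dots> \<le> 1 / (1 - exp (- (c * Re u * x)))"
        using ge v by (intro divide_left_mono mult_pos_pos) auto
      also have "\<dots> \<le> 1 + 1 / (c * Re u * x)" by (rule inverse_one_minus_exp_le[OF v])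
      also have "1 / (c * Re u * x) \<le> 1 / (c * Re u * x0)"
        using x x0 c u by (intro divide_left_mono mult_left_mono mult_pos_pos) auto
      finally have lo: "- ln (norm (1 - q x)) \<le> 1 + 1 / (c * Re u * x0)" by simp
      have "1 / (c * Re u * x0) > 0" using c u x0 by simp
      moreover have "Re (L x) = ln (norm (1 - q x))" unfolding L_def using qn1[OF xp] by simp
      ultimately have "\<bar>Re (L x)\<bar> \<le> 1 + 1 / (c * Re u * x0)" 
        using up lo by linarith
      hence "Re u * \<bar>Re (L x)\<bar> \<le> Re u * (1 + 1 / (c * Re u * x0))" using u by (intro mult_left_mono) auto
      also have "\<dots> \<le> 1 + 1 / (c * x0)" using u u1 by (simp add: distrib_left)
      finally have 1: "Re u * \<bar>Re (L x)\<bar> \<le> 1 + 1 / (c * x0)" .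
      have 2: "\<bar>Im u\<bar> * \<bar>Im (L x)\<bar> \<le> 1 * pi" using u1 Im by (intro mult_mono) auto
      \<comment> \<open>The point of the estimate: since |u| = 1, 1/u is the conjugate of u, so Re L
        is weighted by Re u. This cancels the 1/Re u in the lower bound for ln |1 - q| and makes M
        independent of u.\<close>
      have "2 / (of_real c * u) = of_real (2 / c) * cnj u"
      proof -
        have "u * cnj u = 1" using u(1) by (simp add: complex_norm_square[symmetric])
        thus ?thesis using u0 c by (simp add: field_simps)
      qed
      hence "\<Psi> x = 2 / c * (Re u * Re (L x) + Im u * Im (L x))"
        unfolding \<Psi>_def by (simp add: distrib_left add_divide_distrib)
      hence "\<bar>\<Psi> x\<bar> = 2 / c * \<bar>Re u * Re (L x) + Im u * Im (L x)\<bar>"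
        using c by (simp only: abs_mult) simp
      also have "\<dots> \<le> 2 / c * (Re u * \<bar>Re (L x)\<bar> + \<bar>Im u\<bar> * \<bar>Im (L x)\<bar>)"
        using c u abs_triangle_ineq[of "Re u * Re (L x)" "Im u * Im (L x)"]
        by (intro mult_left_mono) (auto simp: abs_mult)
      also have "\<dots> \<le> M" unfolding M_def using 1 2 c by (intro mult_left_mono) auto
      finally show ?thesis .
    qed
    have d\<Psi>: "(\<Psi> has_real_derivative Re (2 * q x / (1 - q x))) (at x)" if xp: "x > 0" for x
    proof -
      have "((\<lambda>x. 2 / (of_real c * u) * L x) has_vector_derivative 2 * q x / (1 - q x)) (at x)"
        unfolding L_def q_def
      proof (rule has_vector_derivative_real_field)
        have nR: "1 - exp (- (of_real c * (u * of_real x))) \<notin> \<real>\<^sub>\<le>\<^sub>0"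
          using Req[OF xp] by (auto simp: complex_nonpos_Reals_iff q_def)
        define e where "e = exp (- (of_real c * (u * complex_of_real x)))"
        have "((\<lambda>z. 2 / (of_real c * u) * Ln (1 - exp (- (of_real c * (u * z))))) has_field_derivative
            2 / (of_real c * u) * (of_real c * u * e / (1 - e))) (at (of_real x))"
          unfolding e_def using nR
          by (intro DERIV_cmult) (auto intro!: derivative_eq_intros simp: divide_inverse mult_ac)
        moreover have "2 / (of_real c * u) * (of_real c * u * e / (1 - e)) = 2 * e / (1 - e)"
          using u0 c by simp
        ultimately show "((\<lambda>z. 2 / (of_real c * u) * Ln (1 - exp (- (of_real c * (u * z))))) has_field_derivative
            2 * exp (- (of_real c * (u * of_real x))) / (1 - exp (- (of_real c * (u * of_real x))))) (at (of_real x))"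
          unfolding e_def[symmetric] by (rule DERIV_cong)
      qed
      from bounded_linear.has_vector_derivative[OF bounded_linear_Re this] show ?thesis
        unfolding \<Psi>_def has_real_derivative_iff_has_vector_derivative .
    qed
    let ?f = "\<lambda>x. x powr (- 1 - \<delta>) * poisson (q x)"
    let ?d = "\<lambda>x. x powr (- 1 - \<delta>) * poisson (q x) + (1 + \<delta>) * x powr (- 2 - \<delta>) * (M - \<Psi> x)"
    have d\<Theta>: "(\<Theta> has_vector_derivative ?d x) (at x within {x0..R})" if x: "x \<in> {x0..R}" for x
    proof -
      have xp: "x > 0" using x x0 by auto
      have e: "x powr (- 1 - \<delta> - 1) = x powr (- 2 - \<delta>)" "x powr (- \<delta> - 1) = x powr (- 1 - \<delta>)"
        by (rule arg_cong[where f = "(powr) x"], simp)+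
      note pw = has_real_derivative_powr[OF xp]
      have "(\<Theta> has_real_derivative
         ((- 1 - \<delta>) * x powr (- 1 - \<delta> - 1) * \<Psi> x + Re (2 * q x / (1 - q x)) * x powr (- 1 - \<delta>)
         - (- \<delta>) * x powr (- \<delta> - 1) / \<delta>) - M * ((- 1 - \<delta>) * x powr (- 1 - \<delta> - 1))) (at x)"
        unfolding \<Theta>_def
        by (rule DERIV_diff[OF DERIV_diff[OF DERIV_mult[OF pw d\<Psi>[OF xp]] DERIV_cdivide[OF pw]] DERIV_cmult[OF pw]])
      hence "(\<Theta> has_real_derivative ?d x) (at x)"
        unfolding e poisson_eq[OF qn1[OF xp]] using \<delta> by (simp add: algebra_simps)
      thus ?thesis by (simp add: has_real_derivative_iff_has_vector_derivative has_vector_derivative_at_within)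
    qed
    have int: "(?d has_integral (\<Theta> R - \<Theta> x0)) {x0..R}"
      by (rule fundamental_theorem_of_calculus[OF R d\<Theta>])
    have intf: "?f integrable_on {x0..R}"
    proof (rule integrable_continuous_interval)
      have "continuous_on {x0..R} q" unfolding q_def by (intro continuous_intros)
      thus "continuous_on {x0..R} ?f" unfolding poisson_def
        using qn1 x0 by (intro continuous_intros) auto
    qed
    have "integral {x0..R} ?f \<le> integral {x0..R} ?d"
    proof (rule integral_le[OF intf has_integral_integrable[OF int]])
      fix x assume x: "x \<in> {x0..R}"
      have "\<Psi> x \<le> M" using \<Psi>_le[of x] x by auto
      thus "?f x \<le> ?d x" using \<delta> by simp
    qed
    also have "\<dots> = \<Theta> R - \<Theta> x0" using int by (rule integral_unique)
    also have "\<dots> \<le> x0 powr (- \<delta>) / \<delta> + 2 * M * x0 powr (- 1 - \<delta>)"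
    proof -
      have "R powr (- 1 - \<delta>) * \<Psi> R \<le> R powr (- 1 - \<delta>) * M" using \<Psi>_le[OF R] by (intro mult_left_mono) auto
      moreover have "x0 powr (- 1 - \<delta>) * (- M) \<le> x0 powr (- 1 - \<delta>) * \<Psi> x0" using \<Psi>_le[of x0] by (intro mult_left_mono) auto
      moreover have "0 \<le> R powr (- \<delta>) / \<delta>" using \<delta> by simp
      ultimately show ?thesis unfolding \<Theta>_def by (simp add: algebra_simps)
    qed
    also have "x0 powr (- 1 - \<delta>) = x0 powr (- \<delta>) / x0"
      using x0 by (simp add: powr_diff powr_minus field_simps)
    also have "x0 powr (- \<delta>) / \<delta> + 2 * M * (x0 powr (- \<delta>) / x0) \<le> x0 powr (- \<delta>) / \<delta> + 2 * M * (x0 powr (- \<delta>) / x0) / \<delta>"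
    proof -
      have "K \<le> K / \<delta>" if "K \<ge> 0" for K :: real
        using that \<delta> by (simp add: pos_le_divide_eq mult_left_le)
      from this[of "2 * M * (x0 powr (- \<delta>) / x0)"] show ?thesis using M x0 by simp
    qed
    also have "\<dots> = x0 powr (- \<delta>) * (1 + 2 * M / x0) / \<delta>" by (simp add: field_simps add_divide_distrib)
    also have "\<dots> \<le> C / \<delta>" unfolding C_def
      using powr_minus_le_one_plus_inverse[OF x0, of \<delta>] \<delta> M x0
      by (intro divide_right_mono mult_right_mono) auto
    finally show ?thesis using intf unfolding q_def by blast
  qed
  with C show ?thesis by blast
qed

section \<open>Derivatives of the kernel dominated by Poisson kernels\<close>

context barnes
begin

text \<open>Writing y^2 as the Poisson kernel over 1 - |q|^2 costs only one factor 1/(1 - |q|),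
  hence m + 1 in place of m + 2 on the right. This is where one power of t is saved.\<close>

lemma y_power_le:
  assumes z: "Re z > 0" and i: "i < r"
  shows "y i z ^ (m + 2) \<le> (1 + 1 / (w i * Re z)) ^ (m + 1) * poisson (exp (- (of_real (w i) * z)))"
proof -
  let ?q = "exp (- (of_real (w i) * z))"
  let ?g = "1 / (1 - exp (- (w i * Re z)))"
  have v: "w i * Re z > 0" using z w_pos[OF i] by simp
  have nq: "norm ?q = exp (- (w i * Re z))" by simp
  have q1: "norm ?q < 1" using v unfolding nq by simp
  hence qn: "?q \<noteq> 1" by (metis norm_one less_irrefl)
  have y0: "y i z \<ge> 0" by (simp add: y_def)
  have g: "y i z \<le> ?g" by (rule y_le[OF z i])
  have g2: "?g \<le> 1 + 1 / (w i * Re z)" by (rule inverse_one_minus_exp_le[OF v])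
  have g0: "?g \<ge> 0" using q1 unfolding nq by simp
  have sq: "1 - norm ?q \<le> 1 - (norm ?q)\<^sup>2"
    using q1 by (simp add: power2_eq_square mult_le_cancel_right1 del: norm_exp_eq_Re)
  have "(y i z)\<^sup>2 = poisson ?q * (1 / (1 - (norm ?q)\<^sup>2))"
    using q1 sq by (simp add: y_def poisson_def power_divide del: norm_exp_eq_Re)
  also have "\<dots> \<le> poisson ?q * (1 / (1 - norm ?q))"
    using q1 sq by (intro mult_left_mono divide_left_mono mult_pos_pos)
      (auto simp: poisson_def simp del: norm_exp_eq_Re)
  finally have y2: "(y i z)\<^sup>2 \<le> poisson ?q * ?g" unfolding nq .
  have p0: "poisson ?q \<ge> 0" using q1 sq by (auto simp: poisson_def simp del: norm_exp_eq_Re)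
  have "y i z ^ (m + 2) = y i z ^ m * (y i z)\<^sup>2" by (rule power_add)
  also have "\<dots> \<le> ?g ^ m * (poisson ?q * ?g)"
    using y0 g y2 g0 by (intro mult_mono power_mono) auto
  also have "\<dots> = ?g ^ (m + 1) * poisson ?q" by simp
  also have "\<dots> \<le> (1 + 1 / (w i * Re z)) ^ (m + 1) * poisson ?q"
    using g0 g2 p0 by (intro mult_right_mono power_mono) auto
  finally show ?thesis .
qed

text \<open>The constant is uniform in u, with the dependence on Re u explicit. With v = Re u x and
  N = 2 r + j, half of the exponential absorbs (v + 1/w_i)^N, and x^(2 r - 1)/x^N leaves 1/x times
  x^(- j), the latter at most \<rho>^(- j).\<close>

lemma D_ray_le:
  "\<exists>C\<ge>0. \<forall>u x. norm u = 1 \<longrightarrow> Re u > 0 \<longrightarrow> x \<ge> \<rho> \<longrightarrow>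
     x ^ (r - 1) * norm (D (r + Suc j) (u * of_real x)) \<le>
       C / Re u ^ (2 * r + j) * ((1 / x) * exp (- (a * Re u / 2 * x)) *
         (\<Sum>i<r. poisson (exp (- (of_real (w i) * (u * of_real x))))))"
proof -
  define N where "N = 2 * r + j"
  obtain C1 where C1: "C1 \<ge> 0" "\<And>z. Re z > 0 \<Longrightarrow> norm z \<ge> \<rho> \<Longrightarrow>
     norm (D (r + Suc j) z) \<le> C1 * (norm z ^ r * exp (- (a * Re z)) * (\<Sum>i<r. y i z ^ (r + (r + Suc j))))"
    using D_bound by blast
  have "\<exists>C\<ge>0. \<forall>v\<ge>0. (v + 1 / w i) ^ N * exp (- (a / 2 * v)) \<le> C" if "i < r" for i
    using power_mult_exp_bounded[of "a / 2" "1 / w i" N] a_pos w_pos[OF that] by simp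
  then obtain K where K: "\<And>i. i < r \<Longrightarrow> K i \<ge> 0"
      "\<And>i v. i < r \<Longrightarrow> v \<ge> 0 \<Longrightarrow> (v + 1 / w i) ^ N * exp (- (a / 2 * v)) \<le> K i" by metis
  define C2 where "C2 = (\<Sum>i<r. K i)"
  have C2: "K i \<le> C2" if "i < r" for i unfolding C2_def using that K(1) by (intro member_le_sum) auto
  have C20: "C2 \<ge> 0" unfolding C2_def using K(1) by (intro sum_nonneg) auto
  show ?thesis
  proof (intro exI[of _ "C1 * C2 * (1 / \<rho>) ^ j"] conjI allI impI)
    fix u x assume u: "norm u = 1" "Re u > 0" and x: "x \<ge> \<rho>"
    define v where "v = Re u * x"
    have xp: "x > 0" using x rho_pos by simp
    have v: "v > 0" using u xp by (simp add: v_def)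
    have Rez: "Re (u * of_real x) = v" by (simp add: v_def)
    have nz: "norm (u * of_real x) = x" using u xp by (simp add: norm_mult)
    define p where "p = (\<lambda>i. poisson (exp (- (of_real (w i) * (u * of_real x)))))"
    have p0: "p i \<ge> 0" if "i < r" for i
    proof -
      have "norm (exp (- (of_real (w i) * (u * of_real x)))) \<le> 1"
      proof -
        have "Re (of_real (w i) * (u * of_real x)) = w i * v" by (simp add: v_def)
        thus ?thesis using v w_pos[OF that] by (simp only: norm_exp_eq_Re uminus_complex.sel) simp
      qed
      hence "(norm (exp (- (of_real (w i) * (u * of_real x)))))\<^sup>2 \<le> 1" by (intro power_le_one) auto
      thus ?thesis unfolding p_def poisson_def by (intro divide_nonneg_nonneg) auto
    qed
    have yN: "exp (- (a * v / 2)) * y i (u * of_real x) ^ (r + (r + Suc j)) \<le> C2 / v ^ N * p i" if i: "i < r" for i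
    proof -
      obtain m where m: "r + (r + Suc j) = m + 2" "N = m + 1"
        using r_pos by (cases r) (auto simp: N_def)
      have "exp (- (a * v / 2)) * y i (u * of_real x) ^ (r + (r + Suc j)) \<le>
          exp (- (a * v / 2)) * ((1 + 1 / (w i * v)) ^ N * p i)"
        using y_power_le[of "u * of_real x" i m] v i unfolding m p_def Rez by (intro mult_left_mono) auto
      also have "1 + 1 / (w i * v) = (v + 1 / w i) / v" using v by (simp add: field_simps)
      also have "exp (- (a * v / 2)) * (((v + 1 / w i) / v) ^ N * p i) =
         ((v + 1 / w i) ^ N * exp (- (a / 2 * v))) / v ^ N * p i" by (simp add: power_divide)
      also have "\<dots> \<le> C2 / v ^ N * p i"
        using K(2)[OF i, of v] C2[OF i] v p0[OF i] by (intro mult_right_mono divide_right_mono) auto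
      finally show ?thesis .
    qed
    have "x ^ (r - 1) * norm (D (r + Suc j) (u * of_real x)) \<le>
       x ^ (r - 1) * (C1 * (x ^ r * exp (- (a * v)) * (\<Sum>i<r. y i (u * of_real x) ^ (r + (r + Suc j)))))"
      using C1(2)[of "u * of_real x"] v x xp unfolding Rez nz by (intro mult_left_mono) auto
    also have "\<dots> = x ^ (r - 1) * (C1 * (x ^ r * (exp (- (a * v / 2)) * (\<Sum>i<r. exp (- (a * v / 2)) * y i (u * of_real x) ^ (r + (r + Suc j))))))"
    proof -
      have "exp (- (a * v)) = exp (- (a * v / 2)) * exp (- (a * v / 2))" by (simp flip: exp_add)
      thus ?thesis by (simp add: sum_distrib_left mult.assoc)
    qed
    also have "\<dots> \<le> x ^ (r - 1) * (C1 * (x ^ r * (exp (- (a * v / 2)) * (\<Sum>i<r. C2 / v ^ N * p i))))"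
      using yN C1(1) xp by (intro mult_left_mono sum_mono) auto
    also have "\<dots> = C1 * C2 / Re u ^ N * (exp (- (a * v / 2)) * (\<Sum>i<r. p i)) * (x ^ (r - 1) * x ^ r / x ^ N)"
    proof -
      have "(\<Sum>i<r. C2 / v ^ N * p i) = C2 / v ^ N * (\<Sum>i<r. p i)" by (simp add: sum_distrib_left)
      thus ?thesis by (simp add: v_def power_mult_distrib)
    qed
    also have "x ^ (r - 1) * x ^ r / x ^ N = (1 / x) * (1 / x) ^ j"
    proof -
      have "x ^ N = x ^ (r - 1) * x ^ r * (x * x ^ j)"
        using r_pos by (cases r) (simp_all add: N_def power_add mult_2)
      thus ?thesis using xp by (simp add: power_divide)
    qed
    also have "C1 * C2 / Re u ^ N * (exp (- (a * v / 2)) * (\<Sum>i<r. p i)) * ((1 / x) * (1 / x) ^ j) \<le>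
        C1 * C2 / Re u ^ N * (exp (- (a * v / 2)) * (\<Sum>i<r. p i)) * ((1 / x) * (1 / \<rho>) ^ j)"
      using x xp rho_pos C1(1) C20 u p0
      by (intro mult_left_mono power_mono mult_nonneg_nonneg sum_nonneg divide_left_mono) auto
    finally show "x ^ (r - 1) * norm (D (r + Suc j) (u * of_real x)) \<le>
       C1 * C2 * (1 / \<rho>) ^ j / Re u ^ (2 * r + j) * ((1 / x) * exp (- (a * Re u / 2 * x)) *
         (\<Sum>i<r. poisson (exp (- (of_real (w i) * (u * of_real x))))))"
      by (simp add: N_def p_def v_def mult_ac)
  qed (use C1 C20 rho_pos in auto)
qed

end

text \<open>From Y^\<delta> \<le> exp Y. It trades the exponential cut-off for a power x^(-
  \<delta>), the weight for which the Poisson primitive was set up.\<close>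

lemma powr_mult_exp_le:
  fixes b x \<delta> :: real
  assumes "b > 0" "x > 0" "0 \<le> \<delta>" "\<delta> \<le> 1"
  shows "exp (- (b * x)) \<le> b powr (- \<delta>) * x powr (- \<delta>)"
proof -
  have bx: "b * x > 0" using assms by simp
  have "(b * x) powr \<delta> \<le> exp (b * x)"
  proof (cases "b * x \<ge> 1")
    case True
    hence "(b * x) powr \<delta> \<le> (b * x) powr 1" using assms by (intro powr_mono) auto
    also have "\<dots> = b * x" using bx by (simp del: zero_less_mult_iff)
    also have "\<dots> \<le> exp (b * x)" using exp_ge_add_one_self[of "b * x"] by linarith
    finally show ?thesis .
  next
    case False
    hence "(b * x) powr \<delta> \<le> 1" using bx assms by (intro powr_le1) auto
    also have "1 \<le> exp (b * x)" using bx by simp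
    finally show ?thesis .
  qed
  hence "1 / exp (b * x) \<le> 1 / (b * x) powr \<delta>" using bx assms by (intro divide_left_mono mult_pos_pos) auto
  thus ?thesis using assms by (simp add: exp_minus powr_minus powr_mult field_simps)
qed

section \<open>Growth on vertical lines\<close>

context barnes
begin

text \<open>
  The ray of argument \<open>pi/2 - 1/t\<close> is chosen so that \<open>u powr (s + k)\<close> has the exponential decay
  of \<open>Gamma (s + k)\<close>.
\<close>
lemma J_ray_integral_le:
  "\<exists>C\<ge>0. \<forall>t\<ge>1. norm (integral {0<..} (\<lambda>x. of_real x powr (Complex (real r) t - 1) *
       D (r + Suc j) (Complex (sin (1 / t)) (cos (1 / t)) * of_real x))) \<le> C * (t ^ (2 * r + j) * ln (t + 2))"
proof -
  define N where "N = 2 * r + j"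
  obtain C0 where C0: "C0 \<ge> 0" "\<And>z. norm z \<le> \<rho> \<Longrightarrow> norm (D (r + Suc j) z) \<le> C0" using D_bounded_near_0 by blast
  obtain C1 where C1: "C1 \<ge> 0" "\<And>u x. norm u = 1 \<Longrightarrow> Re u > 0 \<Longrightarrow> x \<ge> \<rho> \<Longrightarrow>
     x ^ (r - 1) * norm (D (r + Suc j) (u * of_real x)) \<le>
       C1 / Re u ^ N * ((1 / x) * exp (- (a * Re u / 2 * x)) *
         (\<Sum>i<r. poisson (exp (- (of_real (w i) * (u * of_real x))))))"
    using D_ray_le[of j] unfolding N_def by blast
  define Q where "Q = (\<lambda>i C. C \<ge> 0 \<and> (\<forall>u \<delta> R. norm u = 1 \<longrightarrow> Re u > 0 \<longrightarrow> 0 < \<delta> \<longrightarrow> \<delta> \<le> 1 \<longrightarrow> \<rho> \<le> R \<longrightarrow>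
    (\<lambda>x. x powr (- 1 - \<delta>) * poisson (exp (- (of_real (w i) * (u * of_real x))))) integrable_on {\<rho>..R} \<and>
    integral {\<rho>..R} (\<lambda>x. x powr (- 1 - \<delta>) * poisson (exp (- (of_real (w i) * (u * of_real x))))) \<le> C / \<delta>))"
  have "\<forall>i\<in>{..<r}. \<exists>C. Q i C"
    unfolding Q_def using poisson_ray_integral_le[OF w_pos rho_pos] by auto
  from bchoice[OF this] obtain K where K': "\<And>i. i < r \<Longrightarrow> Q i (K i)" by auto
  have K0: "K i \<ge> 0" if "i < r" for i using K'[OF that] by (simp add: Q_def)
  have K: "(\<lambda>x. x powr (- 1 - \<delta>) * poisson (exp (- (of_real (w i) * (u * of_real x))))) integrable_on {\<rho>..R} \<and>
    integral {\<rho>..R} (\<lambda>x. x powr (- 1 - \<delta>) * poisson (exp (- (of_real (w i) * (u * of_real x))))) \<le> K i / \<delta>"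
    if "i < r" "norm u = 1" "Re u > 0" "0 < \<delta>" "\<delta> \<le> 1" "\<rho> \<le> R" for i u \<delta> R
    using K'[OF that(1)] that(2-) unfolding Q_def by blast
  define KK where "KK = (\<Sum>i<r. K i)"
  have KK: "KK \<ge> 0" unfolding KK_def using K0 by (intro sum_nonneg) auto
  \<comment> \<open>Bounds (a Re u / 2)^(- \<delta>): this is at most exp (\<delta> (ln (4/a) + ln
    t)), where \<delta> \<le> 1 and \<delta> ln t \<le> 1.\<close>
  define C2 where "C2 = exp (\<bar>ln (4 / a)\<bar> + 1)"
  define C where "C = C0 * \<rho> ^ r + C1 * 2 ^ N * C2 * KK"
  show ?thesis
  proof (intro exI[of _ C] conjI allI impI)
    show "C \<ge> 0" unfolding C_def using C0 C1 KK rho_pos by (simp add: C2_def)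
    fix t :: real assume t: "t \<ge> 1"
    define u where "u = Complex (sin (1 / t)) (cos (1 / t))"
    \<comment> \<open>Balances two costs: the Poisson integral contributes 1/\<delta> = ln (t + 2),
      while t^\<delta> stays bounded. The shift by 2 ensures \<delta> \<le> 1 from t = 1 on.\<close>
    define \<delta> where "\<delta> = 1 / ln (t + 2)"
    have "exp 1 \<le> t + 2" using t exp_le by linarith
    hence L: "ln (t + 2) \<ge> 1" using t by (subst ln_ge_iff) auto
    have \<delta>: "0 < \<delta>" "\<delta> \<le> 1" using L by (auto simp: \<delta>_def)
    have nu: "norm u = 1" by (simp add: u_def complex_norm)
    have Reu: "Re u \<ge> 1 / (2 * t)" using half_le_sin[of "1 / t"] t by (simp add: u_def)
    hence Ru: "Re u > 0" using t by (smt (verit) divide_pos_pos)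
    define f where "f = (\<lambda>x. of_real x powr (Complex (real r) t - 1) * D (r + Suc j) (u * of_real x))"
    obtain M where M: "\<And>x. x > 0 \<Longrightarrow> norm (D (r + Suc j) (u * of_real x)) \<le> M * exp (- (a * Re u / 2 * x))"
      using D_ray_decay[OF Ru] by blast
    have fint: "f absolutely_integrable_on {0<..}" unfolding f_def
      by (rule mellin_absolutely_integrable[OF continuous_on_D_ray[OF Ru] M]) (use a_pos Ru r_pos in auto)
    have nf: "norm (f x) = x ^ (r - 1) * norm (D (r + Suc j) (u * of_real x))" if "x > 0" for x
      using that r_pos by (simp add: f_def norm_mult norm_powr_real_powr powr_realpow[symmetric] of_nat_diff)
    have near: "norm (f x) \<le> \<rho> ^ (r - 1) * C0" if "x > 0" "x \<le> \<rho>" for x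
      unfolding nf[OF that(1)] using that nu rho_pos C0(1)
      by (intro mult_mono power_mono C0(2)) (auto simp: norm_mult)
    define A where "A = C1 / Re u ^ N * C2"
    have A: "A \<ge> 0" unfolding A_def using C1 Ru by (simp add: C2_def)
    have far: "norm (f x) \<le> A * (\<Sum>i<r. x powr (- 1 - \<delta>) * poisson (exp (- (of_real (w i) * (u * of_real x)))))" if x: "x \<ge> \<rho>" for x
    proof -
      have xp: "x > 0" using x rho_pos by simp
      let ?p = "\<Sum>i<r. poisson (exp (- (of_real (w i) * (u * of_real x))))"
      have p: "?p \<ge> 0"
      proof (intro sum_nonneg)
        fix i assume "i \<in> {..<r}"
        hence "norm (exp (- (of_real (w i) * (u * of_real x)))) \<le> 1"
          using w_pos[of i] Ru xp by (auto simp: norm_exp_eq_Re)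
        hence "(norm (exp (- (of_real (w i) * (u * of_real x)))))\<^sup>2 \<le> 1" by (intro power_le_one) auto
        thus "poisson (exp (- (of_real (w i) * (u * of_real x)))) \<ge> 0"
          unfolding poisson_def by (intro divide_nonneg_nonneg) auto
      qed
      have b: "a * Re u / 2 \<ge> a / (4 * t)" using mult_left_mono[OF Reu, of "a / 2"] a_pos by simp
      have b0: "a / (4 * t) > 0" using a_pos t by simp
      have "exp (- (a * Re u / 2 * x)) \<le> (a * Re u / 2) powr (- \<delta>) * x powr (- \<delta>)"
        using a_pos Ru xp \<delta> by (intro powr_mult_exp_le) auto
      also have "(a * Re u / 2) powr (- \<delta>) \<le> C2"
      proof -
        have "(a * Re u / 2) powr (- \<delta>) \<le> (a / (4 * t)) powr (- \<delta>)"
          using b b0 \<delta> by (intro powr_mono2') auto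
        also have "\<dots> = exp (\<delta> * (ln (4 / a) + ln t))"
          using a_pos t by (simp add: powr_def ln_div ln_mult algebra_simps)
        also have "\<delta> * (ln (4 / a) + ln t) \<le> \<bar>ln (4 / a)\<bar> + 1"
        proof -
          have "\<delta> * ln (4 / a) \<le> \<delta> * \<bar>ln (4 / a)\<bar>" using \<delta> by (intro mult_left_mono) auto
          also have "\<dots> \<le> 1 * \<bar>ln (4 / a)\<bar>" using \<delta> by (intro mult_right_mono) auto
          finally have "\<delta> * ln (4 / a) \<le> \<bar>ln (4 / a)\<bar>" by simp
          moreover have "\<delta> * ln t \<le> 1"
          proof -
            have "ln t \<le> ln (t + 2)" using t by simp
            thus ?thesis using L by (simp add: \<delta>_def field_simps)
          qed
          ultimately show ?thesis by (simp add: distrib_left)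
        qed
        finally show ?thesis by (simp add: C2_def)
      qed
      finally have ex: "exp (- (a * Re u / 2 * x)) \<le> C2 * x powr (- \<delta>)" by (simp add: mult_right_mono)
      have "norm (f x) \<le> C1 / Re u ^ N * ((1 / x) * exp (- (a * Re u / 2 * x)) * ?p)"
        unfolding nf[OF xp] by (rule C1(2)[OF nu Ru x])
      also have "\<dots> \<le> C1 / Re u ^ N * ((1 / x) * (C2 * x powr (- \<delta>)) * ?p)"
        using ex p C1(1) Ru xp by (intro mult_left_mono mult_right_mono) auto
      also have "\<dots> = A * (x powr (- 1 - \<delta>) * ?p)"
        using xp by (simp add: A_def powr_diff powr_minus field_simps)
      finally show ?thesis by (simp add: sum_distrib_left)
    qed
    \<comment> \<open>The estimate is made on compact intervals with a bound free of n. Up to \<rho>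
      the derivative is bounded; beyond it the Poisson integrals apply.\<close>
    have "norm (integral {1 / real (Suc n)..real (Suc n)} f) \<le> C0 * \<rho> ^ r + A * (KK / \<delta>)"
      if n: "real (Suc n) \<ge> \<rho>" "1 / real (Suc n) \<le> \<rho>" for n
    proof -
      let ?e = "1 / real (Suc n)" and ?R = "real (Suc n)"
      have e: "?e > 0" by simp
      have sub: "f integrable_on {?e..?R}"
      proof -
        have "f absolutely_integrable_on {?e..?R}"
          by (rule set_integrable_subset[OF fint]) (auto intro: less_le_trans[OF e])
        thus ?thesis by (simp add: absolutely_integrable_on_def)
      qed
      have s1: "f integrable_on {?e..\<rho>}" and s2: "f integrable_on {\<rho>..?R}"
        by (rule integrable_subinterval_real[OF sub]; use n in simp)+
      have split: "integral {?e..?R} f = integral {?e..\<rho>} f + integral {\<rho>..?R} f"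
        by (rule Henstock_Kurzweil_Integration.integral_combine[symmetric]) (use n sub in auto)
      have "norm (integral {?e..\<rho>} f) \<le> C0 * \<rho> ^ r"
      proof -
        have "norm (integral {?e..\<rho>} f) \<le> integral {?e..\<rho>} (\<lambda>_. \<rho> ^ (r - 1) * C0)"
        proof (intro integral_norm_bound_integral s1)
          show "norm (f x) \<le> \<rho> ^ (r - 1) * C0" if "x \<in> {?e..\<rho>}" for x
            using near[of x] less_le_trans[OF e, of x] that by auto
        qed auto
        also have "\<dots> = (\<rho> - ?e) * (\<rho> ^ (r - 1) * C0)" using n by simp
        also have "\<dots> \<le> \<rho> * (\<rho> ^ (r - 1) * C0)" using e C0(1) rho_pos by (intro mult_right_mono) auto
        also have "\<dots> = C0 * \<rho> ^ r" using r_pos by (cases r) auto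
        finally show ?thesis .
      qed
      moreover have "norm (integral {\<rho>..?R} f) \<le> A * (KK / \<delta>)"
      proof -
        let ?g = "\<lambda>i x. x powr (- 1 - \<delta>) * poisson (exp (- (of_real (w i) * (u * of_real x))))"
        have gi: "?g i integrable_on {\<rho>..?R}" "integral {\<rho>..?R} (?g i) \<le> K i / \<delta>" if "i < r" for i
          using K[OF that nu Ru \<delta> n(1)] by auto
        have "norm (integral {\<rho>..?R} f) \<le> integral {\<rho>..?R} (\<lambda>x. A * (\<Sum>i<r. ?g i x))"
          using far gi(1) by (intro integral_norm_bound_integral s2 integrable_on_mult_right integrable_sum) auto
        also have "\<dots> = A * integral {\<rho>..?R} (\<lambda>x. \<Sum>i<r. ?g i x)" by simp
        also have "integral {\<rho>..?R} (\<lambda>x. \<Sum>i<r. ?g i x) = (\<Sum>i<r. integral {\<rho>..?R} (?g i))"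
          by (rule integral_sum) (use gi(1) in auto)
        also have "A * (\<Sum>i<r. integral {\<rho>..?R} (?g i)) \<le> A * (\<Sum>i<r. K i / \<delta>)"
          using gi(2) A by (intro mult_left_mono sum_mono) auto
        finally show ?thesis by (simp add: KK_def sum_divide_distrib)
      qed
      ultimately show ?thesis unfolding split
        using norm_triangle_ineq[of "integral {?e..\<rho>} f" "integral {\<rho>..?R} f"] by linarith
    qed
    note finite_le = this
    have bd: "eventually (\<lambda>n. norm (integral {1 / real (Suc n)..real (Suc n)} f) \<le> C0 * \<rho> ^ r + A * (KK / \<delta>)) sequentially"
    proof -
      have "eventually (\<lambda>n. real (Suc n) \<ge> \<rho>) sequentially"
        using eventually_ge_at_top[of "nat \<lceil>\<rho>\<rceil>"] by eventually_elim linarith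
      moreover have "eventually (\<lambda>n. 1 / real (Suc n) \<le> \<rho>) sequentially"
        using eventually_ge_at_top[of "nat \<lceil>1 / \<rho>\<rceil>"]
      proof eventually_elim
        case (elim n)
        hence "1 / \<rho> \<le> real (Suc n)" by linarith
        thus ?case using rho_pos by (simp add: field_simps)
      qed
      ultimately show ?thesis by eventually_elim (rule finite_le)
    qed
    have "norm (integral {0<..} f) \<le> C0 * \<rho> ^ r + A * (KK / \<delta>)"
      by (rule tendsto_upperbound[OF tendsto_norm[OF integral_exhaust_tendsto[OF fint]] bd]) simp
    also have "\<dots> \<le> C * (t ^ N * ln (t + 2))"
    proof -
      have tN: "1 \<le> t ^ N" using t by (rule one_le_power)
      have "1 / Re u ^ N \<le> (2 * t) ^ N"
      proof -
        have "1 / Re u \<le> 2 * t" using Reu Ru t by (simp add: field_simps)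
        hence "(1 / Re u) ^ N \<le> (2 * t) ^ N" using Ru by (intro power_mono) auto
        thus ?thesis by (simp add: power_divide)
      qed
      hence "C1 * C2 * KK * ln (t + 2) * (1 / Re u ^ N) \<le> C1 * C2 * KK * ln (t + 2) * (2 * t) ^ N"
        using C1 KK L by (intro mult_left_mono) (auto simp: C2_def)
      hence "A * (KK / \<delta>) \<le> C1 * 2 ^ N * C2 * KK * (t ^ N * ln (t + 2))"
        by (simp add: A_def \<delta>_def power_mult_distrib mult_ac)
      moreover have "C0 * \<rho> ^ r * 1 \<le> C0 * \<rho> ^ r * (t ^ N * ln (t + 2))"
        using tN L C0 rho_pos mult_mono[of 1 "t ^ N" 1 "ln (t + 2)"] by (intro mult_left_mono) auto
      ultimately show ?thesis by (simp add: C_def distrib_right)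
    qed
    finally show "norm (integral {0<..} (\<lambda>x. of_real x powr (Complex (real r) t - 1) *
       D (r + Suc j) (Complex (sin (1 / t)) (cos (1 / t)) * of_real x))) \<le> C * (t ^ (2 * r + j) * ln (t + 2))"
      by (simp add: f_def u_def N_def)
  qed
qed

text \<open>Shifting by k = j + 1 puts the argument of Gamma at r + i t for every j. There |1/Gamma|
  is at most t^(1/2 - r) exp (pi t / 2), the integral at most a constant times t^(2 r + j) ln (t +
  2), and |P| at least t^r.\<close>

lemma norm_barnes_zeta_line_le:
  "\<exists>C\<ge>0. \<forall>t\<ge>1. norm (barnes_zeta r a w (Complex (real r - 1 - real j) t)) \<le> C * (t powr (real j + 1 / 2) * ln (t + 2))"
proof -
  obtain C where C: "C \<ge> 0" "\<And>t. t \<ge> 1 \<Longrightarrow> norm (integral {0<..} (\<lambda>x. of_real x powr (Complex (real r) t - 1) *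
       D (r + Suc j) (Complex (sin (1 / t)) (cos (1 / t)) * of_real x))) \<le> C * (t ^ (2 * r + j) * ln (t + 2))"
    using J_ray_integral_le by blast
  show ?thesis
  proof (intro exI[of _ "exp 1 * C"] conjI allI impI)
    fix t :: real assume t: "t \<ge> 1"
    let ?s = "Complex (real r - 1 - real j) t"
    define u where "u = Complex (sin (1 / t)) (cos (1 / t))"
    have sk: "?s + of_nat (Suc j) = Complex (real r) t" by (simp add: complex_eq_iff)
    have Ru: "Re u > 0" using half_le_sin[of "1 / t"] t by (simp add: u_def) (smt (verit) divide_pos_pos)
    have "u = exp (\<i> * of_real (pi / 2 - 1 / t))"
      by (simp add: u_def complex_eq_iff Re_exp Im_exp sin_diff cos_diff)
    moreover have "Ln (exp (\<i> * of_real (pi / 2 - 1 / t))) = \<i> * of_real (pi / 2 - 1 / t)"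
    proof (rule Ln_exp)
      have "1 / t \<le> 1" "1 / t > 0" using t by auto
      hence "- pi < pi / 2 - 1 / t" "pi / 2 - 1 / t \<le> pi" using pi_gt3 by linarith+
      thus "- pi < Im (\<i> * of_real (pi / 2 - 1 / t))" "Im (\<i> * of_real (pi / 2 - 1 / t)) \<le> pi"
        by simp_all
    qed
    ultimately have Lu: "Ln u = \<i> * of_real (pi / 2 - 1 / t)" by simp
    \<comment> \<open>The argument pi/2 - 1/t gives |u^(r + i t)| = exp (- t (pi/2 - 1/t)); against
      exp (pi t / 2) only exp 1 survives.\<close>
    have e: "norm (exp (Complex (real r) t * Ln u)) = exp (1 - pi * t / 2)"
      using t by (simp add: Lu field_simps)
    have EE: "EE ?s = E (Suc j) u ?s" by (rule EE_eq[OF Ru]) (use r_pos in simp)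
    have "norm (EE ?s) = norm (rGamma (Complex (real r) t)) * (exp (1 - pi * t / 2) *
        norm (integral {0<..} (\<lambda>x. of_real x powr (Complex (real r) t - 1) * D (r + Suc j) (u * of_real x))))"
      unfolding EE E_def J_def sk by (simp add: norm_mult norm_power e del: norm_exp_eq_Re)
    also have "\<dots> \<le> (t powr (1/2 - real r) * exp (pi * t / 2)) * (exp (1 - pi * t / 2) * (C * (t ^ (2 * r + j) * ln (t + 2))))"
      using norm_rGamma_integer_line_le[of t r] C(2)[OF t] t unfolding u_def
      by (intro mult_mono mult_nonneg_nonneg) auto
    also have "\<dots> = exp 1 * C * (t ^ r * (t powr (real j + 1 / 2) * ln (t + 2)))"
    proof -
      have 1: "exp (pi * t / 2) * exp (1 - pi * t / 2) = exp 1" by (simp flip: exp_add)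
      have 2: "t powr (1/2 - real r) * t ^ (2 * r + j) = t ^ r * t powr (real j + 1 / 2)"
        using t by (simp add: powr_realpow[symmetric] add_ac flip: powr_add)
      have "(t powr (1/2 - real r) * exp (pi * t / 2)) * (exp (1 - pi * t / 2) * (C * (t ^ (2 * r + j) * ln (t + 2)))) =
          (exp (pi * t / 2) * exp (1 - pi * t / 2)) * C * ((t powr (1/2 - real r) * t ^ (2 * r + j)) * ln (t + 2))"
        by (simp only: mult_ac)
      thus ?thesis unfolding 1 2 by (simp only: mult_ac)
    qed
    finally have EEle: "norm (EE ?s) \<le> t ^ r * (exp 1 * C * (t powr (real j + 1 / 2) * ln (t + 2)))" by (simp add: mult_ac)
    have P: "norm (P ?s) \<ge> t ^ r" using t by (intro norm_P_ge) auto
    have tr: "t ^ r > 0" using t by simp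
    have "norm (barnes_zeta r a w ?s) = norm (EE ?s) / norm (P ?s)"
      using P_nonzero[of ?s] t by (simp add: barnes_zeta_eq_EE norm_divide)
    also have "\<dots> \<le> norm (EE ?s) / t ^ r"
      using P tr by (intro divide_left_mono mult_pos_pos) auto
    also have "\<dots> \<le> exp 1 * C * (t powr (real j + 1 / 2) * ln (t + 2))"
      using EEle tr by (simp add: pos_divide_le_eq mult_ac)
    finally show "norm (barnes_zeta r a w ?s) \<le> exp 1 * C * (t powr (real j + 1 / 2) * ln (t + 2))" .
  qed (use C(1) in auto)
qed

section \<open>Interpolation between the lines\<close>

text \<open>The rectangle has half-height T/2, so its heights are comparable to T and at least 1.
  The threshold m is what the horizontal sides require: pi y \<le> 3 pi T/2 \<le> (T/2)^2 + (3
  pi/2)^2. It does not depend on \<beta>, which is essential because \<beta> will move with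
  T.\<close>

lemma norm_barnes_zeta_three_lines:
  "\<exists>m>0. \<forall>\<beta> T A B \<sigma>. \<alpha> < \<beta> \<longrightarrow> \<beta> \<le> \<gamma> \<longrightarrow> T \<ge> 2 \<longrightarrow> m \<le> A \<longrightarrow> m \<le> B \<longrightarrow>
     (\<forall>y\<in>{T/2..3*T/2}. norm (barnes_zeta r a w (Complex \<alpha> y)) \<le> A \<and> norm (barnes_zeta r a w (Complex \<beta> y)) \<le> B) \<longrightarrow>
     \<alpha> \<le> \<sigma> \<longrightarrow> \<sigma> \<le> \<beta> \<longrightarrow>
     norm (barnes_zeta r a w (Complex \<sigma> T)) \<le> exp ((\<beta> - \<alpha>)\<^sup>2) *
       (A powr ((\<beta> - \<sigma>) / (\<beta> - \<alpha>)) * B powr ((\<sigma> - \<alpha>) / (\<beta> - \<alpha>)))"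
proof -
  obtain C' where C': "\<And>c t. c \<in> {\<alpha>..\<gamma>} \<Longrightarrow> t \<ge> 1 \<Longrightarrow> norm (barnes_zeta r a w (Complex c t)) \<le> C' * exp (pi * t)"
    using norm_barnes_zeta_crude_le by blast
  define C where "C = max 1 C'"
  have C: "norm (barnes_zeta r a w (Complex c t)) \<le> C * exp (pi * t)" if "c \<in> {\<alpha>..\<gamma>}" "t \<ge> 1" for c t
    using C'[OF that] by (rule order_trans) (auto simp: C_def intro!: mult_right_mono)
  have C1: "C \<ge> 1" by (simp add: C_def)
  define m where "m = C * exp ((3 * pi / 2)\<^sup>2)"
  have m: "m > 0" using C1 by (simp add: m_def)
  have hol: "barnes_zeta r a w holomorphic_on {s. Im s > 0}"
  proof (rule holomorphic_transform)
    show "(\<lambda>s. EE s / P s) holomorphic_on {s. Im s > 0}"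
      using holomorphic_EE P_nonzero by (intro holomorphic_intros holomorphic_P) (auto intro: holomorphic_on_subset)
    show "EE s / P s = barnes_zeta r a w s" if "s \<in> {s. Im s > 0}" for s
      using barnes_zeta_eq_EE[of s] P_nonzero[of s] that by auto
  qed
  have "norm (barnes_zeta r a w (Complex \<sigma> T)) \<le> exp ((\<beta> - \<alpha>)\<^sup>2) *
       (A powr ((\<beta> - \<sigma>) / (\<beta> - \<alpha>)) * B powr ((\<sigma> - \<alpha>) / (\<beta> - \<alpha>)))"
    if \<beta>: "\<alpha> < \<beta>" "\<beta> \<le> \<gamma>" and T: "T \<ge> 2" and AB: "m \<le> A" "m \<le> B"
      and sides: "\<forall>y\<in>{T/2..3*T/2}. norm (barnes_zeta r a w (Complex \<alpha> y)) \<le> A \<and> norm (barnes_zeta r a w (Complex \<beta> y)) \<le> B"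
      and \<sigma>: "\<alpha> \<le> \<sigma>" "\<sigma> \<le> \<beta>" for \<beta> T A B \<sigma>
  proof (rule three_lines_rectangle[OF \<beta>(1) _ _ _ hol, where R = "T / 2"])
    show "A > 0" "B > 0" using m AB by auto
    show "cbox (Complex \<alpha> (T - T / 2)) (Complex \<beta> (T + T / 2)) \<subseteq> {s. Im s > 0}"
      using T by (auto simp: in_cbox_complex_iff)
    show "norm (barnes_zeta r a w (Complex \<alpha> y)) \<le> A" "norm (barnes_zeta r a w (Complex \<beta> y)) \<le> B" if "\<bar>y - T\<bar> \<le> T / 2" for y
    proof -
      have "T / 2 \<le> y" "y \<le> 3 * T / 2" using that by linarith+
      hence "y \<in> {T/2..3*T/2}" by simp
      with sides show "norm (barnes_zeta r a w (Complex \<alpha> y)) \<le> A" "norm (barnes_zeta r a w (Complex \<beta> y)) \<le> B" by auto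
    qed
    show "norm (barnes_zeta r a w (Complex x y)) \<le> exp ((T / 2)\<^sup>2) * min A B"
      if x: "\<alpha> \<le> x" "x \<le> \<beta>" and y: "\<bar>y - T\<bar> = T / 2" for x y
    proof -
      have y1: "y \<ge> 1" "y \<le> 3 * T / 2" using y T by (auto simp: abs_if split: if_splits)
      have "norm (barnes_zeta r a w (Complex x y)) \<le> C * exp (pi * y)" using x \<beta> y1 by (intro C) auto
      also have "pi * y \<le> (T / 2)\<^sup>2 + (3 * pi / 2)\<^sup>2"
      proof -
        have "pi * y \<le> pi * (3 * T / 2)" using y1 by (intro mult_left_mono) auto
        also have "\<dots> \<le> (T / 2)\<^sup>2 + (3 * pi / 2)\<^sup>2"
        proof -
          have "0 \<le> (T / 2 - 3 * pi / 2)\<^sup>2" by simp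
          thus ?thesis by (simp add: power2_eq_square algebra_simps)
        qed
        finally show ?thesis .
      qed
      hence "C * exp (pi * y) \<le> C * exp ((T / 2)\<^sup>2 + (3 * pi / 2)\<^sup>2)" using C1 by simp
      also have "\<dots> = exp ((T / 2)\<^sup>2) * m" by (simp add: m_def exp_add)
      also have "\<dots> \<le> exp ((T / 2)\<^sup>2) * min A B" using AB by simp
      finally show ?thesis .
    qed
  qed (use T \<sigma> in auto)
  with m show ?thesis by blast
qed

end

text \<open>Transfers a bound at height y to the central height T, using y \<le> 2 T and y + 2 \<le>
  4 T \<le> T^3.\<close>

lemma powr_mult_ln_le:
  fixes p T y :: real
  assumes "p \<ge> 0" "T \<ge> 2" "T / 2 \<le> y" "y \<le> 3 * T / 2"
  shows "y powr p * ln (y + 2) \<le> 3 * 2 powr p * (T powr p * ln T)"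
proof -
  have "y powr p \<le> (2 * T) powr p" using assms by (intro powr_mono2) auto
  hence 1: "y powr p \<le> 2 powr p * T powr p" using assms by (simp add: powr_mult)
  have "4 * T \<le> T ^ 3"
    using mult_mono[of 4 "T * T" T T] mult_mono[of 2 T 2 T] assms by (simp add: power3_eq_cube)
  hence "ln (y + 2) \<le> ln (T ^ 3)" using assms by (subst ln_le_cancel_iff) auto
  also have "\<dots> = 3 * ln T" using assms by (simp add: ln_realpow)
  finally have 2: "ln (y + 2) \<le> 3 * ln T" .
  have "y powr p * ln (y + 2) \<le> (2 powr p * T powr p) * (3 * ln T)"
    using 1 2 assms by (intro mult_mono) auto
  thus ?thesis by (simp add: mult_ac)
qed

context barnes
begin

text \<open>At Re s = r + 1/ln T the factor 1/(c - r) is ln T, the same logarithm as on Re s = r -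
  1, so only powers of T are interpolated. Ending slightly to the right of r changes the exponent by
  at most 1/(2 ln T), which costs a factor exp (1/2).\<close>

lemma norm_barnes_zeta_right_strip_le:
  "\<exists>C. \<forall>\<sigma>\<in>{real r - 1..real r}. \<forall>t\<ge>2.
     norm (barnes_zeta r a w (Complex \<sigma> t)) \<le> C * (t powr ((real r - \<sigma>) / 2) * ln t)"
proof -
  let ?\<alpha> = "real r - 1"
  obtain C1 where C1: "C1 \<ge> 0" "\<And>t. t \<ge> 1 \<Longrightarrow> norm (barnes_zeta r a w (Complex ?\<alpha> t)) \<le> C1 * (t powr (1 / 2) * ln (t + 2))"
    using norm_barnes_zeta_line_le[of 0] by auto
  obtain C2 where C2: "\<And>c t. real r < c \<Longrightarrow> c \<le> real r + 2 \<Longrightarrow> norm (barnes_zeta r a w (Complex c t)) \<le> C2 / (c - real r)"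
    using norm_barnes_zeta_right_le by blast
  obtain m where m: "m > 0" and three: "\<And>\<beta> T A B \<sigma>. ?\<alpha> < \<beta> \<Longrightarrow> \<beta> \<le> real r + 2 \<Longrightarrow> T \<ge> 2 \<Longrightarrow> m \<le> A \<Longrightarrow> m \<le> B \<Longrightarrow>
     (\<forall>y\<in>{T/2..3*T/2}. norm (barnes_zeta r a w (Complex ?\<alpha> y)) \<le> A \<and> norm (barnes_zeta r a w (Complex \<beta> y)) \<le> B) \<Longrightarrow>
     ?\<alpha> \<le> \<sigma> \<Longrightarrow> \<sigma> \<le> \<beta> \<Longrightarrow>
     norm (barnes_zeta r a w (Complex \<sigma> T)) \<le> exp ((\<beta> - ?\<alpha>)\<^sup>2) *
       (A powr ((\<beta> - \<sigma>) / (\<beta> - ?\<alpha>)) * B powr ((\<sigma> - ?\<alpha>) / (\<beta> - ?\<alpha>)))"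
    using norm_barnes_zeta_three_lines[of ?\<alpha> "real r + 2"] by blast
  \<comment> \<open>The summand 2 m ensures m \<le> C ln T, because ln T \<ge> 1/2 for T \<ge>
    2.\<close>
  define C where "C = C1 * (3 * 2 powr (1 / 2)) + \<bar>C2\<bar> + 2 * m"
  have "C1 * (3 * 2 powr (1 / 2)) \<ge> 0" using C1(1) by simp
  hence C: "C > 0" "C \<ge> C1 * (3 * 2 powr (1 / 2))" "C \<ge> C2" "C \<ge> 2 * m"
    unfolding C_def using m abs_ge_self[of C2] abs_ge_zero[of C2] by linarith+
  show ?thesis
  proof (intro exI[of _ "exp 9 * (C * exp (1 / 2))"] ballI allI impI)
    fix \<sigma> T :: real assume \<sigma>: "\<sigma> \<in> {real r - 1..real r}" and T: "T \<ge> 2"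
    have "ln 2 \<le> ln T" using T by simp
    hence lnT: "ln T \<ge> 1 / 2" using ln2_ge_two_thirds by linarith
    define \<delta> where "\<delta> = 1 / ln T"
    have \<delta>: "0 < \<delta>" "\<delta> \<le> 2" using lnT by (auto simp: \<delta>_def field_simps)
    define \<beta> where "\<beta> = real r + \<delta>"
    define A where "A = C * ln T * T powr (1 / 2)"
    define B where "B = C * ln T"
    have B0: "B > 0" using C lnT by (simp add: B_def)
    have mB: "m \<le> B" using C lnT mult_mono[of "2 * m" C "1 / 2" "ln T"] m by (simp add: B_def)
    have "1 \<le> T powr (1 / 2)" using T by (intro ge_one_powr_ge_zero) auto
    hence mA: "m \<le> A" using mB B0 mult_left_mono[of 1 "T powr (1 / 2)" B] by (simp add: A_def B_def)
    define \<theta> where "\<theta> = (\<beta> - \<sigma>) / (\<beta> - ?\<alpha>)"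
    have \<theta>: "(\<sigma> - ?\<alpha>) / (\<beta> - ?\<alpha>) = 1 - \<theta>" using \<delta> by (simp add: \<theta>_def \<beta>_def field_simps)
    have \<theta>_le: "\<theta> \<le> real r - \<sigma> + \<delta>"
    proof -
      have "\<theta> \<le> (\<beta> - \<sigma>) / 1" unfolding \<theta>_def using \<delta> \<sigma> by (intro divide_left_mono) (auto simp: \<beta>_def)
      thus ?thesis by (simp add: \<beta>_def)
    qed
    have "norm (barnes_zeta r a w (Complex \<sigma> T)) \<le> exp ((\<beta> - ?\<alpha>)\<^sup>2) *
       (A powr ((\<beta> - \<sigma>) / (\<beta> - ?\<alpha>)) * B powr ((\<sigma> - ?\<alpha>) / (\<beta> - ?\<alpha>)))"
    proof (rule three[OF _ _ T mA mB])
      show "\<forall>y\<in>{T/2..3*T/2}. norm (barnes_zeta r a w (Complex ?\<alpha> y)) \<le> A \<and> norm (barnes_zeta r a w (Complex \<beta> y)) \<le> B"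
      proof (intro ballI conjI)
        fix y assume y: "y \<in> {T/2..3*T/2}"
        have "norm (barnes_zeta r a w (Complex ?\<alpha> y)) \<le> C1 * (y powr (1 / 2) * ln (y + 2))"
          using y T by (intro C1(2)) auto
        also have "\<dots> \<le> C1 * (3 * 2 powr (1 / 2) * (T powr (1 / 2) * ln T))"
          using y T C1(1) by (intro mult_left_mono powr_mult_ln_le) auto
        also have "\<dots> = (C1 * (3 * 2 powr (1 / 2))) * (T powr (1 / 2) * ln T)" by simp
        also have "\<dots> \<le> C * (T powr (1 / 2) * ln T)" using C lnT by (intro mult_right_mono) auto
        finally show "norm (barnes_zeta r a w (Complex ?\<alpha> y)) \<le> A" by (simp add: A_def mult_ac)
        have "norm (barnes_zeta r a w (Complex \<beta> y)) \<le> C2 / (\<beta> - real r)"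
          using \<delta> by (intro C2) (auto simp: \<beta>_def)
        also have "\<dots> = C2 * ln T" by (simp add: \<beta>_def \<delta>_def)
        also have "\<dots> \<le> B" unfolding B_def using C lnT by (intro mult_right_mono) auto
        finally show "norm (barnes_zeta r a w (Complex \<beta> y)) \<le> B" .
      qed
    qed (use \<delta> \<sigma> in \<open>auto simp: \<beta>_def\<close>)
    also have "A powr ((\<beta> - \<sigma>) / (\<beta> - ?\<alpha>)) * B powr ((\<sigma> - ?\<alpha>) / (\<beta> - ?\<alpha>)) = B * T powr (\<theta> / 2)"
    proof -
      have "A powr \<theta> * B powr (1 - \<theta>) = (B * T powr (1 / 2)) powr \<theta> * B powr (1 - \<theta>)" by (simp add: A_def B_def)
      also have "\<dots> = (B powr \<theta> * B powr (1 - \<theta>)) * T powr (\<theta> / 2)"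
        using B0 by (simp add: powr_mult powr_powr)
      also have "B powr \<theta> * B powr (1 - \<theta>) = B" using B0 by (simp flip: powr_add)
      finally show ?thesis unfolding \<theta> by (simp add: \<theta>_def)
    qed
    also have "exp ((\<beta> - ?\<alpha>)\<^sup>2) * (B * T powr (\<theta> / 2)) \<le> exp 9 * (B * (T powr ((real r - \<sigma>) / 2) * exp (1 / 2)))"
    proof (intro mult_mono mult_left_mono)
      \<comment> \<open>The width of the strip is 1 + \<delta> \<le> 3; this is the origin of exp
        9.\<close>
      have "(\<beta> - ?\<alpha>)\<^sup>2 \<le> 3\<^sup>2" using \<delta> by (intro power_mono) (auto simp: \<beta>_def)
      thus "exp ((\<beta> - ?\<alpha>)\<^sup>2) \<le> exp 9" by simp
      have "\<theta> / 2 \<le> (real r - \<sigma>) / 2 + \<delta> / 2"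
        using divide_right_mono[OF \<theta>_le, of 2] by (simp add: add_divide_distrib)
      hence "T powr (\<theta> / 2) \<le> T powr ((real r - \<sigma>) / 2 + \<delta> / 2)" using T by (intro powr_mono) auto
      also have "\<dots> = T powr ((real r - \<sigma>) / 2) * T powr (\<delta> / 2)" by (rule powr_add)
      also have "T powr (\<delta> / 2) = exp (1 / 2)" using T lnT by (simp add: powr_def \<delta>_def)
      finally show "T powr (\<theta> / 2) \<le> T powr ((real r - \<sigma>) / 2) * exp (1 / 2)" .
    qed (use B0 in auto)
    also have "\<dots> = exp 9 * (C * exp (1 / 2)) * (T powr ((real r - \<sigma>) / 2) * ln T)" by (simp add: B_def)
    finally show "norm (barnes_zeta r a w (Complex \<sigma> T)) \<le> exp 9 * (C * exp (1 / 2)) * (T powr ((real r - \<sigma>) / 2) * ln T)" by simp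
  qed
qed

text \<open>The exponents j + 3/2 and j + 1/2 on the two sides already lie on the line r - \<sigma>
  - 1/2, so linear interpolation reproduces it with the logarithm unchanged. The factor exp 1 comes
  from the width 1.\<close>

lemma norm_barnes_zeta_unit_strip_le:
  "\<exists>C\<ge>0. \<forall>\<sigma>\<in>{real r - 2 - real j..real r - 1 - real j}. \<forall>t\<ge>2.
     norm (barnes_zeta r a w (Complex \<sigma> t)) \<le> C * (t powr (real r - \<sigma> - 1 / 2) * ln t)"
proof -
  let ?\<alpha> = "real r - 2 - real j" and ?\<beta> = "real r - 1 - real j"
  let ?p = "real j + 3 / 2" and ?q = "real j + 1 / 2"
  have ps: "real r - 1 - real (Suc j) = ?\<alpha>" "real (Suc j) + 1 / 2 = ?p" by simp_all
  obtain C1 where C1: "C1 \<ge> 0" "\<And>t. t \<ge> 1 \<Longrightarrow> norm (barnes_zeta r a w (Complex ?\<alpha> t)) \<le> C1 * (t powr ?p * ln (t + 2))"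
    using norm_barnes_zeta_line_le[of "Suc j"] unfolding ps by blast
  obtain C2 where C2: "C2 \<ge> 0" "\<And>t. t \<ge> 1 \<Longrightarrow> norm (barnes_zeta r a w (Complex ?\<beta> t)) \<le> C2 * (t powr ?q * ln (t + 2))"
    using norm_barnes_zeta_line_le[of j] by blast
  obtain m where m: "m > 0" and three: "\<And>\<beta> T A B \<sigma>. ?\<alpha> < \<beta> \<Longrightarrow> \<beta> \<le> ?\<beta> \<Longrightarrow> T \<ge> 2 \<Longrightarrow> m \<le> A \<Longrightarrow> m \<le> B \<Longrightarrow>
     (\<forall>y\<in>{T/2..3*T/2}. norm (barnes_zeta r a w (Complex ?\<alpha> y)) \<le> A \<and> norm (barnes_zeta r a w (Complex \<beta> y)) \<le> B) \<Longrightarrow>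
     ?\<alpha> \<le> \<sigma> \<Longrightarrow> \<sigma> \<le> \<beta> \<Longrightarrow>
     norm (barnes_zeta r a w (Complex \<sigma> T)) \<le> exp ((\<beta> - ?\<alpha>)\<^sup>2) *
       (A powr ((\<beta> - \<sigma>) / (\<beta> - ?\<alpha>)) * B powr ((\<sigma> - ?\<alpha>) / (\<beta> - ?\<alpha>)))"
    using norm_barnes_zeta_three_lines[of ?\<alpha> ?\<beta>] by blast
  define C where "C = C1 * (3 * 2 powr ?p) + C2 * (3 * 2 powr ?q) + 2 * m"
  have "C1 * (3 * 2 powr ?p) \<ge> 0" "C2 * (3 * 2 powr ?q) \<ge> 0" using C1(1) C2(1) by simp_all
  hence C: "C > 0" "C \<ge> C1 * (3 * 2 powr ?p)" "C \<ge> C2 * (3 * 2 powr ?q)" "C \<ge> 2 * m"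
    unfolding C_def using m by linarith+
  show ?thesis
  proof (intro exI[of _ "exp 1 * C"] conjI ballI allI impI)
    show "exp 1 * C \<ge> 0" using C by simp
    fix \<sigma> T :: real assume \<sigma>: "\<sigma> \<in> {?\<alpha>..?\<beta>}" and T: "T \<ge> 2"
    have "ln 2 \<le> ln T" using T by simp
    hence lnT: "ln T \<ge> 1 / 2" using ln2_ge_two_thirds by linarith
    define L where "L = C * ln T"
    have L0: "L > 0" using C lnT by (simp add: L_def)
    have mL: "m \<le> L" using C lnT mult_mono[of "2 * m" C "1 / 2" "ln T"] m by (simp add: L_def)
    have mLp: "m \<le> L * T powr p" if "p \<ge> 0" for p
    proof -
      have "1 \<le> T powr p" using T that by (intro ge_one_powr_ge_zero) auto
      hence "L * 1 \<le> L * T powr p" using L0 by (intro mult_left_mono) auto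
      thus ?thesis using mL by linarith
    qed
    have "norm (barnes_zeta r a w (Complex \<sigma> T)) \<le> exp ((?\<beta> - ?\<alpha>)\<^sup>2) *
       ((L * T powr ?p) powr ((?\<beta> - \<sigma>) / (?\<beta> - ?\<alpha>)) * (L * T powr ?q) powr ((\<sigma> - ?\<alpha>) / (?\<beta> - ?\<alpha>)))"
    proof (rule three[OF _ _ T mLp mLp])
      have side: "norm (barnes_zeta r a w (Complex c y)) \<le> L * T powr p"
        if y: "y \<in> {T/2..3*T/2}" and p: "p \<ge> 0" and K: "K \<ge> 0" "K * (3 * 2 powr p) \<le> C"
          and le: "\<And>t. t \<ge> 1 \<Longrightarrow> norm (barnes_zeta r a w (Complex c t)) \<le> K * (t powr p * ln (t + 2))" for c y p K
      proof -
        have "norm (barnes_zeta r a w (Complex c y)) \<le> K * (y powr p * ln (y + 2))"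
          using y T by (intro le) auto
        also have "\<dots> \<le> K * (3 * 2 powr p * (T powr p * ln T))"
          using y T K(1) p by (intro mult_left_mono powr_mult_ln_le) auto
        also have "\<dots> = (K * (3 * 2 powr p)) * (T powr p * ln T)" by simp
        also have "\<dots> \<le> C * (T powr p * ln T)" using K lnT by (intro mult_right_mono) auto
        finally show ?thesis by (simp add: L_def mult_ac)
      qed
      show "\<forall>y\<in>{T/2..3*T/2}. norm (barnes_zeta r a w (Complex ?\<alpha> y)) \<le> L * T powr ?p \<and> norm (barnes_zeta r a w (Complex ?\<beta> y)) \<le> L * T powr ?q"
        using side[OF _ _ C1(1) C(2) C1(2)] side[OF _ _ C2(1) C(3) C2(2)] by auto
    qed (use \<sigma> in auto)
    also have "?\<beta> - ?\<alpha> = 1" by simp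
    also have "(L * T powr ?p) powr ((?\<beta> - \<sigma>) / 1) * (L * T powr ?q) powr ((\<sigma> - ?\<alpha>) / 1) =
        (L powr (?\<beta> - \<sigma>) * L powr (\<sigma> - ?\<alpha>)) * (T powr (?p * (?\<beta> - \<sigma>)) * T powr (?q * (\<sigma> - ?\<alpha>)))"
      using L0 T by (simp add: powr_mult powr_powr)
    also have "L powr (?\<beta> - \<sigma>) * L powr (\<sigma> - ?\<alpha>) = L powr 1"
      unfolding powr_add[symmetric] by (rule arg_cong[where f = "(powr) L"]) simp
    also have "L powr 1 = L" using L0 by simp
    also have "T powr (?p * (?\<beta> - \<sigma>)) * T powr (?q * (\<sigma> - ?\<alpha>)) = T powr (real r - \<sigma> - 1 / 2)"
      unfolding powr_add[symmetric] by (rule arg_cong[where f = "(powr) T"]) (simp add: algebra_simps)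
    finally show "norm (barnes_zeta r a w (Complex \<sigma> T)) \<le> exp 1 * C * (T powr (real r - \<sigma> - 1 / 2) * ln T)"
      by (simp add: L_def mult_ac)
  qed
qed

text \<open>Finitely many unit strips cover the range, and the sum of their nonnegative constants
  dominates each of them.\<close>

lemma norm_barnes_zeta_left_le:
  "\<exists>C. \<forall>\<sigma>\<in>{\<sigma>\<^sub>0..real r - 1}. \<forall>t\<ge>2.
     norm (barnes_zeta r a w (Complex \<sigma> t)) \<le> C * (t powr (real r - \<sigma> - 1 / 2) * ln t)"
proof -
  obtain C where C: "\<And>j. C j \<ge> 0" "\<And>j \<sigma> t. \<sigma> \<in> {real r - 2 - real j..real r - 1 - real j} \<Longrightarrow> t \<ge> 2 \<Longrightarrow>
     norm (barnes_zeta r a w (Complex \<sigma> t)) \<le> C j * (t powr (real r - \<sigma> - 1 / 2) * ln t)"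
    using norm_barnes_zeta_unit_strip_le by metis
  define n where "n = nat \<lfloor>real r - 1 - \<sigma>\<^sub>0\<rfloor>"
  show ?thesis
  proof (intro exI[of _ "\<Sum>j\<le>n. C j"] ballI allI impI)
    fix \<sigma> t :: real assume \<sigma>: "\<sigma> \<in> {\<sigma>\<^sub>0..real r - 1}" and t: "t \<ge> 2"
    define j where "j = nat \<lfloor>real r - 1 - \<sigma>\<rfloor>"
    have j: "j \<le> n" unfolding j_def n_def using \<sigma> by (intro nat_mono floor_mono) auto
    have "\<sigma> \<in> {real r - 2 - real j..real r - 1 - real j}" unfolding j_def using \<sigma> by auto linarith+
    from C(2)[OF this t] have "norm (barnes_zeta r a w (Complex \<sigma> t)) \<le> C j * (t powr (real r - \<sigma> - 1 / 2) * ln t)" .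
    also have "\<dots> \<le> (\<Sum>j\<le>n. C j) * (t powr (real r - \<sigma> - 1 / 2) * ln t)"
      using j C(1) t by (intro mult_right_mono member_le_sum) auto
    finally show "norm (barnes_zeta r a w (Complex \<sigma> t)) \<le> (\<Sum>j\<le>n. C j) * (t powr (real r - \<sigma> - 1 / 2) * ln t)" .
  qed
qed

lemma norm_barnes_zeta_absolute_le:
  assumes "\<sigma>\<^sub>1 > real r"
  shows "\<exists>C. \<forall>\<sigma>\<in>{\<sigma>\<^sub>1..\<sigma>\<^sub>2}. \<forall>t. norm (barnes_zeta r a w (Complex \<sigma> t)) \<le> C"
proof -
  obtain C where C: "\<And>c t. real r < c \<Longrightarrow> c \<le> \<sigma>\<^sub>2 \<Longrightarrow> norm (barnes_zeta r a w (Complex c t)) \<le> C / (c - real r)"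
    using norm_barnes_zeta_right_le by blast
  show ?thesis
  proof (intro exI[of _ "\<bar>C\<bar> / (\<sigma>\<^sub>1 - real r)"] ballI allI)
    fix \<sigma> t assume \<sigma>: "\<sigma> \<in> {\<sigma>\<^sub>1..\<sigma>\<^sub>2}"
    have "norm (barnes_zeta r a w (Complex \<sigma> t)) \<le> C / (\<sigma> - real r)" using \<sigma> assms by (intro C) auto
    also have "\<dots> \<le> \<bar>C\<bar> / (\<sigma>\<^sub>1 - real r)" using \<sigma> assms by (intro frac_le) auto
    finally show "norm (barnes_zeta r a w (Complex \<sigma> t)) \<le> \<bar>C\<bar> / (\<sigma>\<^sub>1 - real r)" .
  qed
qed

end

text \<open>The constants are uniform in \<sigma> on bounded ranges. In the first case
  \<open>\<sigma>\<^sub>1\<close> keeps away from r, where the bound from absolute convergence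
  degenerates like 1/(\<sigma> - r), and \<open>\<sigma>\<^sub>2\<close> is there because for a < 1
  the term a^(- s) of the series is unbounded as \<sigma> grows. In the third case the constant
  depends on how many unit strips are crossed.\<close>

theorem theorem1p4:
  fixes r :: nat and a :: real and w :: "nat \<Rightarrow> real"
  assumes "r > 0" and "a > 0" and "\<And>i. i < r \<Longrightarrow> w i > 0"
  shows "(\<forall>\<sigma>\<^sub>1 > real r. \<forall>\<sigma>\<^sub>2. \<exists>C. \<forall>\<sigma> \<in> {\<sigma>\<^sub>1..\<sigma>\<^sub>2}. \<forall>t \<ge> 2.
            norm (barnes_zeta r a w (Complex \<sigma> t)) \<le> C)
       \<and> (\<exists>C. \<forall>\<sigma> \<in> {real r - 1<..real r}. \<forall>t \<ge> 2.
            norm (barnes_zeta r a w (Complex \<sigma> t)) \<le> C * (t powr ((real r - \<sigma>) / 2) * ln t))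
       \<and> (\<forall>\<sigma>\<^sub>0. \<exists>C. \<forall>\<sigma> \<in> {\<sigma>\<^sub>0..real r - 1}. \<forall>t \<ge> 2.
            norm (barnes_zeta r a w (Complex \<sigma> t)) \<le> C * (t powr (real r - \<sigma> - 1 / 2) * ln t))"
proof -
  interpret barnes r a w by unfold_locales (use assms in auto)
  show ?thesis
  proof (intro conjI allI impI)
    fix \<sigma>\<^sub>1 \<sigma>\<^sub>2 assume "\<sigma>\<^sub>1 > real r"
    from norm_barnes_zeta_absolute_le[OF this]
    show "\<exists>C. \<forall>\<sigma> \<in> {\<sigma>\<^sub>1..\<sigma>\<^sub>2}. \<forall>t \<ge> 2. norm (barnes_zeta r a w (Complex \<sigma> t)) \<le> C" by blast
  next
    from norm_barnes_zeta_right_strip_le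
    show "\<exists>C. \<forall>\<sigma> \<in> {real r - 1<..real r}. \<forall>t \<ge> 2.
            norm (barnes_zeta r a w (Complex \<sigma> t)) \<le> C * (t powr ((real r - \<sigma>) / 2) * ln t)"
      by (meson greaterThanAtMost_subseteq_atLeastAtMost_iff order_refl subsetD)
  next
    fix \<sigma>\<^sub>0
    show "\<exists>C. \<forall>\<sigma> \<in> {\<sigma>\<^sub>0..real r - 1}. \<forall>t \<ge> 2.
            norm (barnes_zeta r a w (Complex \<sigma> t)) \<le> C * (t powr (real r - \<sigma> - 1 / 2) * ln t)"
      by (rule norm_barnes_zeta_left_le)
  qed
qed

end
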